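(* Fix constants $R^\star,\varepsilon,\eta,B>0$. There exists $n_0=n_0(\varepsilon,\eta,R^\star,B)$ such that for every $n\ge n_0$ there exist a rate $R\le R^\star+\varepsilon$, an encoder $f:\mathbb R^n\times\mathbb S^n_+\times[0,1]\to\{1,\dots,\lfloor 2^{nR}\rfloor\}$ and a decoder $g:\{1,\dots,\lfloor2^{nR}\rfloor\}\times[0,1]\to\mathbb R^n$ with the following property. Let $S\sim\mathrm{Unif}[0,1]$ (shared randomness), $W\sim\mathcal N(0,I_n)$ independent of $S$, and $\widehat W(\Sigma)=g(f(W,\Sigma,S),S)$. Then with probability at least $1-\exp(-n^B)$ over $S$, simultaneously for all $\Sigma\in\mathbb S^n_+$ with $\mathrm{tr}\,\Sigma=n$, $$\frac1n\,\mathbb E_W\big[d_\Sigma(W,\widehat W(\Sigma))\big]\ \le\ \mathbf D_{\mathrm{rc}}(\mathrm{spec}(\Sigma),R^\star)+\eta .$$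
   Context: $\mathbb S^n_+$ is the set of positive semidefinite $n\times n$ matrices; $\mathrm{spec}(\Sigma)\in\mathbb R^n_{\ge0}$ is the vector of eigenvalues of $\Sigma$. For $w,\hat w\in\mathbb R^n$, $d_\Sigma(w,\hat w)=(w-\hat w)^\top\Sigma(w-\hat w)$. Logarithms are base 2. For $\lambda\in\mathbb R^n_{\ge0}$, $\lambda\neq0$, and $R>0$, let $T^\lambda_{\mathrm{rc}}(R)$ be the unique $T>0$ with $\frac1{2n}\sum_{i=1}^n\log(1+\lambda_iT)=R$, and define $\mathbf D_{\mathrm{rc}}(\lambda,R)=\frac1n\sum_{i=1}^n\frac{\lambda_i}{1+\lambda_iT^\lambda_{\mathrm{rc}}(R)}$. The expectation $\mathbb E_W$ is over $W$ only, with $S$ fixed. *)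

theory Defs
  imports "HOL-Probability.Probability" "Jordan_Normal_Form.Matrix" "Jordan_Normal_Form.Char_Poly"
begin

definition psd_mat :: "nat \<Rightarrow> real mat \<Rightarrow> bool" where
  "psd_mat n A \<longleftrightarrow> A \<in> carrier_mat n n \<and> transpose_mat A = A \<and>
     (\<forall>v \<in> carrier_vec n. scalar_prod v (A *\<^sub>v v) \<ge> 0)"

definition mat_trace :: "real mat \<Rightarrow> real" where
  "mat_trace A = (\<Sum>i<dim_row A. A $$ (i, i))"

definition spec :: "real mat \<Rightarrow> real multiset" where
  "spec A = proots (char_poly A)"

definition d_Sigma :: "real mat \<Rightarrow> real vec \<Rightarrow> real vec \<Rightarrow> real" where
  "d_Sigma S w w' = scalar_prod (w - w') (S *\<^sub>v (w - w'))"

definition T_rc :: "real multiset \<Rightarrow> real \<Rightarrow> real" where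
  "T_rc lam R = (THE T. T > 0 \<and>
      (1 / (2 * real (size lam))) * (\<Sum>l\<in>#lam. log 2 (1 + l * T)) = R)"

definition D_rc :: "real multiset \<Rightarrow> real \<Rightarrow> real" where
  "D_rc lam R = (1 / real (size lam)) * (\<Sum>l\<in>#lam. l / (1 + l * T_rc lam R))"

definition gauss_n :: "nat \<Rightarrow> (nat \<Rightarrow> real) measure" where
  "gauss_n n = PiM {..<n} (\<lambda>_. density lborel std_normal_density)"

end

theory Submission
  imports Defs "Jordan_Normal_Form.Schur_Decomposition" "HOL-Real_Asymp.Real_Asymp"
begin

text \<open>Shared randomness is not needed: a random codebook is good for all \<open>\<Sigma>\<close> at once with positive
  probability, so one deterministic good codebook serves every seed.

  For fixed \<open>\<Sigma>\<close> with eigenvalues \<open>\<lambda> i\<close> put \<open>a i = T * \<lambda> i / (1 + T * \<lambda> i)\<close>. A Gaussian codeword of variance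
  \<open>\<sigma>\<^sup>2\<close>, the ratio of the sums of \<open>(a i)\<^sup>2\<close> and \<open>a i\<close>, lies within the target distortion of a typical
  source word with probability about \<open>2 powr (- n * R)\<close>, by a change of measure to the optimal test
  channel. The codeword law is rotation invariant and \<open>\<sigma>\<^sup>2 \<le> 1\<close> only has to be known up to a small
  \<open>\<delta>\<close>, so the union of about \<open>1 / \<delta>\<close> scalings of a single Gaussian codebook serves every \<open>\<Sigma>\<close>. With
  \<open>M\<close> slightly above \<open>2 powr (n * R)\<close> codewords the failure probability for one \<open>\<Sigma>\<close> is doubly
  exponentially small, which beats the \<open>exp (O (n ^ 3))\<close> matrices of an exponentially fine net.
  Untypical source words are encoded by the zero codeword.\<close>

section \<open>Gaussian measure: affine maps and rotations\<close>

text \<open>The decoder does not know \<Sigma>, so codewords cannot carry the covariance of the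
  optimal reproduction. Isotropic ones of variance \<open>\<sigma>\<^sup>2\<close> add half of
  \<open>(\<Sum>i<n. (a i)\<^sup>2) / \<sigma>\<^sup>2 - (\<Sum>i<n. a i)\<close> to the mean
  log-likelihood ratio and \<open>(\<sigma>\<^sup>2 * (\<Sum>i<n. a i) - (\<Sum>i<n. (a i)\<^sup>2))
  / T\<close> to the mean distortion, and a single \<sigma> annihilates both.

  Uniformity over spectra is the first obstacle, since an eigenvalue may be as large as n. By
  \<open>lam i * (1 - a i) = a i / T\<close> the fluctuations have coefficients bounded in terms of
  the variance step and a lower bound for T, and Chebyshev's inequality makes untypical words O(1/n)
  probable, uniformly in \<Sigma>.

  The second obstacle is the net. Codewords are controlled only through their total energy, so one
  of them may have squared norm of order n * M, exponential in n. The net must be accurate to order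
  1 / (n * M) in each entry, and n^2 entries at this accuracy produce the exponent n^3.\<close>

lemma nn_integral_lborel_PiM_affine:
  fixes t c :: "'i \<Rightarrow> real"
  assumes I: "finite I" and c: "\<And>i. i \<in> I \<Longrightarrow> c i \<noteq> 0"
    and F[measurable]: "F \<in> borel_measurable (PiM I (\<lambda>_. lborel))"
  shows "(\<integral>\<^sup>+x. F x \<partial>PiM I (\<lambda>_. lborel)) =
    ennreal (\<Prod>i\<in>I. \<bar>c i\<bar>) * (\<integral>\<^sup>+x. F (\<lambda>i\<in>I. t i + c i * x i) \<partial>PiM I (\<lambda>_. lborel))"
proof -
  interpret product_sigma_finite "\<lambda>_::'i. lborel :: real measure" ..
  let ?L = "PiM I (\<lambda>_. lborel :: real measure)"
  let ?h = "\<lambda>x. \<lambda>i\<in>I. t i + c i * x i"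
  have h[measurable]: "?h \<in> measurable ?L ?L" by measurable
  let ?P = "scale_measure (ennreal (\<Prod>i\<in>I. \<bar>c i\<bar>)) (distr ?L ?L ?h)"
  \<comment> \<open>Product measures are determined on boxes, where the claim splits into
    one-dimensional affine substitutions.\<close>
  have "?P = ?L"
  proof (rule PiM_eqI[OF I])
    show "sets ?P = sets ?L" by simp
    fix A assume A: "\<And>i. i \<in> I \<Longrightarrow> A i \<in> sets (lborel :: real measure)"
    have box: "Pi\<^sub>E I A \<in> sets ?L" using A I by (intro sets_PiM_I_finite) auto
    have vi: "?h -` (Pi\<^sub>E I A) \<inter> space ?L = Pi\<^sub>E I (\<lambda>i. (\<lambda>x. t i + c i * x) -` A i)"
      by (auto simp: space_PiM PiE_iff)
    have "emeasure ?P (Pi\<^sub>E I A) = ennreal (\<Prod>i\<in>I. \<bar>c i\<bar>) * (\<Prod>i\<in>I. emeasure lborel ((\<lambda>x. t i + c i * x) -` A i))"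
    proof -
      have "(\<lambda>x. t i + c i * x) -` A i \<in> sets lborel" if "i \<in> I" for i
        using A[OF that] by (auto intro!: measurable_sets_borel[of _ borel])
      then show ?thesis using A box I by (simp add: emeasure_distr vi emeasure_PiM)
    qed
    also have "\<dots> = (\<Prod>i\<in>I. ennreal \<bar>c i\<bar> * emeasure lborel ((\<lambda>x. t i + c i * x) -` A i))"
      by (simp add: prod.distrib prod_ennreal)
    also have "\<dots> = (\<Prod>i\<in>I. emeasure lborel (A i))"
    proof (rule prod.cong[OF refl])
      fix i assume i: "i \<in> I"
      have "emeasure lborel (A i) = (\<integral>\<^sup>+x. indicator (A i) x \<partial>lborel)" using A[OF i] by simp
      also have "\<dots> = ennreal \<bar>c i\<bar> * (\<integral>\<^sup>+x. indicator (A i) (t i + c i * x) \<partial>lborel)"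
        using A[OF i] by (intro nn_integral_real_affine c i) simp
      also have "(\<integral>\<^sup>+x. indicator (A i) (t i + c i * x) \<partial>lborel) = (\<integral>\<^sup>+x. indicator ((\<lambda>x. t i + c i * x) -` A i) x \<partial>lborel)"
        by (intro nn_integral_cong) (auto simp: indicator_def)
      also have "\<dots> = emeasure lborel ((\<lambda>x. t i + c i * x) -` A i)"
      proof -
        have "(\<lambda>x. t i + c i * x) -` A i \<in> sets lborel"
          using A[OF i] by (auto intro!: measurable_sets_borel[of _ borel])
        then show ?thesis by simp
      qed
      finally show "ennreal \<bar>c i\<bar> * emeasure lborel ((\<lambda>x. t i + c i * x) -` A i) = emeasure lborel (A i)" by simp
    qed
    finally show "emeasure ?P (Pi\<^sub>E I A) = (\<Prod>i\<in>I. emeasure lborel (A i))" .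
  qed
  then have "(\<integral>\<^sup>+x. F x \<partial>?L) = (\<integral>\<^sup>+x. F x \<partial>?P)" by simp
  also have "\<dots> = ennreal (\<Prod>i\<in>I. \<bar>c i\<bar>) * (\<integral>\<^sup>+x. F x \<partial>distr ?L ?L ?h)"
    by (rule nn_integral_scale_measure) simp
  also have "(\<integral>\<^sup>+x. F x \<partial>distr ?L ?L ?h) = (\<integral>\<^sup>+x. F (?h x) \<partial>?L)"
    by (rule nn_integral_distr) simp_all
  finally show ?thesis .
qed

abbreviation leb_n :: "nat \<Rightarrow> (nat \<Rightarrow> real) measure" where
  "leb_n n \<equiv> PiM {..<n} (\<lambda>_. lborel)"

definition gauss_density :: "nat \<Rightarrow> (nat \<Rightarrow> real) \<Rightarrow> real" where
  "gauss_density n x = (\<Prod>i<n. std_normal_density (x i))"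

lemma gauss_density_nonneg[simp]: "0 \<le> gauss_density n x" 
  unfolding gauss_density_def by (intro prod_nonneg) auto

lemma measurable_gauss_density[measurable]: "gauss_density n \<in> borel_measurable (leb_n n)"
  unfolding gauss_density_def[abs_def] by measurable

lemma gauss_density_eq: "gauss_density n x = (1 / sqrt (2 * pi)) ^ n * exp (- (\<Sum>i<n. (x i)\<^sup>2) / 2)"
proof -
  have "gauss_density n x = (\<Prod>i<n. 1 / sqrt (2 * pi)) * (\<Prod>i<n. exp (- (x i)\<^sup>2 / 2))"
    unfolding gauss_density_def std_normal_density_def by (rule prod.distrib)
  also have "(\<Prod>i<n. exp (- (x i)\<^sup>2 / 2)) = exp (\<Sum>i<n. - (x i)\<^sup>2 / 2)"
    by (simp add: exp_sum)
  also have "(\<Sum>i<n. - (x i)\<^sup>2 / 2) = - (\<Sum>i<n. (x i)\<^sup>2) / 2"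
    by (simp add: sum_divide_distrib sum_negf)
  finally show ?thesis by simp
qed

lemma sets_gauss_n[measurable_cong]: "sets (gauss_n n) = sets (leb_n n)"
  unfolding gauss_n_def by (rule sets_PiM_cong) auto

lemma prob_space_gauss_n: "prob_space (gauss_n n)"
  unfolding gauss_n_def by (intro prob_space_PiM prob_space_normal_density) simp

text \<open>A density against product Lebesgue measure gives access to affine substitution and
  translation invariance, from which the change of measure and the rotation invariance of
  \<open>gauss_n\<close> are derived.\<close>

lemma gauss_n_eq_density: "gauss_n n = density (leb_n n) (gauss_density n)"
proof -
  interpret N: product_prob_space "\<lambda>_::nat. density lborel std_normal_density"
    by (intro product_prob_spaceI prob_space_normal_density) simp
  interpret L: product_sigma_finite "\<lambda>_::nat. lborel :: real measure" ..
  have "density (leb_n n) (gauss_density n) = PiM {..<n} (\<lambda>_. density lborel std_normal_density)"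
  proof (rule N.PiM_eqI)
    show "sets (density (leb_n n) (gauss_density n)) = sets (PiM {..<n} (\<lambda>_. density lborel std_normal_density))"
      by (simp add: sets_gauss_n flip: gauss_n_def)
    fix A assume "\<And>i. i \<in> {..<n} \<Longrightarrow> A i \<in> sets (density lborel std_normal_density)"
    then have A: "\<And>i. i \<in> {..<n} \<Longrightarrow> A i \<in> sets borel" by simp
    have box: "Pi\<^sub>E {..<n} A \<in> sets (leb_n n)" using A by (intro sets_PiM_I_finite) auto
    have "emeasure (density (leb_n n) (gauss_density n)) (Pi\<^sub>E {..<n} A)
       = (\<integral>\<^sup>+x. ennreal (gauss_density n x) * indicator (Pi\<^sub>E {..<n} A) x \<partial>leb_n n)"
      using box by (simp add: emeasure_density)
    also have "\<dots> = (\<integral>\<^sup>+x. (\<Prod>i<n. ennreal (std_normal_density (x i)) * indicator (A i) (x i)) \<partial>leb_n n)"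
    proof (rule nn_integral_cong)
      fix x assume x: "x \<in> space (leb_n n)"
      have "indicator (Pi\<^sub>E {..<n} A) x = (\<Prod>i<n. indicator (A i) (x i) :: ennreal)"
        using x by (auto simp: indicator_def space_PiM PiE_iff intro!: prod.neutral)
      then show "ennreal (gauss_density n x) * indicator (Pi\<^sub>E {..<n} A) x = (\<Prod>i<n. ennreal (std_normal_density (x i)) * indicator (A i) (x i))"
        by (simp add: gauss_density_def prod.distrib prod_ennreal)
    qed
    also have "\<dots> = (\<Prod>i<n. \<integral>\<^sup>+x. ennreal (std_normal_density x) * indicator (A i) x \<partial>lborel)"
      using A by (intro L.product_nn_integral_prod) auto
    also have "\<dots> = (\<Prod>i<n. emeasure (density lborel std_normal_density) (A i))"
      using A by (intro prod.cong) (auto simp: emeasure_density)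
    finally show "emeasure (density (leb_n n) (gauss_density n)) (Pi\<^sub>E {..<n} A)
       = (\<Prod>i<n. emeasure (density lborel std_normal_density) (A i))" .
  qed simp
  then show ?thesis by (simp add: gauss_n_def)
qed

lemma nn_integral_gauss_n:
  assumes "F \<in> borel_measurable (leb_n n)"
  shows "(\<integral>\<^sup>+x. F x \<partial>gauss_n n) = (\<integral>\<^sup>+x. ennreal (gauss_density n x) * F x \<partial>leb_n n)"
  unfolding gauss_n_eq_density using assms by (intro nn_integral_density) auto

lemma nn_integral_gauss_density: "(\<integral>\<^sup>+x. ennreal (gauss_density n x) \<partial>leb_n n) = 1"
proof -
  interpret prob_space "gauss_n n" by (rule prob_space_gauss_n)
  have "(\<integral>\<^sup>+x. 1 \<partial>gauss_n n) = (\<integral>\<^sup>+x. ennreal (gauss_density n x) * 1 \<partial>leb_n n)"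
    by (rule nn_integral_gauss_n) simp
  then show ?thesis using emeasure_space_1 by simp
qed

text \<open>The exponential factor is the likelihood ratio of the standard Gaussian law to the law
  of \<open>m i + s i * y i\<close>, written in terms of \<open>y\<close>. An exponentially rare
  event for \<open>z\<close> is thus computed where it is typical, under the shifted and scaled
  law.\<close>

lemma gauss_n_change_of_measure:
  assumes s: "\<And>i. i < n \<Longrightarrow> 0 < s i"
    and F[measurable]: "F \<in> borel_measurable (leb_n n)"
  shows "(\<integral>\<^sup>+z. F z \<partial>gauss_n n) =
    (\<integral>\<^sup>+y. F (\<lambda>i\<in>{..<n}. m i + s i * y i) *
       ennreal (exp (- (\<Sum>i<n. - ln (s i) + ((m i + s i * y i)\<^sup>2 - (y i)\<^sup>2) / 2))) \<partial>gauss_n n)"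
proof -
  let ?h = "\<lambda>y. \<lambda>i\<in>{..<n}. m i + s i * y i"
  let ?LL = "\<lambda>y. \<Sum>i<n. - ln (s i) + ((m i + s i * y i)\<^sup>2 - (y i)\<^sup>2) / 2"
  have h[measurable]: "?h \<in> measurable (leb_n n) (leb_n n)" by measurable
  have LL[measurable]: "(\<lambda>y. exp (- ?LL y)) \<in> borel_measurable (leb_n n)" by measurable
  have ps: "(\<Prod>i<n. \<bar>s i\<bar>) = (\<Prod>i<n. s i)" using s by (intro prod.cong) (auto simp: less_imp_le)
  have e: "exp (\<Sum>i<n. ln (s i)) = (\<Prod>i<n. s i)"
    unfolding exp_sum[OF finite_lessThan] using s by (intro prod.cong) auto
  have pw: "(\<Prod>i<n. s i) * gauss_density n (?h y) = gauss_density n y * exp (- ?LL y)" for y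
  proof -
    have "(\<Sum>i<n. ln (s i)) + - (\<Sum>i<n. (?h y i)\<^sup>2) / 2 = - (\<Sum>i<n. (y i)\<^sup>2) / 2 + - ?LL y"
      by (simp add: sum.distrib sum_negf sum_subtractf diff_divide_distrib flip: sum_divide_distrib)
    then have "exp (\<Sum>i<n. ln (s i)) * exp (- (\<Sum>i<n. (?h y i)\<^sup>2) / 2) = exp (- (\<Sum>i<n. (y i)\<^sup>2) / 2) * exp (- ?LL y)"
      unfolding exp_add[symmetric] by (rule arg_cong)
    then show ?thesis unfolding gauss_density_eq e by (simp add: mult.assoc mult.left_commute)
  qed
  have "(\<integral>\<^sup>+z. F z \<partial>gauss_n n) = (\<integral>\<^sup>+x. ennreal (gauss_density n x) * F x \<partial>leb_n n)"
    by (rule nn_integral_gauss_n) simp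
  also have "\<dots> = ennreal (\<Prod>i<n. \<bar>s i\<bar>) * (\<integral>\<^sup>+x. ennreal (gauss_density n (?h x)) * F (?h x) \<partial>leb_n n)"
    using s by (intro nn_integral_lborel_PiM_affine) (auto, fastforce)
  also have "\<dots> = (\<integral>\<^sup>+x. ennreal (\<Prod>i<n. s i) * (ennreal (gauss_density n (?h x)) * F (?h x)) \<partial>leb_n n)"
    unfolding ps by (rule nn_integral_cmult[symmetric]) measurable
  also have "\<dots> = (\<integral>\<^sup>+x. ennreal (gauss_density n x) * (F (?h x) * ennreal (exp (- ?LL x))) \<partial>leb_n n)"
  proof (rule nn_integral_cong)
    fix x
    have "0 \<le> (\<Prod>i<n. s i)" using s by (intro prod_nonneg) (auto simp: less_imp_le)
    then have "ennreal (\<Prod>i<n. s i) * ennreal (gauss_density n (?h x)) = ennreal (gauss_density n x) * ennreal (exp (- ?LL x))"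
      using pw[of x] by (simp flip: ennreal_mult)
    then show "ennreal (\<Prod>i<n. s i) * (ennreal (gauss_density n (?h x)) * F (?h x)) = ennreal (gauss_density n x) * (F (?h x) * ennreal (exp (- ?LL x)))"
      by (simp only: mult.assoc[symmetric]) (simp only: mult.assoc mult.commute[of _ "F (?h x)"])
  qed
  also have "\<dots> = (\<integral>\<^sup>+y. F (?h y) * ennreal (exp (- ?LL y)) \<partial>gauss_n n)"
    by (rule nn_integral_gauss_n[symmetric]) measurable
  finally show ?thesis .
qed

section \<open>Orthogonal maps and rotation invariance of the Gaussian measure\<close>

definition lin_n :: "nat \<Rightarrow> (nat \<Rightarrow> nat \<Rightarrow> real) \<Rightarrow> (nat \<Rightarrow> real) \<Rightarrow> nat \<Rightarrow> real" where
  "lin_n n V x = (\<lambda>i\<in>{..<n}. \<Sum>k<n. V i k * x k)"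

text \<open>Both relations are recorded: orthonormal columns preserve the norm, orthonormal rows
  make the transpose a right inverse.\<close>

definition orth_n :: "nat \<Rightarrow> (nat \<Rightarrow> nat \<Rightarrow> real) \<Rightarrow> bool" where
  "orth_n n V \<longleftrightarrow>
     (\<forall>i<n. \<forall>j<n. (\<Sum>k<n. V i k * V j k) = of_bool (i = j)) \<and>
     (\<forall>i<n. \<forall>j<n. (\<Sum>k<n. V k i * V k j) = of_bool (i = j))"

lemma measurable_lin_n[measurable]: "lin_n n V \<in> measurable (leb_n n) (leb_n n)"
  unfolding lin_n_def[abs_def] by measurable

lemma orth_n_norm:
  assumes "orth_n n V"
  shows "(\<Sum>i<n. (lin_n n V x i)\<^sup>2) = (\<Sum>i<n. (x i)\<^sup>2)"
proof -
  have "(\<Sum>i<n. (lin_n n V x i)\<^sup>2) = (\<Sum>i<n. \<Sum>k<n. \<Sum>l<n. (V i k * x k) * (V i l * x l))"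
    by (simp add: lin_n_def power2_eq_square sum_product)
  also have "\<dots> = (\<Sum>k<n. \<Sum>i<n. \<Sum>l<n. (V i k * x k) * (V i l * x l))" by (rule sum.swap)
  also have "\<dots> = (\<Sum>k<n. \<Sum>l<n. \<Sum>i<n. (V i k * x k) * (V i l * x l))"
    by (rule sum.cong[OF refl]) (rule sum.swap)
  also have "\<dots> = (\<Sum>k<n. \<Sum>l<n. (x k * x l) * (\<Sum>i<n. V i k * V i l))"
    unfolding sum_distrib_left by (intro sum.cong refl) (simp add: ac_simps)
  also have "\<dots> = (\<Sum>k<n. \<Sum>l<n. if k = l then (x k)\<^sup>2 else 0)"
    using assms by (intro sum.cong refl) (auto simp: orth_n_def power2_eq_square)
  also have "\<dots> = (\<Sum>i<n. (x i)\<^sup>2)" by (simp add: sum.delta)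
  finally show ?thesis .
qed

lemma orth_n_cancel:
  assumes "orth_n n V" "i < n"
  shows "lin_n n V (lin_n n (\<lambda>i j. V j i) y) i = y i"
proof -
  have "lin_n n V (lin_n n (\<lambda>i j. V j i) y) i = (\<Sum>k<n. \<Sum>l<n. V i k * (V l k * y l))"
    using assms by (simp add: lin_n_def sum_distrib_left)
  also have "\<dots> = (\<Sum>l<n. \<Sum>k<n. V i k * (V l k * y l))" by (rule sum.swap)
  also have "\<dots> = (\<Sum>l<n. y l * (\<Sum>k<n. V i k * V l k))"
    unfolding sum_distrib_left by (intro sum.cong refl) (simp add: ac_simps)
  also have "\<dots> = (\<Sum>l<n. if l = i then y i else 0)"
    using assms by (intro sum.cong refl) (auto simp: orth_n_def)
  also have "\<dots> = y i" using assms by simp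
  finally show ?thesis .
qed

text \<open>The double integral of \<open>F (T x) * g (y + T x)\<close>, where \<open>g\<close> is the Gaussian density and \<open>F\<close>
  absorbs another copy of it, is evaluated with either variable integrated first: this is the
  uniqueness argument for translation-invariant measures, normalised by the rotation invariance
  of \<open>g\<close>.\<close>

lemma nn_integral_gauss_n_orth:
  assumes V: "orth_n n V" and F[measurable]: "F \<in> borel_measurable (leb_n n)"
  shows "(\<integral>\<^sup>+x. F (lin_n n V x) \<partial>gauss_n n) = (\<integral>\<^sup>+x. F x \<partial>gauss_n n)"
proof -
  interpret L: product_sigma_finite "\<lambda>_::nat. lborel :: real measure" ..
  interpret S: sigma_finite_measure "leb_n n" by (rule L.sigma_finite) simp
  interpret P: pair_sigma_finite "leb_n n" "leb_n n" ..
  let ?T = "lin_n n V"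
  let ?T' = "lin_n n (\<lambda>i j. V j i)"
  define G where "G x = ennreal (gauss_density n x) * F x" for x
  have G[measurable]: "G \<in> borel_measurable (leb_n n)" unfolding G_def[abs_def] by measurable
  define add where "add x y = (\<lambda>i\<in>{..<n}. x i + 1 * y i)" for x y :: "nat \<Rightarrow> real"
  define sub where "sub x y = (\<lambda>i\<in>{..<n}. x i + (-1) * y i)" for x y :: "nat \<Rightarrow> real"
  have add[measurable]: "case_prod add \<in> measurable (leb_n n \<Otimes>\<^sub>M leb_n n) (leb_n n)"
    unfolding add_def[abs_def] by measurable
  have sub[measurable]: "case_prod sub \<in> measurable (leb_n n \<Otimes>\<^sub>M leb_n n) (leb_n n)"
    unfolding sub_def[abs_def] by measurable
  have tr: "(\<integral>\<^sup>+y. H (add x y) \<partial>leb_n n) = (\<integral>\<^sup>+y. H y \<partial>leb_n n)" 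
    if [measurable]: "H \<in> borel_measurable (leb_n n)" for H x
    using nn_integral_lborel_PiM_affine[of "{..<n}" "\<lambda>_. 1" H x] that by (simp add: add_def)
  have rf: "(\<integral>\<^sup>+y. H (sub x y) \<partial>leb_n n) = (\<integral>\<^sup>+y. H y \<partial>leb_n n)" 
    if [measurable]: "H \<in> borel_measurable (leb_n n)" for H x
    using nn_integral_lborel_PiM_affine[of "{..<n}" "\<lambda>_. -1" H x] that by (simp add: sub_def)
  have gT: "gauss_density n (?T x) = gauss_density n x" for x
    using orth_n_norm[OF V, of x] by (simp add: gauss_density_eq)
  \<comment> \<open>\<open>?T\<close> undoes its transpose, so translating \<open>x\<close> by minus
    the transpose applied to \<open>y\<close> shifts \<open>?T x\<close> by minus \<open>y\<close>.
    Translation invariance in \<open>x\<close> thereby moves the argument of \<open>G\<close> to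
    \<open>sub (?T x) y\<close>, while the Gaussian factor turns into
    \<open>gauss_density n (?T x)\<close>, which equals \<open>gauss_density n x\<close>.\<close>
  have Tsub: "?T (add (sub (\<lambda>_. 0) (?T' y)) x) = sub (?T x) y" for x y
  proof
    fix i
    show "?T (add (sub (\<lambda>_. 0) (?T' y)) x) i = sub (?T x) y i"
    proof (cases "i < n")
      case True
      have "?T (add (sub (\<lambda>_. 0) (?T' y)) x) i = ?T x i - ?T (?T' y) i"
        using True by (simp add: lin_n_def add_def sub_def algebra_simps sum_subtractf)
      then show ?thesis using orth_n_cancel[OF V True] True by (simp add: sub_def)
    qed (simp add: lin_n_def sub_def)
  qed
  have addsub: "add y (sub x y) = restrict x {..<n}" for x y
    by (auto simp: add_def sub_def)
  have restr: "gauss_density n (restrict x {..<n}) = gauss_density n x" for x by (simp add: gauss_density_def)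
  have "(\<integral>\<^sup>+x. F (?T x) \<partial>gauss_n n) = (\<integral>\<^sup>+x. G (?T x) \<partial>leb_n n)"
    by (subst nn_integral_gauss_n) (simp_all add: G_def gT)
  also have "\<dots> = (\<integral>\<^sup>+x. (\<integral>\<^sup>+y. G (?T x) * ennreal (gauss_density n (add (?T x) y)) \<partial>leb_n n) \<partial>leb_n n)"
  proof (rule nn_integral_cong)
    fix x
    have "(\<integral>\<^sup>+y. G (?T x) * ennreal (gauss_density n (add (?T x) y)) \<partial>leb_n n) = G (?T x) * (\<integral>\<^sup>+y. ennreal (gauss_density n (add (?T x) y)) \<partial>leb_n n)"
      by (rule nn_integral_cmult) (simp add: add_def)
    also have "\<dots> = G (?T x)" using tr[of "\<lambda>x. ennreal (gauss_density n x)" "?T x"] by (simp add: nn_integral_gauss_density)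
    finally show "G (?T x) = (\<integral>\<^sup>+y. G (?T x) * ennreal (gauss_density n (add (?T x) y)) \<partial>leb_n n)" by simp
  qed
  also have "\<dots> = (\<integral>\<^sup>+y. (\<integral>\<^sup>+x. G (?T x) * ennreal (gauss_density n (add (?T x) y)) \<partial>leb_n n) \<partial>leb_n n)"
    by (rule P.Fubini'[symmetric]) measurable
  also have "\<dots> = (\<integral>\<^sup>+y. (\<integral>\<^sup>+x. G (sub (?T x) y) * ennreal (gauss_density n (add (sub (?T x) y) y)) \<partial>leb_n n) \<partial>leb_n n)"
  proof (rule nn_integral_cong)
    fix y assume "y \<in> space (leb_n n)"
    show "(\<integral>\<^sup>+x. G (?T x) * ennreal (gauss_density n (add (?T x) y)) \<partial>leb_n n) = (\<integral>\<^sup>+x. G (sub (?T x) y) * ennreal (gauss_density n (add (sub (?T x) y) y)) \<partial>leb_n n)"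
    proof -
      have [measurable]: "(\<lambda>x. add x y) \<in> measurable (leb_n n) (leb_n n)" unfolding add_def by measurable
      show ?thesis
        using tr[of "\<lambda>x. G (?T x) * ennreal (gauss_density n (add (?T x) y))" "sub (\<lambda>_. 0) (?T' y)"]
        unfolding Tsub by simp
    qed
  qed
  also have "\<dots> = (\<integral>\<^sup>+y. (\<integral>\<^sup>+x. G (sub (?T x) y) * ennreal (gauss_density n (?T x)) \<partial>leb_n n) \<partial>leb_n n)"
    by (simp add: gauss_density_def add_def sub_def)
  also have "\<dots> = (\<integral>\<^sup>+x. (\<integral>\<^sup>+y. G (sub (?T x) y) * ennreal (gauss_density n (?T x)) \<partial>leb_n n) \<partial>leb_n n)"
    by (rule P.Fubini') measurable
  also have "\<dots> = (\<integral>\<^sup>+x. (\<integral>\<^sup>+y. G y \<partial>leb_n n) * ennreal (gauss_density n x) \<partial>leb_n n)"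
  proof (rule nn_integral_cong)
    fix x
    have [measurable]: "sub (?T x) \<in> measurable (leb_n n) (leb_n n)" unfolding sub_def[abs_def] by measurable
    show "(\<integral>\<^sup>+y. G (sub (?T x) y) * ennreal (gauss_density n (?T x)) \<partial>leb_n n) = (\<integral>\<^sup>+y. G y \<partial>leb_n n) * ennreal (gauss_density n x)"
      by (subst nn_integral_multc) (auto simp: rf gT)
  qed
  also have "\<dots> = (\<integral>\<^sup>+y. G y \<partial>leb_n n)"
    by (subst nn_integral_cmult) (auto simp: nn_integral_gauss_density)
  also have "\<dots> = (\<integral>\<^sup>+x. F x \<partial>gauss_n n)"
    by (subst nn_integral_gauss_n) (simp_all add: G_def[abs_def])
  finally show ?thesis .
qed

section \<open>Spectral theorem for positive semidefinite matrices\<close>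

lemma symmetric_scalar_prod_swap:
  fixes A :: "'a :: comm_semiring_0 mat"
  assumes A: "A \<in> carrier_mat n n" "transpose_mat A = A"
    and x: "x \<in> carrier_vec n" and y: "y \<in> carrier_vec n"
  shows "x \<bullet> (A *\<^sub>v y) = y \<bullet> (A *\<^sub>v x)"
  using transpose_vec_mult_scalar[OF A(1) y x] A comm_scalar_prod[of y n "A *\<^sub>v x"] x y by simp

text \<open>The characteristic polynomial splits over the complex numbers, so a complex eigenpair
  exists; symmetry, applied to the eigenvector and its conjugate, forces the eigenvalue to equal its
  conjugate. A real root of the real characteristic polynomial then has a real eigenvector.\<close>

lemma symmetric_real_eigenvector:
  fixes A :: "real mat"
  assumes A: "A \<in> carrier_mat n n" and sym: "transpose_mat A = A" and n: "0 < n"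
  obtains v e where "v \<in> carrier_vec n" "v \<noteq> 0\<^sub>v n" "A *\<^sub>v v = e \<cdot>\<^sub>v v"
proof -
  let ?C = "map_mat complex_of_real A"
  have C: "?C \<in> carrier_mat n n" using A by simp
  have symC: "transpose_mat ?C = ?C" using sym by (metis map_mat_transpose)
  obtain as where as: "char_poly ?C = (\<Prod>a\<leftarrow>as. [:- a, 1:])" "length as = n"
    using char_poly_factorized[OF C] by blast
  then obtain z where "z \<in> set as" using n by (cases as) auto
  then have root: "poly (char_poly ?C) z = 0"
    unfolding as(1) by (rule linear_poly_root)
  then have "eigenvalue ?C z" using eigenvalue_root_char_poly[OF C] by simp
  then obtain x where x: "x \<in> carrier_vec n" "x \<noteq> 0\<^sub>v n" and ev: "?C *\<^sub>v x = z \<cdot>\<^sub>v x"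
    using C by (auto simp: eigenvalue_def eigenvector_def)
  have cx: "conjugate x \<in> carrier_vec n" using x by simp
  have "conjugate (?C *\<^sub>v x) = ?C *\<^sub>v conjugate x"
    using A x by (intro eq_vecI) (auto simp: scalar_prod_def)
  then have evc: "?C *\<^sub>v conjugate x = conjugate z \<cdot>\<^sub>v conjugate x"
    using ev by (simp add: conjugate_smult_vec)
  have "z * (conjugate x \<bullet> x) = conjugate x \<bullet> (?C *\<^sub>v x)" using ev x cx by simp
  also have "\<dots> = x \<bullet> (?C *\<^sub>v conjugate x)" by (rule symmetric_scalar_prod_swap[OF C symC cx x(1)])
  also have "\<dots> = conjugate z * (conjugate x \<bullet> x)" using evc x cx by (simp add: comm_scalar_prod[of x n])
  finally have "z * (conjugate x \<bullet> x) = conjugate z * (conjugate x \<bullet> x)" .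
  moreover have "conjugate x \<bullet> x \<noteq> 0"
    using conjugate_square_eq_0_vec[OF x(1)] x comm_scalar_prod[OF x(1) cx] by simp
  ultimately have "cnj z = z" by simp
  then have z: "z = complex_of_real (Re z)" by (simp add: complex_eq_iff)
  have "complex_of_real (poly (char_poly A) (Re z)) = poly (char_poly ?C) z"
    unfolding of_real_hom.char_poly_hom[OF A] by (subst z) (rule of_real_hom.poly_map_poly[symmetric])
  then have "poly (char_poly A) (Re z) = 0" using root by simp
  then have "eigenvalue A (Re z)" using eigenvalue_root_char_poly[OF A] by simp
  then show ?thesis using that A by (auto simp: eigenvalue_def eigenvector_def)
qed

text \<open>\<open>gram_schmidt\<close> keeps the head of the completed basis, so \<open>v\<close>
  survives up to its length. It orthogonalises without normalising, hence the division by norms in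
  \<open>W\<close>.\<close>

lemma orthonormal_matrix_with_first_column:
  fixes v :: "real vec"
  assumes v: "v \<in> carrier_vec n" "v \<noteq> 0\<^sub>v n"
  obtains W where "W \<in> carrier_mat n n" "transpose_mat W * W = 1\<^sub>m n" "col W 0 = (1 / sqrt (v \<bullet> v)) \<cdot>\<^sub>v v"
proof -
  interpret cof_vec_space n "TYPE(real)" .
  have n: "0 < n" using v by (cases n) auto
  define ws where "ws = gram_schmidt n (basis_completion v)"
  note bc = basis_completion[OF v]
  have len_b: "length (basis_completion v) = n" and hdb: "hd (basis_completion v) = v"
    using bc by auto
  then obtain vs where vs: "basis_completion v = v # vs" using n by (cases "basis_completion v") auto
  have ws: "set ws \<subseteq> carrier_vec n" "corthogonal ws" "length ws = n"
    using gram_schmidt_result[OF bc(2) _ _ ws_def] bc len_b by auto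
  have "hd ws = v" using gram_schmidt_hd[OF v(1), of vs] by (simp add: ws_def vs)
  then have ws0: "ws ! 0 = v" using ws n hd_conv_nth[of ws] by auto
  have orth: "ws ! i \<bullet> ws ! j = 0 \<longleftrightarrow> i \<noteq> j" if "i < n" "j < n" for i j
    using corthogonalD[OF ws(2), of i j] that ws by (simp add: conjugate_vec_def)
  define W where "W = mat n n (\<lambda>(k, j). (ws ! j) $ k / sqrt (ws ! j \<bullet> ws ! j))"
  have W: "W \<in> carrier_mat n n" by (simp add: W_def)
  have wc: "ws ! j \<in> carrier_vec n" if "j < n" for j using ws that by auto
  have "transpose_mat W * W = 1\<^sub>m n"
  proof (rule eq_matI)
    fix i j assume "i < dim_row (1\<^sub>m n :: real mat)" "j < dim_col (1\<^sub>m n :: real mat)"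
    then have ij: "i < n" "j < n" by auto
    have "(transpose_mat W * W) $$ (i, j) = (\<Sum>k = 0..<n. (ws ! i) $ k / sqrt (ws ! i \<bullet> ws ! i) * ((ws ! j) $ k / sqrt (ws ! j \<bullet> ws ! j)))"
      using ij by (simp add: W_def scalar_prod_def)
    also have "\<dots> = (ws ! i \<bullet> ws ! j) / (sqrt (ws ! i \<bullet> ws ! i) * sqrt (ws ! j \<bullet> ws ! j))"
      using wc[OF ij(2)] by (simp add: scalar_prod_def sum_divide_distrib carrier_vecD)
    also have "\<dots> = (1\<^sub>m n) $$ (i, j)"
    proof (cases "i = j")
      case True
      have "ws ! i \<bullet> ws ! i \<ge> 0" by (simp add: scalar_prod_def sum_nonneg)
      then show ?thesis using True ij orth[of i i] by simp
    next
      case False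
      then show ?thesis using ij orth[of i j] by simp
    qed
    finally show "(transpose_mat W * W) $$ (i, j) = (1\<^sub>m n) $$ (i, j)" .
  qed (use W in auto)
  moreover have "col W 0 = (1 / sqrt (v \<bullet> v)) \<cdot>\<^sub>v v"
    using n v ws0 by (intro eq_vecI) (auto simp: W_def)
  ultimately show ?thesis using W that by blast
qed

text \<open>Deflation: in an orthonormal basis that begins with an eigenvector the first column of
  the matrix is \<open>e\<close> followed by zeros, symmetry gives the same for the first row, and
  the induction hypothesis diagonalises the remaining block.\<close>

lemma real_symmetric_diagonalizable:
  fixes A :: "real mat"
  assumes "A \<in> carrier_mat n n" "transpose_mat A = A"
  shows "\<exists>P f. P \<in> carrier_mat n n \<and> transpose_mat P * P = 1\<^sub>m n \<and> transpose_mat P * A * P = mat_diag n f"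
  using assms
proof (induction n arbitrary: A)
  case 0
  then show ?case by (intro exI[of _ "1\<^sub>m 0"] exI[of _ "\<lambda>_. 0"] conjI eq_matI) (auto simp: mat_diag_def)
next
  case (Suc m)
  let ?n = "Suc m"
  note A = Suc.prems(1) and sym = Suc.prems(2)
  obtain v e where v: "v \<in> carrier_vec ?n" "v \<noteq> 0\<^sub>v ?n" and ev: "A *\<^sub>v v = e \<cdot>\<^sub>v v"
    using symmetric_real_eigenvector[OF A sym] by blast
  obtain W where W: "W \<in> carrier_mat ?n ?n" and WW: "transpose_mat W * W = 1\<^sub>m ?n"
    and W0: "col W 0 = (1 / sqrt (v \<bullet> v)) \<cdot>\<^sub>v v"
    using orthonormal_matrix_with_first_column[OF v] by blast
  let ?B = "transpose_mat W * A * W"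
  have Wt: "transpose_mat W \<in> carrier_mat ?n ?n" using W by simp
  have B: "?B \<in> carrier_mat ?n ?n" using A W by auto
  have AW: "A * W \<in> carrier_mat ?n ?n" using A W by auto
  have Beq: "?B = transpose_mat W * (A * W)" using A W Wt by (simp add: assoc_mult_mat[of _ ?n ?n _ ?n _ ?n])
  have symB: "transpose_mat ?B = ?B"
    unfolding transpose_mult[OF mult_carrier_mat[OF Wt A] W] transpose_mult[OF Wt A] sym
    using A W Wt by (simp add: assoc_mult_mat[of _ ?n ?n _ ?n _ ?n])
  have colAW: "col (A * W) 0 = e \<cdot>\<^sub>v col W 0"
  proof -
    have "col (A * W) 0 = A *\<^sub>v col W 0" by (rule col_mult2[OF A W]) simp
    also have "\<dots> = (1 / sqrt (v \<bullet> v)) \<cdot>\<^sub>v (A *\<^sub>v v)" unfolding W0 by (rule mult_mat_vec[OF A v(1)])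
    also have "\<dots> = e \<cdot>\<^sub>v col W 0" unfolding ev W0 by (simp add: smult_smult_assoc mult.commute)
    finally show ?thesis .
  qed
  have B0: "?B $$ (i, 0) = (if i = 0 then e else 0)" if i: "i < ?n" for i
  proof -
    have "?B $$ (i, 0) = row (transpose_mat W) i \<bullet> col (A * W) 0"
      unfolding Beq using i AW Wt by simp
    also have "\<dots> = e * (row (transpose_mat W) i \<bullet> col W 0)"
      unfolding colAW using i W by (intro scalar_prod_smult_right) auto
    also have "row (transpose_mat W) i \<bullet> col W 0 = (transpose_mat W * W) $$ (i, 0)"
      using i W by simp
    also have "\<dots> = (if i = 0 then 1 else 0)" unfolding WW using i by simp
    finally show ?thesis by simp
  qed
  have B0': "?B $$ (0, i) = (if i = 0 then e else 0)" if i: "i < ?n" for i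
  proof -
    have "?B $$ (0, i) = transpose_mat ?B $$ (i, 0)" using i B by (subst index_transpose_mat) auto
    then show ?thesis unfolding symB using B0[OF i] by simp
  qed
  define A3 where "A3 = mat m m (\<lambda>(i, j). ?B $$ (Suc i, Suc j))"
  have A3: "A3 \<in> carrier_mat m m" by (simp add: A3_def)
  have symA3: "transpose_mat A3 = A3"
  proof (rule eq_matI)
    fix i j assume "i < dim_row A3" "j < dim_col A3"
    then have ij: "i < m" "j < m" by (auto simp: A3_def)
    have "?B $$ (Suc j, Suc i) = transpose_mat ?B $$ (Suc i, Suc j)"
      using ij B by (subst index_transpose_mat) auto
    then show "transpose_mat A3 $$ (i, j) = A3 $$ (i, j)"
      unfolding symB using ij by (simp add: A3_def)
  qed (auto simp: A3_def)
  let ?E = "mat_diag 1 (\<lambda>_. e)"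
  have blk: "?B = four_block_mat ?E (0\<^sub>m 1 m) (0\<^sub>m m 1) A3"
  proof (rule eq_matI)
    fix i j assume "i < dim_row (four_block_mat ?E (0\<^sub>m 1 m) (0\<^sub>m m 1) A3)" "j < dim_col (four_block_mat ?E (0\<^sub>m 1 m) (0\<^sub>m m 1) A3)"
    then have ij: "i < ?n" "j < ?n" by (auto simp: A3_def mat_diag_def)
    show "?B $$ (i, j) = four_block_mat ?E (0\<^sub>m 1 m) (0\<^sub>m m 1) A3 $$ (i, j)"
    proof (cases "i = 0 \<or> j = 0")
      case True
      then show ?thesis using B0[OF ij(1)] B0'[OF ij(2)] ij by (auto simp: A3_def mat_diag_def)
    next
      case False
      then obtain i' j' where "i = Suc i'" "j = Suc j'" by (metis not0_implies_Suc)
      then show ?thesis using ij by (simp add: A3_def mat_diag_def)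
    qed
  qed (use B in \<open>auto simp: A3_def mat_diag_def\<close>)
  obtain P3 f where P3: "P3 \<in> carrier_mat m m" "transpose_mat P3 * P3 = 1\<^sub>m m"
    and d3: "transpose_mat P3 * A3 * P3 = mat_diag m f" using Suc.IH[OF A3 symA3] by blast
  \<comment> \<open>The smaller orthogonal matrix acts on the last m coordinates only, so the
    eigenvector already split off stays fixed.\<close>
  let ?F = "four_block_mat (1\<^sub>m 1) (0\<^sub>m 1 m) (0\<^sub>m m 1) P3"
  have F: "?F \<in> carrier_mat ?n ?n" using P3 by (metis four_block_carrier_mat one_carrier_mat plus_1_eq_Suc)
  have Ft: "transpose_mat ?F = four_block_mat (1\<^sub>m 1) (0\<^sub>m 1 m) (0\<^sub>m m 1) (transpose_mat P3)"
    using P3 by (subst transpose_four_block_mat[of _ 1 1 _ m _ m]) auto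
  have FF: "transpose_mat ?F * ?F = 1\<^sub>m ?n"
    unfolding Ft using P3 by (subst mult_four_block_mat[of _ 1 1 _ m _ m]) auto
  have FBF: "transpose_mat ?F * ?B * ?F = mat_diag ?n (\<lambda>i. if i = 0 then e else f (i - 1))"
  proof -
    have E: "?E \<in> carrier_mat (Suc 0) (Suc 0)" by simp
    have "transpose_mat ?F * ?B * ?F = four_block_mat ?E (0\<^sub>m 1 m) (0\<^sub>m m 1) (transpose_mat P3 * A3 * P3)"
      unfolding Ft blk using P3 A3 left_mult_one_mat[OF E] left_mult_zero_mat[OF E, of m]
        right_mult_one_mat[OF E] right_mult_zero_mat[OF E, of m] right_add_zero_mat[OF E]
      by (subst mult_four_block_mat[of _ 1 1 _ m _ m], auto)
         (subst mult_four_block_mat[of _ 1 1 _ m _ m], auto)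
    also have "\<dots> = mat_diag ?n (\<lambda>i. if i = 0 then e else f (i - 1))"
      unfolding d3 by (rule eq_matI) (auto simp: mat_diag_def)
    finally show ?thesis .
  qed
  let ?P = "W * ?F"
  have Ft': "transpose_mat ?F \<in> carrier_mat ?n ?n" using F by simp
  have Pt: "transpose_mat ?P = transpose_mat ?F * transpose_mat W" by (rule transpose_mult[OF W F])
  have "transpose_mat ?P * ?P = transpose_mat ?F * ((transpose_mat W * W) * ?F)"
    unfolding Pt using F W Wt Ft' by (simp add: assoc_mult_mat[of _ ?n ?n _ ?n _ ?n])
  also have "\<dots> = 1\<^sub>m ?n" unfolding WW left_mult_one_mat[OF F] by (rule FF)
  finally have PP: "transpose_mat ?P * ?P = 1\<^sub>m ?n" .
  have "transpose_mat ?P * A * ?P = transpose_mat ?F * ?B * ?F"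
    unfolding Pt using F W Wt Ft' A by (simp add: assoc_mult_mat[of _ ?n ?n _ ?n _ ?n])
  then show ?case using PP mult_carrier_mat[OF W F] unfolding FBF by blast
qed

text \<open>The rows of \<open>V\<close> are eigenvectors, so \<open>lin_n n V\<close> passes to
  eigencoordinates. Eigenvalue multiset, trace and quadratic form are delivered with one common
  \<open>lam\<close>, which ties \<open>spec A\<close> to the indexed sums used from here
  on.\<close>

lemma psd_mat_spectral:
  assumes psd: "psd_mat n A"
  obtains V lam where "orth_n n V" "\<forall>i<n. 0 \<le> lam i"
    "spec A = image_mset lam (mset_set {..<n})" "mat_trace A = (\<Sum>i<n. lam i)"
    "\<forall>x\<in>carrier_vec n. x \<bullet> (A *\<^sub>v x) = (\<Sum>i<n. lam i * (lin_n n V (\<lambda>k. x $ k) i)\<^sup>2)"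
proof -
  have A: "A \<in> carrier_mat n n" and sym: "transpose_mat A = A"
    and nn: "\<And>v. v \<in> carrier_vec n \<Longrightarrow> 0 \<le> v \<bullet> (A *\<^sub>v v)"
    using psd by (auto simp: psd_mat_def)
  obtain P f where P: "P \<in> carrier_mat n n" and PP: "transpose_mat P * P = 1\<^sub>m n"
    and D: "transpose_mat P * A * P = mat_diag n f" using real_symmetric_diagonalizable[OF A sym] by blast
  have Pt: "transpose_mat P \<in> carrier_mat n n" using P by simp
  have PP': "P * transpose_mat P = 1\<^sub>m n" by (rule mat_mult_left_right_inverse[OF Pt P PP])
  define V where "V i k = P $$ (k, i)" for i k
  have "of_bool (i = j) = (\<Sum>k<n. V i k * V j k)" if "i < n" "j < n" for i j
    using arg_cong[OF PP, of "\<lambda>M. M $$ (i, j)"] that P by (simp add: V_def scalar_prod_def lessThan_atLeast0 of_bool_def)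
  moreover have "of_bool (i = j) = (\<Sum>k<n. V k i * V k j)" if "i < n" "j < n" for i j
    using arg_cong[OF PP', of "\<lambda>M. M $$ (i, j)"] that P by (simp add: V_def scalar_prod_def lessThan_atLeast0 of_bool_def)
  ultimately have V: "orth_n n V" unfolding orth_n_def by metis
  have Aeq: "A = P * mat_diag n f * transpose_mat P"
  proof -
    have "P * mat_diag n f * transpose_mat P = (P * transpose_mat P) * A * (P * transpose_mat P)"
      unfolding D[symmetric] using P Pt A by (simp add: assoc_mult_mat[of _ n n _ n _ n])
    then show ?thesis unfolding PP' using A by simp
  qed
  have quad: "x \<bullet> (A *\<^sub>v x) = (\<Sum>i<n. f i * (lin_n n V (\<lambda>k. x $ k) i)\<^sup>2)" if x: "x \<in> carrier_vec n" for x
  proof -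
    let ?y = "transpose_mat P *\<^sub>v x"
    have y: "?y \<in> carrier_vec n" using x Pt by simp
    have yi: "?y $ i = lin_n n V (\<lambda>k. x $ k) i" if "i < n" for i
      using that x P by (simp add: lin_n_def V_def scalar_prod_def lessThan_atLeast0)
    have D': "mat_diag n f *\<^sub>v ?y \<in> carrier_vec n" using y by (metis mat_diag_dim mult_mat_vec_carrier)
    have "x \<bullet> (A *\<^sub>v x) = x \<bullet> (P *\<^sub>v (mat_diag n f *\<^sub>v ?y))"
      unfolding Aeq using x P Pt y by (simp add: assoc_mult_mat_vec[of _ n n _ n])
    also have "\<dots> = ?y \<bullet> (mat_diag n f *\<^sub>v ?y)"
      by (rule transpose_vec_mult_scalar[OF P D' x, symmetric])
    also have "\<dots> = (\<Sum>i<n. ?y $ i * (mat_diag n f *\<^sub>v ?y) $ i)"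
      using P by (simp add: scalar_prod_def lessThan_atLeast0 mat_diag_def)
    also have "\<dots> = (\<Sum>i<n. ?y $ i * (f i * ?y $ i))"
    proof (intro sum.cong refl arg_cong2[where f = "(*)"])
      fix i assume i: "i \<in> {..<n}"
      have "(mat_diag n f *\<^sub>v y) $ i = f i * y $ i" if y: "y \<in> carrier_vec n" for y
      proof -
        have "(mat_diag n f *\<^sub>v y) $ i = (\<Sum>k<n. (if i = k then f k else 0) * y $ k)"
          using i y by (simp add: mat_diag_def scalar_prod_def lessThan_atLeast0)
        also have "\<dots> = (\<Sum>k<n. (if i = k then f i * y $ i else 0))"
          by (intro sum.cong) auto
        finally show ?thesis using i by simp
      qed
      then show "(mat_diag n f *\<^sub>v ?y) $ i = f i * ?y $ i" using y by blast
    qed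
    also have "\<dots> = (\<Sum>i<n. f i * (lin_n n V (\<lambda>k. x $ k) i)\<^sup>2)"
      using yi by (intro sum.cong) (auto simp: power2_eq_square)
    finally show ?thesis .
  qed
  \<comment> \<open>The i-th row of \<open>V\<close> has the i-th unit vector as its
    eigencoordinates, so the form takes the value \<open>f i\<close> there.\<close>
  have fnn: "0 \<le> f i" if i: "i < n" for i
  proof -
    let ?x = "vec n (V i)"
    have "lin_n n V (\<lambda>k. ?x $ k) j = of_bool (j = i)" if "j < n" for j
      using V i that by (simp add: lin_n_def orth_n_def)
    then have "(\<Sum>j<n. f j * (lin_n n V (\<lambda>k. ?x $ k) j)\<^sup>2) = (\<Sum>j<n. if j = i then f i else 0)"
      by (intro sum.cong) auto
    then show ?thesis using quad[of ?x] nn[of ?x] i by simp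
  qed
  have "similar_mat A (mat_diag n f)"
    unfolding similar_mat_def similar_mat_wit_def Let_def
    using A P Pt PP PP' Aeq by (intro exI[of _ P] exI[of _ "transpose_mat P"]) auto
  then have "char_poly A = char_poly (mat_diag n f)" by (rule char_poly_similar)
  also have "\<dots> = (\<Prod>a\<leftarrow>diag_mat (mat_diag n f). [:- a, 1:])"
    by (rule char_poly_upper_triangular[of _ n]) (auto simp: mat_diag_def)
  also have "diag_mat (mat_diag n f) = map f [0..<n]"
    by (auto simp: diag_mat_def mat_diag_def)
  finally have "spec A = proots (\<Prod>a\<leftarrow>map f [0..<n]. [:- a, 1:])" by (simp add: spec_def)
  also have "\<dots> = mset (map f xs)" if "xs = [0..<n]" for xs :: "nat list"
  proof -
    have "proots (\<Prod>a\<leftarrow>map f ys. [:- a, 1:]) = mset (map f ys)" for ys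
    proof (induction ys)
      case (Cons y ys)
      have "(\<Prod>a\<leftarrow>map f ys. [:- a, 1:]) \<noteq> 0" by (auto simp: prod_list_zero_iff)
      then show ?case using Cons by (simp add: proots_mult del: mult_pCons_left)
    qed simp
    then show ?thesis using that by blast
  qed
  finally have spec: "spec A = image_mset f (mset_set {..<n})"
    by (simp add: lessThan_atLeast0 mset_map mset_upt)
  \<comment> \<open>Diagonal entries are values of the form at unit vectors; in their sum the rows
    of \<open>V\<close>, having norm 1, leave just the eigenvalues.\<close>
  have "mat_trace A = (\<Sum>i<n. \<Sum>k<n. f k * (V k i)\<^sup>2)"
  proof -
    have "A $$ (i, i) = (\<Sum>k<n. f k * (V k i)\<^sup>2)" if i: "i < n" for i
    proof -
      have "unit_vec n i \<bullet> (A *\<^sub>v unit_vec n i) = A $$ (i, i)"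
        using i A by (simp add: scalar_prod_left_unit mult_mat_vec_def scalar_prod_right_unit)
      moreover have "lin_n n V (\<lambda>k. unit_vec n i $ k) j = V j i" if "j < n" for j
      proof -
        have "lin_n n V (\<lambda>k. unit_vec n i $ k) j = (\<Sum>k<n. V j k * (if k = i then 1 else 0))"
          using that i by (simp add: lin_n_def)
        also have "\<dots> = (\<Sum>k<n. if k = i then V j i else 0)"
          by (intro sum.cong) auto
        finally show ?thesis using i by simp
      qed
      ultimately show ?thesis using quad[of "unit_vec n i"] by simp
    qed
    then show ?thesis using A by (simp add: mat_trace_def)
  qed
  also have "\<dots> = (\<Sum>k<n. f k * (\<Sum>i<n. V k i * V k i))"
    by (subst sum.swap) (simp add: sum_distrib_left power2_eq_square)
  also have "\<dots> = (\<Sum>k<n. f k)" using V by (simp add: orth_n_def)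
  finally show ?thesis using that[OF V _ spec] fnn quad by simp
qed

section \<open>Hitting probability of a codeword, diagonal case\<close>

abbreviation std_normal :: "real measure" where
  "std_normal \<equiv> density lborel std_normal_density"

lemma std_normal_has_moment:
  assumes "has_bochner_integral lborel (\<lambda>x. std_normal_density x * x ^ k) c"
  shows "integrable std_normal (\<lambda>x. x ^ k)" "(\<integral>x. x ^ k \<partial>std_normal) = c"
  using assms by (auto simp: integrable_density integral_density has_bochner_integral_iff)

lemma std_normal_moments:
  shows "integrable std_normal (\<lambda>x. x)" "(\<integral>x. x \<partial>std_normal) = 0"
    "integrable std_normal (\<lambda>x. x\<^sup>2)" "(\<integral>x. x\<^sup>2 \<partial>std_normal) = 1"
    "integrable std_normal (\<lambda>x. x ^ 4)" "(\<integral>x. x ^ 4 \<partial>std_normal) = 3"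
  using std_normal_has_moment[OF std_normal_moment_odd[of 0]]
    std_normal_has_moment[OF std_normal_moment_even[of 1]]
    std_normal_has_moment[OF std_normal_moment_even[of 2]]
  by (simp_all add: fact_numeral)

lemma gauss_n_component:
  fixes g :: "real \<Rightarrow> real"
  assumes i: "i < n" and g: "integrable std_normal g"
  shows "integrable (gauss_n n) (\<lambda>x. g (x i))" "(\<integral>x. g (x i) \<partial>gauss_n n) = (\<integral>x. g x \<partial>std_normal)"
proof -
  interpret N: product_prob_space "\<lambda>_::nat. std_normal"
    by (intro product_prob_spaceI prob_space_normal_density) simp
  have d: "distr (gauss_n n) std_normal (\<lambda>x. x i) = std_normal"
    unfolding gauss_n_def using i by (intro distr_PiM_component) (auto intro: prob_space_normal_density)
  have m: "(\<lambda>x. x i) \<in> measurable (gauss_n n) std_normal"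
    unfolding gauss_n_def using i by simp
  show "integrable (gauss_n n) (\<lambda>x. g (x i))" using integrable_distr[OF m, of g] g by (simp add: d)
  show "(\<integral>x. g (x i) \<partial>gauss_n n) = (\<integral>x. g x \<partial>std_normal)"
    using integral_distr[OF m, of g] g by (simp add: d)
qed

lemma gauss_n_component_pair:
  fixes g :: "real \<Rightarrow> real"
  assumes ij: "i < n" "j < n" "i \<noteq> j" and g: "integrable std_normal g"
  shows "integrable (gauss_n n) (\<lambda>x. g (x i) * g (x j))"
    "(\<integral>x. g (x i) * g (x j) \<partial>gauss_n n) = (\<integral>x. g x \<partial>std_normal)\<^sup>2"
proof -
  interpret N: product_prob_space "\<lambda>_::nat. std_normal"
    by (intro product_prob_spaceI prob_space_normal_density) simp
  define f where "f k = (if k \<in> {i, j} then g else (\<lambda>_. 1))" for k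
  have f: "integrable std_normal (f k)" for k using g by (auto simp: f_def)
  have eq: "(\<Prod>k<n. f k (x k)) = g (x i) * g (x j)" for x
  proof -
    have "(\<Prod>k<n. f k (x k)) = (\<Prod>k\<in>{i, j}. f k (x k))"
      using ij by (intro prod.mono_neutral_right) (auto simp: f_def)
    then show ?thesis using ij by (simp add: f_def)
  qed
  have eq': "(\<Prod>k<n. integral\<^sup>L std_normal (f k)) = (\<integral>x. g x \<partial>std_normal)\<^sup>2"
  proof -
    have "(\<Prod>k<n. integral\<^sup>L std_normal (f k)) = (\<Prod>k\<in>{i, j}. integral\<^sup>L std_normal (f k))"
      using ij N.M.prob_space by (intro prod.mono_neutral_right) (auto simp: f_def)
    then show ?thesis using ij by (simp add: f_def power2_eq_square)
  qed
  show "integrable (gauss_n n) (\<lambda>x. g (x i) * g (x j))"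
    unfolding gauss_n_def eq[symmetric] by (rule N.product_integrable_prod) (auto intro: f)
  show "(\<integral>x. g (x i) * g (x j) \<partial>gauss_n n) = (\<integral>x. g x \<partial>std_normal)\<^sup>2"
    unfolding gauss_n_def eq[symmetric] eq'[symmetric] by (rule N.product_integral_prod) (auto intro: f)
qed

text \<open>\<open>g\<close> is centred, so its values at distinct coordinates are orthogonal and
  only the diagonal of the squared sum survives. It is applied to \<open>x\<close> and to
  \<open>x\<^sup>2 - 1\<close>.\<close>

lemma gauss_n_orthogonal_sum:
  fixes g :: "real \<Rightarrow> real"
  assumes g: "integrable std_normal g" "(\<integral>x. g x \<partial>std_normal) = 0"
    and g2: "integrable std_normal (\<lambda>x. (g x)\<^sup>2)"
  shows "has_bochner_integral (gauss_n n) (\<lambda>x. (\<Sum>i<n. \<alpha> i * g (x i))\<^sup>2)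
    ((\<integral>x. (g x)\<^sup>2 \<partial>std_normal) * (\<Sum>i<n. (\<alpha> i)\<^sup>2))"
proof -
  have *: "has_bochner_integral (gauss_n n) (\<lambda>x. \<alpha> i * \<alpha> j * (g (x i) * g (x j)))
     (if i = j then (\<integral>x. (g x)\<^sup>2 \<partial>std_normal) * (\<alpha> i)\<^sup>2 else 0)" if "i < n" "j < n" for i j
  proof (cases "i = j")
    case True
    then show ?thesis using gauss_n_component[OF \<open>i < n\<close> g2]
      by (auto simp: has_bochner_integral_iff power2_eq_square)
  next
    case False
    then show ?thesis using gauss_n_component_pair[OF that False g(1)] g(2)
      by (auto simp: has_bochner_integral_iff)
  qed
  have "has_bochner_integral (gauss_n n) (\<lambda>x. \<Sum>i<n. \<Sum>j<n. \<alpha> i * \<alpha> j * (g (x i) * g (x j)))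
     (\<Sum>i<n. \<Sum>j<n. if i = j then (\<integral>x. (g x)\<^sup>2 \<partial>std_normal) * (\<alpha> i)\<^sup>2 else 0)"
    by (intro has_bochner_integral_sum *) auto
  moreover have "(\<Sum>i<n. \<Sum>j<n. \<alpha> i * \<alpha> j * (g (x i) * g (x j))) = (\<Sum>i<n. \<alpha> i * g (x i))\<^sup>2" for x
    unfolding power2_eq_square sum_product by (intro sum.cong) auto
  ultimately show ?thesis by (simp add: sum_distrib_left)
qed

lemma gauss_n_linear_sum:
  "has_bochner_integral (gauss_n n) (\<lambda>x. (\<Sum>i<n. \<alpha> i * x i)\<^sup>2) (\<Sum>i<n. (\<alpha> i)\<^sup>2)"
  using gauss_n_orthogonal_sum[of "\<lambda>x. x"] std_normal_moments by simp

lemma gauss_n_square_sum: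
  "has_bochner_integral (gauss_n n) (\<lambda>x. (\<Sum>i<n. \<alpha> i * ((x i)\<^sup>2 - 1))\<^sup>2) (2 * (\<Sum>i<n. (\<alpha> i)\<^sup>2))"
proof -
  interpret N: prob_space std_normal by (intro prob_space_normal_density) simp
  have sq: "(x\<^sup>2 - 1)\<^sup>2 = x ^ 4 - 2 * x\<^sup>2 + 1" for x :: real
    by (simp add: power2_eq_square power4_eq_xxxx algebra_simps)
  have 1: "integrable std_normal (\<lambda>x. x\<^sup>2 - 1)" "(\<integral>x. x\<^sup>2 - 1 \<partial>std_normal) = 0"
    using std_normal_moments N.prob_space by auto
  have 2: "integrable std_normal (\<lambda>x. (x\<^sup>2 - 1)\<^sup>2)" "(\<integral>x. (x\<^sup>2 - 1)\<^sup>2 \<partial>std_normal) = 2"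
    unfolding sq using std_normal_moments N.prob_space by auto
  show ?thesis using gauss_n_orthogonal_sum[OF 1 2(1), of n \<alpha>] 2(2) by simp
qed

text \<open>The centred shape shared by the log-likelihood ratio and the distortion of the test
  channel, with source \<open>w\<close> and channel noise \<open>y\<close>. Under independent
  standard Gaussians each of the three sums has mean zero and, for bounded coefficients, variance at
  most of order n.\<close>

definition bilin_form ::
  "nat \<Rightarrow> (nat \<Rightarrow> real) \<Rightarrow> (nat \<Rightarrow> real) \<Rightarrow> (nat \<Rightarrow> real) \<Rightarrow> (nat \<Rightarrow> real) \<Rightarrow> (nat \<Rightarrow> real) \<Rightarrow> real" where
  "bilin_form n A B C w y =
    (\<Sum>i<n. A i * ((w i)\<^sup>2 - 1)) + (\<Sum>i<n. B i * w i * y i) + (\<Sum>i<n. C i * ((y i)\<^sup>2 - 1))"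

lemma measurable_bilin_form[measurable]:
  "case_prod (bilin_form n A B C) \<in> borel_measurable (leb_n n \<Otimes>\<^sub>M leb_n n)"
  unfolding bilin_form_def[abs_def] by measurable

lemma sum3_squared_le:
  fixes a b c :: real
  shows "(a + b + c)\<^sup>2 \<le> 3 * (a\<^sup>2 + b\<^sup>2 + c\<^sup>2)"
  using sum_squares_ge_zero[of "a - b" "b - c"] zero_le_power2[of "a - b"] zero_le_power2[of "b - c"] zero_le_power2[of "a - c"]
  by (simp add: power2_eq_square algebra_simps)

text \<open>Chebyshev's inequality, with \<open>y\<close> integrated before \<open>w\<close>. The
  second moments of the three sums are at most 2, 1 and 2 times
  \<open>real n * \<kappa>\<^sup>2\<close>; the factor 3 of \<open>sum3_squared_le\<close> makes
  15.\<close>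

lemma bilin_form_tail:
  assumes "\<And>i. i < n \<Longrightarrow> \<bar>A i\<bar> \<le> \<kappa>" "\<And>i. i < n \<Longrightarrow> \<bar>B i\<bar> \<le> \<kappa>" "\<And>i. i < n \<Longrightarrow> \<bar>C i\<bar> \<le> \<kappa>"
    and a: "0 < a"
  shows "(\<integral>\<^sup>+w. (\<integral>\<^sup>+y. indicator {a..} (bilin_form n A B C w y) \<partial>gauss_n n) \<partial>gauss_n n)
    \<le> ennreal (15 * real n * \<kappa>\<^sup>2 / a\<^sup>2)"
proof -
  interpret G: prob_space "gauss_n n" by (rule prob_space_gauss_n)
  have inner: "(\<integral>\<^sup>+y. indicator {a..} (bilin_form n A B C w y) \<partial>gauss_n n)
     \<le> ennreal (3 / a\<^sup>2 * ((\<Sum>i<n. A i * ((w i)\<^sup>2 - 1))\<^sup>2 + (\<Sum>i<n. (B i)\<^sup>2 * (w i)\<^sup>2) + 2 * (\<Sum>i<n. (C i)\<^sup>2)))"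
    (is "_ \<le> ennreal (?f w)") for w
  proof -
    let ?h = "\<lambda>y. 3 / a\<^sup>2 * ((\<Sum>i<n. A i * ((w i)\<^sup>2 - 1))\<^sup>2 + (\<Sum>i<n. (B i * w i) * y i)\<^sup>2 + (\<Sum>i<n. C i * ((y i)\<^sup>2 - 1))\<^sup>2)"
    have "(\<integral>\<^sup>+y. indicator {a..} (bilin_form n A B C w y) \<partial>gauss_n n) \<le> (\<integral>\<^sup>+y. ennreal (?h y) \<partial>gauss_n n)"
    proof (rule nn_integral_mono)
      fix y
      show "indicator {a..} (bilin_form n A B C w y) \<le> ennreal (?h y)"
      proof (cases "a \<le> bilin_form n A B C w y")
        case True
        have "a\<^sup>2 \<le> (bilin_form n A B C w y)\<^sup>2" using True a by (intro power_mono) auto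
        also have "\<dots> \<le> a\<^sup>2 * ?h y"
          using sum3_squared_le a unfolding bilin_form_def by (simp add: mult.assoc)
        finally have "1 \<le> ?h y" using a by simp
        then show ?thesis using True by (simp add: indicator_def)
      qed simp
    qed
    also have "\<dots> = ennreal (?f w)"
    proof -
      note L = gauss_n_linear_sum[of n "\<lambda>i. B i * w i", unfolded has_bochner_integral_iff]
      note S = gauss_n_square_sum[of n C, unfolded has_bochner_integral_iff]
      have "integrable (gauss_n n) ?h" using L S by simp
      moreover have "(\<integral>y. ?h y \<partial>gauss_n n) = ?f w"
        using L S G.prob_space by (simp add: power_mult_distrib)
      ultimately show ?thesis
        by (subst nn_integral_eq_integral) (auto intro!: AE_I2 mult_nonneg_nonneg add_nonneg_nonneg)
    qed
    finally show ?thesis .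
  qed
  have "(\<integral>\<^sup>+w. (\<integral>\<^sup>+y. indicator {a..} (bilin_form n A B C w y) \<partial>gauss_n n) \<partial>gauss_n n)
    \<le> (\<integral>\<^sup>+w. ennreal (?f w) \<partial>gauss_n n)" by (intro nn_integral_mono inner)
  also have "\<dots> = ennreal (3 / a\<^sup>2 * (2 * (\<Sum>i<n. (A i)\<^sup>2) + (\<Sum>i<n. (B i)\<^sup>2) + 2 * (\<Sum>i<n. (C i)\<^sup>2)))"
  proof -
    note S = gauss_n_square_sum[of n A, unfolded has_bochner_integral_iff]
    have 1: "integrable (gauss_n n) (\<lambda>w. (w i)\<^sup>2)" "(\<integral>w. (w i)\<^sup>2 \<partial>gauss_n n) = 1" if "i < n" for i
      using gauss_n_component[OF that std_normal_moments(3)] std_normal_moments(4) by simp_all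
    have 2: "integrable (gauss_n n) (\<lambda>w. \<Sum>i<n. (B i)\<^sup>2 * (w i)\<^sup>2)"
      using 1 by (intro Bochner_Integration.integrable_sum integrable_mult_right) auto
    have 3: "(\<integral>w. (\<Sum>i<n. (B i)\<^sup>2 * (w i)\<^sup>2) \<partial>gauss_n n) = (\<Sum>i<n. (B i)\<^sup>2)" using 1 by simp
    have "integrable (gauss_n n) ?f" using S 2 by simp
    moreover have "(\<integral>w. ?f w \<partial>gauss_n n) = 3 / a\<^sup>2 * (2 * (\<Sum>i<n. (A i)\<^sup>2) + (\<Sum>i<n. (B i)\<^sup>2) + 2 * (\<Sum>i<n. (C i)\<^sup>2))"
      using S 2 3 G.prob_space by simp
    moreover have "0 \<le> ?f w" for w
      by (intro mult_nonneg_nonneg add_nonneg_nonneg sum_nonneg) auto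
    ultimately show ?thesis
      by (subst nn_integral_eq_integral) (auto simp only: intro!: AE_I2)
  qed
  also have "\<dots> \<le> ennreal (15 * real n * \<kappa>\<^sup>2 / a\<^sup>2)"
  proof (rule ennreal_leI)
    have b: "(\<Sum>i<n. (D i)\<^sup>2) \<le> real n * \<kappa>\<^sup>2" if "\<And>i. i < n \<Longrightarrow> \<bar>D i\<bar> \<le> \<kappa>" for D
    proof -
      have "(D i)\<^sup>2 \<le> \<kappa>\<^sup>2" if "i < n" for i
        using power_mono[OF \<open>\<And>i. i < n \<Longrightarrow> \<bar>D i\<bar> \<le> \<kappa>\<close>[OF that] abs_ge_zero, of 2] by simp
      then show ?thesis using sum_bounded_above[of "{..<n}" "\<lambda>i. (D i)\<^sup>2" "\<kappa>\<^sup>2"] by simp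
    qed
    have "2 * (\<Sum>i<n. (A i)\<^sup>2) + (\<Sum>i<n. (B i)\<^sup>2) + 2 * (\<Sum>i<n. (C i)\<^sup>2) \<le> 5 * (real n * \<kappa>\<^sup>2)"
      using b[of A, OF assms(1)] b[of B, OF assms(2)] b[of C, OF assms(3)] by simp
    then have "3 / a\<^sup>2 * (2 * (\<Sum>i<n. (A i)\<^sup>2) + (\<Sum>i<n. (B i)\<^sup>2) + 2 * (\<Sum>i<n. (C i)\<^sup>2)) \<le> 3 / a\<^sup>2 * (5 * (real n * \<kappa>\<^sup>2))"
      using a by (intro mult_left_mono) auto
    then show "3 / a\<^sup>2 * (2 * (\<Sum>i<n. (A i)\<^sup>2) + (\<Sum>i<n. (B i)\<^sup>2) + 2 * (\<Sum>i<n. (C i)\<^sup>2)) \<le> 15 * real n * \<kappa>\<^sup>2 / a\<^sup>2"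
      by simp
  qed
  finally show ?thesis .
qed

definition small_dist :: "nat \<Rightarrow> (nat \<Rightarrow> real) \<Rightarrow> real \<Rightarrow> real \<Rightarrow> (nat \<Rightarrow> real) \<Rightarrow> (nat \<Rightarrow> real) \<Rightarrow> bool" where
  "small_dist n lam \<sigma> d w z \<longleftrightarrow> (\<Sum>i<n. lam i * (w i - \<sigma> * z i)\<^sup>2) \<le> d"

text \<open>The test channel is \<open>z i = a i * w i / \<sigma> + sqrt (1 - a i) * y i\<close> with standard Gaussian \<open>y\<close>.
  When \<open>\<sigma>\<^sup>2\<close> equals the ratio of the sums of \<open>(a i)\<^sup>2\<close> and \<open>a i\<close>, its mean log-likelihood ratio against
  the codeword distribution is the rate and its mean distortion is the sum of
  \<open>lam i / (1 + T * lam i)\<close>; the fluctuations are quadratic forms with bounded coefficients.\<close>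

lemma diagonal_codeword_probability:
  fixes lam :: "nat \<Rightarrow> real" and T T0 \<delta> \<sigma> \<rho> \<gamma> :: real
  defines "a i \<equiv> T * lam i / (1 + T * lam i)"
  assumes n: "0 < n" and lam: "\<And>i. i < n \<Longrightarrow> 0 \<le> lam i"
    and T: "0 < T0" "T0 \<le> T" and \<delta>: "0 < \<delta>" "\<delta> \<le> 1" and \<sigma>: "0 < \<sigma>" "\<delta> \<le> \<sigma>\<^sup>2" "\<sigma>\<^sup>2 \<le> 2"
    and sig_lo: "(\<Sum>i<n. (a i)\<^sup>2) \<le> \<sigma>\<^sup>2 * (\<Sum>i<n. a i)"
    and sig_hi: "\<sigma>\<^sup>2 * (\<Sum>i<n. a i) \<le> (\<Sum>i<n. (a i)\<^sup>2) + \<delta> * (\<Sum>i<n. a i)"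
    and rate: "(\<Sum>i<n. ln (1 + T * lam i) / 2) \<le> real n * \<rho>"
    and \<gamma>: "0 < \<gamma>"
    and dist: "(1 + \<delta>) * (\<Sum>i<n. lam i / (1 + T * lam i)) \<le> real n * D"
  defines "\<kappa> \<equiv> 1 / \<delta> + 3 / T0 + 1"
  shows "\<exists>Bad \<in> sets (leb_n n). emeasure (gauss_n n) Bad \<le> ennreal (60 * \<kappa>\<^sup>2 / (real n * \<gamma>\<^sup>2)) \<and>
    (\<forall>w \<in> space (leb_n n) - Bad.
      ennreal (exp (- (real n * (\<rho> + \<gamma>))) / 2) \<le>
      (\<integral>\<^sup>+z. indicator {z. small_dist n lam \<sigma> (real n * (D + \<gamma>)) w z} z \<partial>gauss_n n))"
proof -
  interpret G: prob_space "gauss_n n" by (rule prob_space_gauss_n)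
  define s where "s i = sqrt (1 - a i)" for i
  have Tpos: "0 < T" using T by simp
  have den: "0 < 1 + T * lam i" if "i < n" for i using lam[OF that] Tpos by (simp add: add_pos_nonneg)
  have a: "0 \<le> a i" "a i < 1" if "i < n" for i
    using den[OF that] lam[OF that] Tpos by (auto simp: a_def field_simps)
  have s2: "(s i)\<^sup>2 = 1 - a i" and s: "0 < s i" "s i \<le> 1" if "i < n" for i
    using a[OF that] by (auto simp: s_def)
  have a1: "1 - a i = 1 / (1 + T * lam i)" if "i < n" for i using den[OF that] by (simp add: a_def field_simps)
  have lns: "- ln (s i) = ln (1 + T * lam i) / 2" if "i < n" for i
  proof -
    have "ln (s i) = ln (1 - a i) / 2" unfolding s_def using a[OF that] by (intro ln_sqrt) auto
    then show ?thesis using den[OF that] by (simp add: a1[OF that] ln_div)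
  qed
  \<comment> \<open>The eigenvalue itself has no uniform bound. Absorbed into
    \<open>a i / T\<close>, it leaves distortion coefficients built only from \<open>a i\<close>,
    \<open>s i\<close>, \<sigma> and \<open>1 / T\<close>.\<close>
  have la: "lam i * (1 - a i) = a i / T" if "i < n" for i
    using Tpos by (simp add: a1[OF that]) (simp add: a_def)
  \<comment> \<open>Index 1 belongs to the log-likelihood ratio, index 2 to the distortion; A, B and
    C are the coefficients of the source, mixed and noise terms.\<close>
  define A1 where "A1 i = (a i)\<^sup>2 / (2 * \<sigma>\<^sup>2)" for i
  define B1 where "B1 i = a i * s i / \<sigma>" for i
  define C1 where "C1 i = - a i / 2" for i
  define A2 where "A2 i = a i * (1 - a i) / T" for i
  define B2 where "B2 i = - 2 * (a i / T) * \<sigma> * s i" for i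
  define C2 where "C2 i = \<sigma>\<^sup>2 * a i / T" for i
  have iT: "1 / T \<le> 1 / T0" using T by (intro divide_left_mono) auto
  have id: "1 / \<sigma>\<^sup>2 \<le> 1 / \<delta>" using \<delta> \<sigma> by (intro divide_left_mono) auto
  have d1: "1 \<le> 1 / \<delta>" using \<delta> by simp
  have isg: "1 / \<sigma> \<le> 1 / \<delta>"
  proof -
    have "\<delta>\<^sup>2 \<le> \<delta>" using \<delta> by (simp add: power2_eq_square mult_left_le)
    then have "\<delta>\<^sup>2 \<le> \<sigma>\<^sup>2" using \<sigma>(2) by (rule order_trans)
    then have "\<delta> \<le> \<sigma>" by (rule power2_le_imp_le) (use \<sigma> in simp)
    then show ?thesis using \<delta> \<sigma> by (intro divide_left_mono) auto
  qed
  have T0i: "0 < 1 / T0" "0 < 1 / T" using T by auto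
  \<comment> \<open>A rational bound for the square root of 2. With it
    \<open>\<bar>B2 i\<bar>\<close> is at most \<open>3 / T\<close>, the origin of
    \<open>3 / T0\<close> in \<kappa>.\<close>
  have s32: "\<sigma> \<le> 3 / 2"
    using \<sigma> by (intro power2_le_imp_le[of \<sigma> "3/2"]) (auto simp: power2_eq_square)
  have \<kappa>: "1 / \<delta> \<le> \<kappa>" "1 \<le> \<kappa>" "3 / T \<le> \<kappa>" "2 / T \<le> \<kappa>" "1 / T \<le> \<kappa>"
  proof -
    have "0 < 3 / T0" "3 / T \<le> 3 / T0" "2 / T \<le> 3 / T" "1 / T \<le> 3 / T" using T iT by (auto simp: divide_right_mono)
    then show "1 / \<delta> \<le> \<kappa>" "1 \<le> \<kappa>" "3 / T \<le> \<kappa>" "2 / T \<le> \<kappa>" "1 / T \<le> \<kappa>" using d1 unfolding \<kappa>_def by linarith+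
  qed
  have bnd: "\<bar>A1 i\<bar> \<le> \<kappa>" "\<bar>B1 i\<bar> \<le> \<kappa>" "\<bar>C1 i\<bar> \<le> \<kappa>" "\<bar>A2 i\<bar> \<le> \<kappa>" "\<bar>B2 i\<bar> \<le> \<kappa>" "\<bar>C2 i\<bar> \<le> \<kappa>" if i: "i < n" for i
  proof -
    note ai = a[OF i] and si = s[OF i]
    have a2: "(a i)\<^sup>2 \<le> 1" using ai by (simp add: power_le_one)
    have "A1 i \<le> 1 * (1 / \<sigma>\<^sup>2)" unfolding A1_def using a2 \<sigma>
      by (simp add: divide_simps)
    moreover have "0 \<le> A1 i" by (simp add: A1_def)
    ultimately show "\<bar>A1 i\<bar> \<le> \<kappa>" using id \<kappa> by simp
    have "a i * s i \<le> 1 * 1" using ai si by (intro mult_mono) auto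
    then have "B1 i \<le> 1 / \<sigma>" unfolding B1_def using \<sigma> by (intro divide_right_mono) auto
    moreover have "0 \<le> B1 i" using ai si \<sigma> by (simp add: B1_def)
    ultimately show "\<bar>B1 i\<bar> \<le> \<kappa>" using isg \<kappa> by simp
    show "\<bar>C1 i\<bar> \<le> \<kappa>" using ai \<kappa>(2) by (simp add: C1_def)
    have "a i * (1 - a i) \<le> 1 * 1" using ai by (intro mult_mono) auto
    then have "A2 i \<le> 1 / T" unfolding A2_def using Tpos by (intro divide_right_mono) auto
    moreover have "0 \<le> A2 i" using ai Tpos by (simp add: A2_def)
    ultimately show "\<bar>A2 i\<bar> \<le> \<kappa>" using \<kappa> by simp
    have "a i * (\<sigma> * s i) \<le> 1 * (3/2 * 1)" using ai si s32 \<sigma> by (intro mult_mono) auto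
    then have "2 * (a i * (\<sigma> * s i)) / T \<le> 3 / T" using Tpos by (intro divide_right_mono) auto
    moreover have "\<bar>B2 i\<bar> = 2 * (a i * (\<sigma> * s i)) / T" using ai si \<sigma> Tpos by (simp add: B2_def abs_mult)
    ultimately show "\<bar>B2 i\<bar> \<le> \<kappa>" using \<kappa> by simp
    have "\<sigma>\<^sup>2 * a i \<le> 2 * 1" using ai \<sigma> by (intro mult_mono) auto
    then have "C2 i \<le> 2 / T" unfolding C2_def using Tpos by (intro divide_right_mono) auto
    moreover have "0 \<le> C2 i" using ai Tpos by (simp add: C2_def)
    ultimately show "\<bar>C2 i\<bar> \<le> \<kappa>" using \<kappa> by simp
  qed
  define z where "z w y = (\<lambda>i\<in>{..<n}. (a i * w i / \<sigma>) + s i * y i)" for w y :: "nat \<Rightarrow> real"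
  define LL where "LL w y = (\<Sum>i<n. - ln (s i) + ((a i * w i / \<sigma> + s i * y i)\<^sup>2 - (y i)\<^sup>2) / 2)" for w y :: "nat \<Rightarrow> real"
  define X1 where "X1 = bilin_form n A1 B1 C1"
  define X2 where "X2 = bilin_form n A2 B2 C2"
  have [measurable]: "case_prod X1 \<in> borel_measurable (leb_n n \<Otimes>\<^sub>M leb_n n)" "case_prod X2 \<in> borel_measurable (leb_n n \<Otimes>\<^sub>M leb_n n)"
    unfolding X1_def X2_def by measurable
  have LL: "LL w y \<le> real n * \<rho> + X1 w y" for w y
  proof -
    have "LL w y = (\<Sum>i<n. ln (1 + T * lam i) / 2) + X1 w y + ((\<Sum>i<n. (a i)\<^sup>2) / \<sigma>\<^sup>2 - (\<Sum>i<n. a i)) / 2"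
    proof -
      have "- ln (s i) + ((a i * w i / \<sigma> + s i * y i)\<^sup>2 - (y i)\<^sup>2) / 2 =
        ln (1 + T * lam i) / 2 + (A1 i * ((w i)\<^sup>2 - 1) + B1 i * w i * y i + C1 i * ((y i)\<^sup>2 - 1)) + ((a i)\<^sup>2 / \<sigma>\<^sup>2 - a i) / 2" if i: "i < n" for i
      proof -
        define r where "r = (a i)\<^sup>2 / \<sigma>\<^sup>2"
        have sq: "(a i * w i / \<sigma> + s i * y i)\<^sup>2 = r * (w i)\<^sup>2 + 2 * B1 i * w i * y i + (s i)\<^sup>2 * (y i)\<^sup>2"
          using \<sigma>(1) by (simp add: r_def B1_def power2_eq_square field_simps)
        have A1r: "A1 i = r / 2" by (simp add: A1_def r_def)
        show ?thesis unfolding lns[OF i] sq s2[OF i] A1r C1_def r_def[symmetric]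
          by (simp add: field_simps)
      qed
      then have "LL w y = (\<Sum>i<n. ln (1 + T * lam i) / 2 + (A1 i * ((w i)\<^sup>2 - 1) + B1 i * w i * y i + C1 i * ((y i)\<^sup>2 - 1)) + ((a i)\<^sup>2 / \<sigma>\<^sup>2 - a i) / 2)"
        unfolding LL_def by (intro sum.cong) auto
      then show ?thesis
        by (simp add: X1_def bilin_form_def sum.distrib sum_subtractf sum_divide_distrib[symmetric])
    qed
    \<comment> \<open>The rate penalty of an isotropic codeword law; its sign is favourable because
      \<open>\<sigma>\<^sup>2\<close> lies on or above the ideal ratio.\<close>
    moreover have "((\<Sum>i<n. (a i)\<^sup>2) / \<sigma>\<^sup>2 - (\<Sum>i<n. a i)) / 2 \<le> 0"
      using sig_lo \<sigma>(1) by (simp add: divide_le_eq mult.commute)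
    ultimately show ?thesis using rate by linarith
  qed
  have DD: "(\<Sum>i<n. lam i * (w i - \<sigma> * z w y i)\<^sup>2) \<le> real n * D + X2 w y" for w y
  proof -
    have "lam i * (w i - \<sigma> * z w y i)\<^sup>2 =
      A2 i * ((w i)\<^sup>2 - 1) + B2 i * w i * y i + C2 i * ((y i)\<^sup>2 - 1) + (a i - (a i)\<^sup>2 + \<sigma>\<^sup>2 * a i) / T" if i: "i < n" for i
    proof -
      have weq: "w i - \<sigma> * z w y i = (1 - a i) * w i - \<sigma> * s i * y i"
        using i \<sigma>(1) by (simp add: z_def field_simps)
      have "lam i * (w i - \<sigma> * z w y i)\<^sup>2 = (lam i * (1 - a i)) * (1 - a i) * (w i)\<^sup>2
        - 2 * (lam i * (1 - a i)) * \<sigma> * s i * w i * y i + lam i * (s i)\<^sup>2 * \<sigma>\<^sup>2 * (y i)\<^sup>2"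
        unfolding weq by (simp add: power2_eq_square algebra_simps)
      also have "lam i * (s i)\<^sup>2 = a i / T" using la[OF i] s2[OF i] by simp
      finally have e: "lam i * (w i - \<sigma> * z w y i)\<^sup>2 = (lam i * (1 - a i)) * (1 - a i) * (w i)\<^sup>2
        - 2 * (lam i * (1 - a i)) * \<sigma> * s i * w i * y i + a i / T * \<sigma>\<^sup>2 * (y i)\<^sup>2" .
      define q where "q = a i / T"
      have qs: "A2 i = q * (1 - a i)" "C2 i = \<sigma>\<^sup>2 * q" "B2 i = - 2 * q * \<sigma> * s i"
        "(a i - (a i)\<^sup>2 + \<sigma>\<^sup>2 * a i) / T = q - q * a i + \<sigma>\<^sup>2 * q"
        by (simp_all add: A2_def B2_def C2_def q_def power2_eq_square add_divide_distrib diff_divide_distrib)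
      show ?thesis unfolding qs e la[OF i] q_def[symmetric] by (simp add: algebra_simps)
    qed
    then have "(\<Sum>i<n. lam i * (w i - \<sigma> * z w y i)\<^sup>2) = (\<Sum>i<n. A2 i * ((w i)\<^sup>2 - 1) + B2 i * w i * y i + C2 i * ((y i)\<^sup>2 - 1) + (a i - (a i)\<^sup>2 + \<sigma>\<^sup>2 * a i) / T)"
      by (intro sum.cong) auto
    also have "\<dots> = X2 w y + ((\<Sum>i<n. a i) - (\<Sum>i<n. (a i)\<^sup>2) + \<sigma>\<^sup>2 * (\<Sum>i<n. a i)) / T"
      by (simp add: X2_def bilin_form_def sum.distrib sum_subtractf sum_divide_distrib[symmetric] sum_distrib_left)
    \<comment> \<open>Exceeding the ideal variance by at most \<delta> costs the factor
      \<open>1 + \<delta>\<close> in distortion.\<close>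
    also have "((\<Sum>i<n. a i) - (\<Sum>i<n. (a i)\<^sup>2) + \<sigma>\<^sup>2 * (\<Sum>i<n. a i)) / T \<le> ((1 + \<delta>) * (\<Sum>i<n. a i)) / T"
      using sig_hi Tpos by (intro divide_right_mono) (auto simp: algebra_simps)
    also have "\<dots> = (1 + \<delta>) * (\<Sum>i<n. lam i / (1 + T * lam i))"
    proof -
      have "(\<Sum>i<n. a i) / T = (\<Sum>i<n. lam i / (1 + T * lam i))"
        unfolding sum_divide_distrib using Tpos by (intro sum.cong) (auto simp: a_def)
      then show ?thesis by (simp flip: times_divide_eq_right)
    qed
    also have "\<dots> \<le> real n * D" by (rule dist)
    finally show ?thesis by simp
  qed
  \<comment> \<open>Given \<open>w\<close>, this bounds the probability that the noise pushes one of
    the two fluctuations to \<open>real n * \<gamma>\<close> or beyond. Its mean is O(1/n), so by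
    Markov's inequality it rarely reaches 1/2.\<close>
  define h where "h w = (\<integral>\<^sup>+y. indicator {real n * \<gamma>..} (X1 w y) + indicator {real n * \<gamma>..} (X2 w y) \<partial>gauss_n n)" for w
  have h[measurable]: "h \<in> borel_measurable (leb_n n)"
  proof -
    have "(\<lambda>w. \<integral>\<^sup>+y. indicator {real n * \<gamma>..} (X1 w y) + indicator {real n * \<gamma>..} (X2 w y) \<partial>gauss_n n) \<in> borel_measurable (gauss_n n)"
      by (rule G.borel_measurable_nn_integral) measurable
    then show ?thesis unfolding h_def[abs_def] by (simp add: measurable_cong_sets[OF sets_gauss_n refl])
  qed
  define Bad where "Bad = {w \<in> space (leb_n n). 1 / 2 \<le> h w}"
  have Bad[measurable]: "Bad \<in> sets (leb_n n)" unfolding Bad_def by measurable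
  have hint: "(\<integral>\<^sup>+w. h w \<partial>gauss_n n) \<le> ennreal (30 * \<kappa>\<^sup>2 / (real n * \<gamma>\<^sup>2))"
  proof -
    let ?t = "15 * real n * \<kappa>\<^sup>2 / (real n * \<gamma>)\<^sup>2"
    have t1: "(\<integral>\<^sup>+w. (\<integral>\<^sup>+y. indicator {real n * \<gamma>..} (X1 w y) \<partial>gauss_n n) \<partial>gauss_n n) \<le> ennreal ?t"
      unfolding X1_def using n \<gamma> bnd by (intro bilin_form_tail) auto
    have t2: "(\<integral>\<^sup>+w. (\<integral>\<^sup>+y. indicator {real n * \<gamma>..} (X2 w y) \<partial>gauss_n n) \<partial>gauss_n n) \<le> ennreal ?t"
      unfolding X2_def using n \<gamma> bnd by (intro bilin_form_tail) auto
    have "(\<integral>\<^sup>+w. h w \<partial>gauss_n n) = (\<integral>\<^sup>+w. (\<integral>\<^sup>+y. indicator {real n * \<gamma>..} (X1 w y) \<partial>gauss_n n) + (\<integral>\<^sup>+y. indicator {real n * \<gamma>..} (X2 w y) \<partial>gauss_n n) \<partial>gauss_n n)"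
    proof (rule nn_integral_cong)
      fix w assume "w \<in> space (gauss_n n)"
      then have [measurable]: "X1 w \<in> borel_measurable (leb_n n)" "X2 w \<in> borel_measurable (leb_n n)"
        by (auto simp: sets_eq_imp_space_eq[OF sets_gauss_n] intro: measurable_Pair2[of "case_prod X1", simplified] measurable_Pair2[of "case_prod X2", simplified])
      show "h w = (\<integral>\<^sup>+y. indicator {real n * \<gamma>..} (X1 w y) \<partial>gauss_n n) + (\<integral>\<^sup>+y. indicator {real n * \<gamma>..} (X2 w y) \<partial>gauss_n n)"
        unfolding h_def by (rule nn_integral_add) measurable
    qed
    also have "\<dots> = (\<integral>\<^sup>+w. (\<integral>\<^sup>+y. indicator {real n * \<gamma>..} (X1 w y) \<partial>gauss_n n) \<partial>gauss_n n) + (\<integral>\<^sup>+w. (\<integral>\<^sup>+y. indicator {real n * \<gamma>..} (X2 w y) \<partial>gauss_n n) \<partial>gauss_n n)"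
      by (rule nn_integral_add; rule G.borel_measurable_nn_integral; measurable)
    also have "\<dots> \<le> ennreal ?t + ennreal ?t" by (intro add_mono t1 t2)
    also have "\<dots> = ennreal (30 * \<kappa>\<^sup>2 / (real n * \<gamma>\<^sup>2))"
      using n \<gamma> by (subst ennreal_plus[symmetric]) (auto simp: power2_eq_square field_simps)
    finally show ?thesis .
  qed
  have "emeasure (gauss_n n) Bad \<le> ennreal (60 * \<kappa>\<^sup>2 / (real n * \<gamma>\<^sup>2))"
  proof -
    have "emeasure (gauss_n n) Bad = (\<integral>\<^sup>+w. indicator Bad w \<partial>gauss_n n)" by simp
    also have "\<dots> \<le> (\<integral>\<^sup>+w. 2 * h w \<partial>gauss_n n)"
    proof (rule nn_integral_mono)
      fix w
      have "2 * (1 / 2) \<le> 2 * h w" if "w \<in> Bad" using that unfolding Bad_def by (intro mult_left_mono) auto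
      moreover have "2 * (1 / 2) = (1 :: ennreal)" by (simp add: ennreal_times_divide)
      ultimately show "indicator Bad w \<le> 2 * h w" by (auto simp: indicator_def)
    qed
    also have "\<dots> = 2 * (\<integral>\<^sup>+w. h w \<partial>gauss_n n)" by (rule nn_integral_cmult) measurable
    also have "\<dots> \<le> 2 * ennreal (30 * \<kappa>\<^sup>2 / (real n * \<gamma>\<^sup>2))" by (intro mult_left_mono hint) auto
    also have "\<dots> = ennreal (60 * \<kappa>\<^sup>2 / (real n * \<gamma>\<^sup>2))"
      by (simp add: ennreal_mult''[symmetric] flip: ennreal_numeral)
    finally show ?thesis .
  qed
  moreover have "ennreal (exp (- (real n * (\<rho> + \<gamma>))) / 2) \<le>
      (\<integral>\<^sup>+z. indicator {z. small_dist n lam \<sigma> (real n * (D + \<gamma>)) w z} z \<partial>gauss_n n)"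
    if w: "w \<in> space (leb_n n) - Bad" for w
  proof -
    have [measurable]: "X1 w \<in> borel_measurable (leb_n n)" "X2 w \<in> borel_measurable (leb_n n)"
      using w by (auto intro: measurable_Pair2[of "case_prod X1", simplified] measurable_Pair2[of "case_prod X2", simplified])
    let ?F = "\<lambda>z. indicator {z. small_dist n lam \<sigma> (real n * (D + \<gamma>)) w z} z :: ennreal"
    have F[measurable]: "?F \<in> borel_measurable (leb_n n)" unfolding small_dist_def by measurable
    have hw: "h w \<le> 1 / 2" using w by (auto simp: Bad_def)
    \<comment> \<open>Pointwise in \<open>y\<close>, either a fluctuation is large, or the codeword
      hits and the weight \<open>exp (real n * (\<rho> + \<gamma>) - LL w y)\<close> is at least 1.
      Outside \<open>Bad\<close> the first alternative contributes at most 1/2; the other half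
      becomes, after the change of measure, the factor 1/2 in the hitting bound.\<close>
    have "1 \<le> (\<integral>\<^sup>+y. ?F (z w y) * ennreal (exp (real n * (\<rho> + \<gamma>) - LL w y)) + (indicator {real n * \<gamma>..} (X1 w y) + indicator {real n * \<gamma>..} (X2 w y)) \<partial>gauss_n n)"
    proof -
      have "1 = (\<integral>\<^sup>+y. 1 \<partial>gauss_n n)" by (simp add: G.emeasure_space_1)
      also have "\<dots> \<le> (\<integral>\<^sup>+y. ?F (z w y) * ennreal (exp (real n * (\<rho> + \<gamma>) - LL w y)) + (indicator {real n * \<gamma>..} (X1 w y) + indicator {real n * \<gamma>..} (X2 w y)) \<partial>gauss_n n)"
      proof (rule nn_integral_mono)
        fix y
        show "1 \<le> ?F (z w y) * ennreal (exp (real n * (\<rho> + \<gamma>) - LL w y)) + (indicator {real n * \<gamma>..} (X1 w y) + indicator {real n * \<gamma>..} (X2 w y))"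
        proof (cases "real n * \<gamma> \<le> X1 w y \<or> real n * \<gamma> \<le> X2 w y")
          case True
          then show ?thesis by (auto simp: indicator_def add_increasing add_increasing2)
        next
          case False
          have "?F (z w y) = 1" using DD[of w y] False by (simp add: small_dist_def algebra_simps)
          moreover have "1 \<le> exp (real n * (\<rho> + \<gamma>) - LL w y)" using LL[of w y] False by (simp add: algebra_simps)
          ultimately show ?thesis using False by (simp add: indicator_def)
        qed
      qed
      finally show ?thesis .
    qed
    also have "\<dots> = (\<integral>\<^sup>+y. ?F (z w y) * ennreal (exp (real n * (\<rho> + \<gamma>) - LL w y)) \<partial>gauss_n n) + h w"
      unfolding h_def z_def LL_def by (rule nn_integral_add) measurable
    also have "\<dots> \<le> (\<integral>\<^sup>+y. ?F (z w y) * ennreal (exp (real n * (\<rho> + \<gamma>) - LL w y)) \<partial>gauss_n n) + 1 / 2"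
      using hw by (intro add_mono) auto
    also have "(\<integral>\<^sup>+y. ?F (z w y) * ennreal (exp (real n * (\<rho> + \<gamma>) - LL w y)) \<partial>gauss_n n)
       = (\<integral>\<^sup>+y. ennreal (exp (real n * (\<rho> + \<gamma>))) * (?F (z w y) * ennreal (exp (- LL w y))) \<partial>gauss_n n)"
      by (intro nn_integral_cong) (simp add: exp_diff exp_minus divide_inverse ennreal_mult mult.left_commute)
    also have "\<dots> = ennreal (exp (real n * (\<rho> + \<gamma>))) * (\<integral>\<^sup>+y. ?F (z w y) * ennreal (exp (- LL w y)) \<partial>gauss_n n)"
      unfolding z_def LL_def by (rule nn_integral_cmult) measurable
    also have "(\<integral>\<^sup>+y. ?F (z w y) * ennreal (exp (- LL w y)) \<partial>gauss_n n) = (\<integral>\<^sup>+z. ?F z \<partial>gauss_n n)"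
      unfolding z_def LL_def using s F by (intro gauss_n_change_of_measure[symmetric]) auto
    finally have le: "1 \<le> ennreal (exp (real n * (\<rho> + \<gamma>))) * (\<integral>\<^sup>+z. ?F z \<partial>gauss_n n) + 1 / 2" .
    have fin: "(\<integral>\<^sup>+z. ?F z \<partial>gauss_n n) \<le> 1"
    proof -
      have "(\<integral>\<^sup>+z. ?F z \<partial>gauss_n n) \<le> (\<integral>\<^sup>+z. 1 \<partial>gauss_n n)" by (intro nn_integral_mono) (auto simp: indicator_def)
      then show ?thesis by (simp add: G.emeasure_space_1)
    qed
    then obtain q where q: "(\<integral>\<^sup>+z. ?F z \<partial>gauss_n n) = ennreal q" "0 \<le> q"
      by (cases "(\<integral>\<^sup>+z. ?F z \<partial>gauss_n n)") (auto simp: top_unique)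
    have "ennreal 1 \<le> ennreal (exp (real n * (\<rho> + \<gamma>)) * q + 1 / 2)"
    proof -
      have "(1 / 2 :: ennreal) = ennreal (1 / 2)" using divide_ennreal[of 1 2] by simp
      then show ?thesis using le q by (simp add: ennreal_mult)
    qed
    then have "1 \<le> exp (real n * (\<rho> + \<gamma>)) * q + 1 / 2" using q by (subst (asm) ennreal_le_iff) auto
    moreover have "exp (- t) / 2 \<le> q" if "1 \<le> exp t * q + 1 / 2" for t :: real
      using that by (simp add: exp_minus field_simps)
    ultimately have "exp (- (real n * (\<rho> + \<gamma>))) / 2 \<le> q" by blast
    then show ?thesis unfolding q(1) by (rule ennreal_leI)
  qed
  ultimately show ?thesis using Bad by blast
qed

section \<open>Hitting probability of a codeword, general case\<close>

text \<open>\<open>T_rc\<close> is a definite description, so existence and uniqueness must both be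
  established. The rate is strictly increasing in T because trace n forces a positive eigenvalue,
  and the intermediate value theorem supplies the solution.\<close>

lemma T_rc_properties:
  fixes lam :: "nat \<Rightarrow> real"
  assumes n: "0 < n" and lam: "\<And>i. i < n \<Longrightarrow> 0 \<le> lam i" and tr: "(\<Sum>i<n. lam i) = real n" and R: "0 < R"
  defines "ms \<equiv> image_mset lam (mset_set {..<n})"
  shows "0 < T_rc ms R" "(\<Sum>i<n. log 2 (1 + lam i * T_rc ms R)) = 2 * real n * R"
proof -
  define F where "F T = (\<Sum>i<n. log 2 (1 + lam i * T))" for T
  obtain j where j: "j < n" "0 < lam j"
  proof (rule ccontr)
    assume "\<not> thesis"
    then have "\<forall>i<n. lam i \<le> 0" using that by (meson not_le)
    then have "(\<Sum>i<n. lam i) \<le> 0" by (intro sum_nonpos) auto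
    then show False using tr n by simp
  qed
  have p: "0 < 1 + lam i * T" if "i < n" "0 \<le> T" for i T using lam[OF that(1)] that by (simp add: add_pos_nonneg)
  have mono: "F S < F T" if "0 \<le> S" "S < T" for S T
    unfolding F_def
  proof (rule sum_strict_mono_ex1)
    show "\<forall>i\<in>{..<n}. log 2 (1 + lam i * S) \<le> log 2 (1 + lam i * T)"
      using that lam p by (auto simp: mult_left_mono)
    show "\<exists>i\<in>{..<n}. log 2 (1 + lam i * S) < log 2 (1 + lam i * T)"
      using that j p[of j S] p[of j T] by (intro bexI[of _ j]) auto
  qed simp
  \<comment> \<open>At this T the j-th term alone equals the required sum, which bounds the interval
    for the intermediate value theorem.\<close>
  define Tm where "Tm = (2 powr (2 * real n * R) - 1) / lam j"
  have pw: "1 \<le> 2 powr (2 * real n * R)" using R by (intro ge_one_powr_ge_zero) auto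
  then have Tm: "0 \<le> Tm" using j by (simp add: Tm_def)
  have "2 * real n * R = log 2 (1 + lam j * Tm)" using j by (simp add: Tm_def)
  also have "\<dots> \<le> F Tm" unfolding F_def
    using j Tm lam by (intro member_le_sum) (auto intro!: zero_le_log_cancel_iff[THEN iffD2] add_pos_nonneg)
  finally have hi: "2 * real n * R \<le> F Tm" .
  have "continuous_on {0..Tm} F" unfolding F_def log_def
    by (intro continuous_intros) (use p in force)+
  moreover have "F 0 \<le> 2 * real n * R" using R by (simp add: F_def)
  ultimately obtain T where T: "0 \<le> T" "T \<le> Tm" "F T = 2 * real n * R"
    using IVT'[of F 0 "2 * real n * R" Tm] hi Tm by auto
  have "F 0 = 0" by (simp add: F_def)
  then have Tp: "0 < T" using T R n by (cases "T = 0") auto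
  have sz: "size ms = n" by (simp add: ms_def)
  have eq: "(1 / (2 * real (size ms))) * (\<Sum>l\<in>#ms. log 2 (1 + l * T)) = R \<longleftrightarrow> F T = 2 * real n * R" for T
  proof -
    have "(\<Sum>l\<in>#ms. log 2 (1 + l * T)) = F T"
      by (simp add: ms_def F_def sum_unfold_sum_mset image_mset.compositionality comp_def)
    then show ?thesis using n by (simp add: sz field_simps)
  qed
  have "\<exists>!T. T > 0 \<and> (1 / (2 * real (size ms))) * (\<Sum>l\<in>#ms. log 2 (1 + l * T)) = R"
    unfolding eq using T Tp mono by (intro ex1I[of _ T]) (auto, metis less_eq_real_def linorder_neqE_linordered_idom less_irrefl)
  from theI'[OF this, folded T_rc_def] show "0 < T_rc ms R" "(\<Sum>i<n. log 2 (1 + lam i * T_rc ms R)) = 2 * real n * R"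
    unfolding eq F_def by auto
qed

lemma D_rc_eq:
  assumes "0 < n"
  shows "real n * D_rc (image_mset lam (mset_set {..<n})) R =
    (\<Sum>i<n. lam i / (1 + lam i * T_rc (image_mset lam (mset_set {..<n})) R))"
  using assms by (simp add: D_rc_def sum_unfold_sum_mset image_mset.compositionality comp_def)

text \<open>Truncating \<open>T\<close> at \<open>1 / \<eta>\<close> costs at most \<open>\<eta>\<close> in distortion and keeps the later quadratic
  forms bounded uniformly in the spectrum.\<close>

lemma bounded_T_rc:
  fixes lam :: "nat \<Rightarrow> real"
  assumes n: "0 < n" and lam: "\<And>i. i < n \<Longrightarrow> 0 \<le> lam i" and tr: "(\<Sum>i<n. lam i) = real n" and R: "0 < R"
    and \<eta>: "0 < \<eta>"
  defines "ms \<equiv> image_mset lam (mset_set {..<n})"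
  shows "0 \<le> D_rc ms R"
    "\<exists>T\<ge>min (2 * R * ln 2) (1 / \<eta>). (\<Sum>i<n. ln (1 + T * lam i) / 2) \<le> real n * (R * ln 2) \<and>
       (\<Sum>i<n. lam i / (1 + T * lam i)) \<le> real n * (D_rc ms R + \<eta>)"
proof -
  let ?T = "T_rc ms R"
  note T = T_rc_properties[OF n lam tr R, folded ms_def]
  note D = D_rc_eq[OF n, of lam R, folded ms_def]
  have p: "0 < 1 + lam i * T" if "i < n" "0 \<le> T" for i T using lam[OF that(1)] that by (simp add: add_pos_nonneg)
  have "0 \<le> real n * D_rc ms R" unfolding D using lam p[of _ ?T] T(1)
    by (intro sum_nonneg divide_nonneg_nonneg) (auto simp: less_imp_le)
  then show D0: "0 \<le> D_rc ms R" using n by (simp add: zero_le_mult_iff)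
  have rate: "(\<Sum>i<n. ln (1 + ?T * lam i) / 2) = real n * (R * ln 2)"
  proof -
    have "(\<Sum>i<n. ln (1 + ?T * lam i) / 2) = (\<Sum>i<n. log 2 (1 + lam i * ?T)) * ln 2 / 2"
      unfolding sum_distrib_right sum_divide_distrib by (simp add: log_def mult.commute)
    also have "\<dots> = real n * (R * ln 2)" using T(2) by simp
    finally show ?thesis .
  qed
  show "\<exists>T\<ge>min (2 * R * ln 2) (1 / \<eta>). (\<Sum>i<n. ln (1 + T * lam i) / 2) \<le> real n * (R * ln 2) \<and>
       (\<Sum>i<n. lam i / (1 + T * lam i)) \<le> real n * (D_rc ms R + \<eta>)"
  proof (cases "?T \<le> 1 / \<eta>")
    case True
    \<comment> \<open>Trace n and \<open>ln (1 + x) \<le> x\<close> give T at least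
      \<open>2 * R * ln 2\<close>: a positive rate keeps T away from 0, whatever the
      spectrum.\<close>
    have "real n * (R * ln 2) \<le> (\<Sum>i<n. ?T * lam i / 2)" unfolding rate[symmetric]
      using T(1) lam by (intro sum_mono divide_right_mono ln_add_one_self_le_self) auto
    also have "\<dots> = ?T * real n / 2"
      using tr by (simp add: sum_distrib_left[symmetric] sum_divide_distrib[symmetric])
    finally have "2 * R * ln 2 \<le> ?T" using n by simp
    moreover have "(\<Sum>i<n. lam i / (1 + ?T * lam i)) \<le> real n * (D_rc ms R + \<eta>)"
      using D \<eta> n by (simp add: mult.commute distrib_left)
    ultimately show ?thesis using rate by (intro exI[of _ ?T]) auto
  next
    case False
    \<comment> \<open>Lowering T can only lower the rate sum, and at \<open>1 / \<eta>\<close> each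
      summand of the distortion is at most \<eta>.\<close>
    let ?S = "1 / \<eta>"
    have S: "0 < ?S" using \<eta> by simp
    have "(\<Sum>i<n. ln (1 + ?S * lam i) / 2) \<le> (\<Sum>i<n. ln (1 + ?T * lam i) / 2)"
      using False lam p[of _ ?S] S
      by (intro sum_mono divide_right_mono ln_mono add_left_mono mult_right_mono) (auto simp: mult.commute)
    moreover have "(\<Sum>i<n. lam i / (1 + ?S * lam i)) \<le> (\<Sum>i<n. \<eta>)"
    proof (rule sum_mono)
      fix i assume "i \<in> {..<n}"
      then have "0 < 1 + ?S * lam i" using p[of i ?S] S by (simp add: mult.commute)
      then show "lam i / (1 + ?S * lam i) \<le> \<eta>" using \<eta> by (simp add: divide_le_eq distrib_left)
    qed
    moreover have "real n * \<eta> \<le> real n * (D_rc ms R + \<eta>)" using D0 by (intro mult_left_mono) auto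
    ultimately show ?thesis using rate by (intro exI[of _ ?S]) auto
  qed
qed

text \<open>As every \<open>a i\<close> lies in [0, 1], the ratio of the two sums lies in (0, 1], so
  rounding it to a multiple of \<delta> takes finitely many levels. Rounding goes upwards because
  the likelihood bound tolerates only an excess of variance; positivity of the ratio gives
  \<open>m\<close> at least 1, hence variance at least \<delta>.\<close>

lemma variance_level:
  fixes a :: "nat \<Rightarrow> real"
  assumes a: "\<And>i. i < n \<Longrightarrow> 0 \<le> a i" "\<And>i. i < n \<Longrightarrow> a i \<le> 1" and pos: "0 < (\<Sum>i<n. a i)" and \<delta>: "0 < \<delta>"
  shows "\<exists>m\<in>{1..nat \<lceil>1 / \<delta>\<rceil>}. (\<Sum>i<n. (a i)\<^sup>2) \<le> real m * \<delta> * (\<Sum>i<n. a i) \<and>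
    real m * \<delta> * (\<Sum>i<n. a i) \<le> (\<Sum>i<n. (a i)\<^sup>2) + \<delta> * (\<Sum>i<n. a i)"
proof -
  let ?s = "\<Sum>i<n. a i" and ?q = "\<Sum>i<n. (a i)\<^sup>2"
  define r where "r = ?q / ?s"
  have q: "?q = r * ?s" using pos by (simp add: r_def)
  have "?q \<le> ?s" using a by (intro sum_mono) (simp add: power2_eq_square mult_left_le)
  then have r1: "r \<le> 1" using pos by (simp add: r_def)
  obtain i where i: "i < n" "0 < a i"
  proof (rule ccontr)
    assume "\<not> thesis"
    then have "\<forall>i<n. a i \<le> 0" using that by (meson not_le)
    then have "?s \<le> 0" by (intro sum_nonpos) auto
    then show False using pos by simp
  qed
  have "(a i)\<^sup>2 \<le> ?q" using i by (intro member_le_sum) auto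
  then have "0 < ?q" using i by (smt (verit) zero_less_power)
  then have r0: "0 < r" using pos by (simp add: r_def)
  define m where "m = nat \<lceil>r / \<delta>\<rceil>"
  have c0: "0 < \<lceil>r / \<delta>\<rceil>" using r0 \<delta> by simp
  then have mr: "real m = of_int \<lceil>r / \<delta>\<rceil>" by (simp add: m_def)
  have "r / \<delta> \<le> real m" "real m \<le> r / \<delta> + 1" unfolding mr by linarith+
  then have lo: "r \<le> real m * \<delta>" and hi: "real m * \<delta> \<le> r + \<delta>" using \<delta> by (auto simp: field_simps)
  have "\<lceil>r / \<delta>\<rceil> \<le> \<lceil>1 / \<delta>\<rceil>" using r1 \<delta> by (intro ceiling_mono divide_right_mono) auto
  then have "m \<in> {1..nat \<lceil>1 / \<delta>\<rceil>}" using c0 unfolding m_def by (simp only: atLeastAtMost_iff) linarith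
  moreover have "?q \<le> real m * \<delta> * ?s" unfolding q using lo pos by (intro mult_right_mono) auto
  moreover have "real m * \<delta> * ?s \<le> ?q + \<delta> * ?s"
    unfolding q distrib_right[symmetric] using hi pos by (intro mult_right_mono) auto
  ultimately show ?thesis by blast
qed

section \<open>Distortion in eigencoordinates and reduction to the diagonal case\<close>

definition quad_dist :: "nat \<Rightarrow> real mat \<Rightarrow> (nat \<Rightarrow> real) \<Rightarrow> (nat \<Rightarrow> real) \<Rightarrow> real" where
  "quad_dist n S w c = d_Sigma S (vec n w) (vec n c)"

lemma lin_n_diff:
  "i < n \<Longrightarrow> lin_n n V (\<lambda>k. (vec n w - vec n c) $ k) i = lin_n n V w i - lin_n n V c i"
  by (simp add: lin_n_def algebra_simps sum_subtractf)

lemma lin_n_scale: "i < n \<Longrightarrow> lin_n n V (\<lambda>k. t * x k) i = t * lin_n n V x i"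
  by (simp add: lin_n_def sum_distrib_left mult.left_commute)

lemma psd_mat_quad_dist_spectral:
  assumes "psd_mat n S"
  obtains V lam where "orth_n n V" "\<forall>i<n. 0 \<le> lam i"
    "spec S = image_mset lam (mset_set {..<n})" "mat_trace S = (\<Sum>i<n. lam i)"
    "\<forall>w c. quad_dist n S w c = (\<Sum>i<n. lam i * (lin_n n V w i - lin_n n V c i)\<^sup>2)"
proof -
  obtain V lam where *: "orth_n n V" "\<forall>i<n. 0 \<le> lam i"
    "spec S = image_mset lam (mset_set {..<n})" "mat_trace S = (\<Sum>i<n. lam i)"
    "\<forall>x\<in>carrier_vec n. x \<bullet> (S *\<^sub>v x) = (\<Sum>i<n. lam i * (lin_n n V (\<lambda>k. x $ k) i)\<^sup>2)"
    using psd_mat_spectral[OF assms] by blast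
  have "quad_dist n S w c = (\<Sum>i<n. lam i * (lin_n n V w i - lin_n n V c i)\<^sup>2)" for w c
    unfolding quad_dist_def d_Sigma_def by (subst *(5)[rule_format]) (auto simp: lin_n_diff intro!: sum.cong)
  then show ?thesis using * that by blast
qed

lemma quad_dist_eq:
  assumes "S \<in> carrier_mat n n"
  shows "quad_dist n S w c = (\<Sum>i<n. \<Sum>j<n. S $$ (i, j) * (w i - c i) * (w j - c j))"
  using assms
  by (auto simp: quad_dist_def d_Sigma_def scalar_prod_def lessThan_atLeast0 sum_distrib_left intro!: sum.cong)

text \<open>Controls the loss on source words encoded by the zero codeword. Cauchy-Schwarz with
  weights \<open>lam i\<close> of total n bounds the squared form by n times the weighted sum of
  fourth powers, so the bound does not depend on how the spectrum is spread; rotation invariance and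
  the fourth moment 3 finish.\<close>

lemma quad_dist_second_moment:
  assumes psd: "psd_mat n S" and tr: "mat_trace S = real n"
  shows "(\<integral>\<^sup>+w. ennreal ((quad_dist n S w (\<lambda>_. 0))\<^sup>2) \<partial>gauss_n n) \<le> ennreal (3 * (real n)\<^sup>2)"
proof -
  obtain V lam where V: "orth_n n V" and lam': "\<forall>i<n. 0 \<le> lam i"
    and "spec S = image_mset lam (mset_set {..<n})" and tr': "mat_trace S = (\<Sum>i<n. lam i)"
    and d': "\<forall>w c. quad_dist n S w c = (\<Sum>i<n. lam i * (lin_n n V w i - lin_n n V c i)\<^sup>2)"
    using psd_mat_quad_dist_spectral[OF psd] by blast
  note lam = lam'[rule_format] and d = d'[rule_format]
  let ?F = "\<lambda>x. ennreal (real n * (\<Sum>i<n. lam i * x i ^ 4))"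
  have "(\<integral>\<^sup>+w. ennreal ((quad_dist n S w (\<lambda>_. 0))\<^sup>2) \<partial>gauss_n n) \<le> (\<integral>\<^sup>+w. ?F (lin_n n V w) \<partial>gauss_n n)"
  proof (intro nn_integral_mono ennreal_leI)
    fix w
    let ?u = "lin_n n V w"
    have z: "lin_n n V (\<lambda>_. 0) i = 0" if "i < n" for i using that by (simp add: lin_n_def)
    have "quad_dist n S w (\<lambda>_. 0) = (\<Sum>i<n. sqrt (lam i) * (sqrt (lam i) * (?u i)\<^sup>2))"
      unfolding d using lam z by (intro sum.cong) (auto simp flip: mult.assoc)
    then have "(quad_dist n S w (\<lambda>_. 0))\<^sup>2 \<le> (\<Sum>i<n. (sqrt (lam i))\<^sup>2) * (\<Sum>i<n. (sqrt (lam i) * (?u i)\<^sup>2)\<^sup>2)"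
      using Cauchy_Schwarz_ineq_sum by simp
    also have "(\<Sum>i<n. (sqrt (lam i))\<^sup>2) = (\<Sum>i<n. lam i)" using lam by (intro sum.cong) auto
    also have "(\<Sum>i<n. (sqrt (lam i) * (?u i)\<^sup>2)\<^sup>2) = (\<Sum>i<n. lam i * ?u i ^ 4)"
      using lam by (intro sum.cong) (auto simp: power_mult_distrib)
    finally show "(quad_dist n S w (\<lambda>_. 0))\<^sup>2 \<le> real n * (\<Sum>i<n. lam i * ?u i ^ 4)" using tr tr' by simp
  qed
  also have "\<dots> = (\<integral>\<^sup>+x. ?F x \<partial>gauss_n n)" by (rule nn_integral_gauss_n_orth[OF V]) measurable
  also have "\<dots> = ennreal (3 * (real n)\<^sup>2)"
  proof -
    have 1: "integrable (gauss_n n) (\<lambda>w. w i ^ 4)" "(\<integral>w. w i ^ 4 \<partial>gauss_n n) = 3" if "i < n" for i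
      using gauss_n_component[OF that std_normal_moments(5)] std_normal_moments(6) by simp_all
    have i: "integrable (gauss_n n) (\<lambda>x. real n * (\<Sum>i<n. lam i * x i ^ 4))"
      using 1 by (intro Bochner_Integration.integrable_sum integrable_mult_right) auto
    have "(\<integral>x. real n * (\<Sum>i<n. lam i * x i ^ 4) \<partial>gauss_n n) = real n * (\<Sum>i<n. lam i * 3)"
      using 1 by (simp add: Bochner_Integration.integral_sum)
    also have "\<dots> = 3 * (real n)\<^sup>2" using tr tr' by (simp add: sum_distrib_right[symmetric] power2_eq_square)
    finally show ?thesis using lam i
      by (subst nn_integral_eq_integral) (auto intro!: AE_I2 mult_nonneg_nonneg sum_nonneg)
  qed
  finally show ?thesis .
qed

text \<open>\<open>C\<close> is chosen before \<open>n\<close> and \<open>S\<close>, which later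
  permits one threshold for n. The slacks have separate sources: \<eta> truncates T, \<delta> is the
  step of the variance grid, \<gamma> is the allowed fluctuation.\<close>

lemma codeword_probability:
  fixes R \<delta> \<eta> \<gamma> :: real
  assumes R: "0 < R" and \<delta>: "0 < \<delta>" "\<delta> \<le> 1" and \<eta>: "0 < \<eta>" and \<gamma>: "0 < \<gamma>"
  shows "\<exists>C>0. \<forall>n>0. \<forall>S. psd_mat n S \<and> mat_trace S = real n \<longrightarrow>
    (\<exists>m\<in>{1..nat \<lceil>1 / \<delta>\<rceil>}. \<exists>Bad \<in> sets (leb_n n). emeasure (gauss_n n) Bad \<le> ennreal (C / real n) \<and>
      (\<forall>w \<in> space (leb_n n) - Bad. ennreal (exp (- (real n * (R * ln 2 + \<gamma>))) / 2) \<le>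
        (\<integral>\<^sup>+z. indicator {z. quad_dist n S w (\<lambda>i. sqrt (real m * \<delta>) * z i) \<le> real n * (D_rc (spec S) R + \<eta> + \<delta> + \<gamma>)} z \<partial>gauss_n n)))"
proof -
  define T0 where "T0 = min (2 * R * ln 2) (1 / \<eta>)"
  define \<kappa> where "\<kappa> = 1 / \<delta> + 3 / T0 + 1"
  have T0: "0 < T0" using R \<eta> by (simp add: T0_def)
  have \<kappa>: "0 < \<kappa>" using \<delta> T0 by (simp add: \<kappa>_def add_pos_pos)
  define C where "C = 60 * \<kappa>\<^sup>2 / \<gamma>\<^sup>2"
  have "0 < C" using \<kappa> \<gamma> by (simp add: C_def)
  moreover have "\<exists>m\<in>{1..nat \<lceil>1 / \<delta>\<rceil>}. \<exists>Bad \<in> sets (leb_n n). emeasure (gauss_n n) Bad \<le> ennreal (C / real n) \<and>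
      (\<forall>w \<in> space (leb_n n) - Bad. ennreal (exp (- (real n * (R * ln 2 + \<gamma>))) / 2) \<le>
        (\<integral>\<^sup>+z. indicator {z. quad_dist n S w (\<lambda>i. sqrt (real m * \<delta>) * z i) \<le> real n * (D_rc (spec S) R + \<eta> + \<delta> + \<gamma>)} z \<partial>gauss_n n))"
    if n: "0 < n" and psd: "psd_mat n S" and tr: "mat_trace S = real n" for n S
  proof -
    obtain V lam where V: "orth_n n V" and lam': "\<forall>i<n. 0 \<le> lam i"
      and spec: "spec S = image_mset lam (mset_set {..<n})" and tr': "mat_trace S = (\<Sum>i<n. lam i)"
      and d': "\<forall>w c. quad_dist n S w c = (\<Sum>i<n. lam i * (lin_n n V w i - lin_n n V c i)\<^sup>2)"
      using psd_mat_quad_dist_spectral[OF psd] by blast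
    note lam = lam'[rule_format] and d = d'[rule_format]
    have sl: "(\<Sum>i<n. lam i) = real n" using tr tr' by simp
    obtain T where T: "T0 \<le> T" and rate: "(\<Sum>i<n. ln (1 + T * lam i) / 2) \<le> real n * (R * ln 2)"
      and dst: "(\<Sum>i<n. lam i / (1 + T * lam i)) \<le> real n * (D_rc (spec S) R + \<eta>)"
      using bounded_T_rc(2)[OF n lam sl R \<eta>] unfolding spec T0_def by blast
    have Tp: "0 < T" using T T0 by simp
    have den: "0 < 1 + T * lam i" "1 \<le> 1 + T * lam i" if "i < n" for i using lam[OF that] Tp by (simp_all add: add_pos_nonneg)
    let ?a = "\<lambda>i. T * lam i / (1 + T * lam i)"
    have a: "0 \<le> ?a i" "?a i \<le> 1" if "i < n" for i
      using den(1)[OF that] lam[OF that] Tp by (auto simp: divide_le_eq not_less less_imp_le intro!: divide_nonneg_pos)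
    have apos: "0 < (\<Sum>i<n. ?a i)"
    proof (rule ccontr)
      assume "\<not> 0 < (\<Sum>i<n. ?a i)"
      moreover have "0 \<le> (\<Sum>i<n. ?a i)" using a by (intro sum_nonneg) auto
      ultimately have "(\<Sum>i<n. ?a i) = 0" by simp
      then have "\<forall>i\<in>{..<n}. ?a i = 0" using a by (subst (asm) sum_nonneg_eq_0_iff) auto
      then have "\<forall>i\<in>{..<n}. lam i = 0" using den Tp by (metis divide_eq_0_iff lessThan_iff mult_eq_0_iff less_irrefl)
      then have "(\<Sum>i<n. lam i) = 0" by simp
      then show False using sl n by simp
    qed
    obtain m where m: "m \<in> {1..nat \<lceil>1 / \<delta>\<rceil>}"
      and lo: "(\<Sum>i<n. (?a i)\<^sup>2) \<le> real m * \<delta> * (\<Sum>i<n. ?a i)"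
      and hi: "real m * \<delta> * (\<Sum>i<n. ?a i) \<le> (\<Sum>i<n. (?a i)\<^sup>2) + \<delta> * (\<Sum>i<n. ?a i)"
      using variance_level[of n ?a, OF a apos \<delta>(1)] by blast
    let ?\<sigma> = "sqrt (real m * \<delta>)"
    have s2: "?\<sigma>\<^sup>2 = real m * \<delta>" using \<delta> by simp
    have m1: "1 \<le> real m" using m by simp
    have "real m \<le> of_int \<lceil>1 / \<delta>\<rceil>" using m by (simp add: le_nat_iff) linarith
    also have "\<dots> \<le> 1 / \<delta> + 1" by linarith
    finally have "real m * \<delta> \<le> 2" using \<delta> by (simp add: field_simps)
    \<comment> \<open>By trace n the distortion sum is at most n, so the factor
      \<open>1 + \<delta>\<close> costs an additive \<open>\<delta> * real n\<close>.\<close>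
    have dd: "(1 + \<delta>) * (\<Sum>i<n. lam i / (1 + T * lam i)) \<le> real n * (D_rc (spec S) R + \<eta> + \<delta>)"
    proof -
      have "(\<Sum>i<n. lam i / (1 + T * lam i)) \<le> (\<Sum>i<n. lam i)"
      proof (rule sum_mono)
        fix i assume "i \<in> {..<n}"
        then show "lam i / (1 + T * lam i) \<le> lam i"
          using divide_left_mono[of 1 "1 + T * lam i" "lam i"] lam[of i] den[of i] by simp
      qed
      then have "\<delta> * (\<Sum>i<n. lam i / (1 + T * lam i)) \<le> \<delta> * real n"
        using \<delta> sl by (intro mult_left_mono) auto
      then show ?thesis using dst by (simp add: algebra_simps)
    qed
    obtain Bad where Bad[measurable]: "Bad \<in> sets (leb_n n)" and eB: "emeasure (gauss_n n) Bad \<le> ennreal (60 * \<kappa>\<^sup>2 / (real n * \<gamma>\<^sup>2))"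
      and q: "\<And>w. w \<in> space (leb_n n) - Bad \<Longrightarrow> ennreal (exp (- (real n * (R * ln 2 + \<gamma>))) / 2) \<le>
      (\<integral>\<^sup>+z. indicator {z. small_dist n lam ?\<sigma> (real n * (D_rc (spec S) R + \<eta> + \<delta> + \<gamma>)) w z} z \<partial>gauss_n n)"
      using diagonal_codeword_probability[of n lam T0 T \<delta> ?\<sigma> "R * ln 2" \<gamma> "D_rc (spec S) R + \<eta> + \<delta>"] 
        n lam T0 T \<delta> m1 \<open>real m * \<delta> \<le> 2\<close> lo hi rate \<gamma> dd unfolding s2 \<kappa>_def by (auto simp: add.assoc)
    \<comment> \<open>The exceptional set is pulled back along the rotation, which preserves its
      probability; in the hitting integral the codeword is rotated by the same matrix.\<close>
    let ?B = "lin_n n V -` Bad \<inter> space (leb_n n)"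
    have B: "?B \<in> sets (leb_n n)" by measurable
    have "emeasure (gauss_n n) ?B = (\<integral>\<^sup>+w. indicator ?B w \<partial>gauss_n n)"
      using B by (simp add: sets_gauss_n)
    also have "\<dots> = (\<integral>\<^sup>+w. indicator Bad (lin_n n V w) \<partial>gauss_n n)"
      by (intro nn_integral_cong) (auto simp: indicator_def sets_eq_imp_space_eq[OF sets_gauss_n])
    also have "\<dots> = (\<integral>\<^sup>+w. indicator Bad w \<partial>gauss_n n)" by (rule nn_integral_gauss_n_orth[OF V]) measurable
    also have "\<dots> = emeasure (gauss_n n) Bad" by (simp add: sets_gauss_n)
    also have "\<dots> \<le> ennreal (C / real n)" using eB by (simp add: C_def mult.commute)
    finally have "emeasure (gauss_n n) ?B \<le> ennreal (C / real n)" .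
    moreover have "ennreal (exp (- (real n * (R * ln 2 + \<gamma>))) / 2) \<le>
        (\<integral>\<^sup>+z. indicator {z. quad_dist n S w (\<lambda>i. ?\<sigma> * z i) \<le> real n * (D_rc (spec S) R + \<eta> + \<delta> + \<gamma>)} z \<partial>gauss_n n)"
      if w: "w \<in> space (leb_n n) - ?B" for w
    proof -
      let ?d = "real n * (D_rc (spec S) R + \<eta> + \<delta> + \<gamma>)"
      have "lin_n n V w \<in> space (leb_n n)" using w by (intro measurable_space[OF measurable_lin_n]) auto
      then have "ennreal (exp (- (real n * (R * ln 2 + \<gamma>))) / 2) \<le> (\<integral>\<^sup>+z. indicator {z. small_dist n lam ?\<sigma> ?d (lin_n n V w) z} z \<partial>gauss_n n)"
        using w by (intro q) auto
      also have "\<dots> = (\<integral>\<^sup>+z. indicator {z. small_dist n lam ?\<sigma> ?d (lin_n n V w) z} (lin_n n V z) \<partial>gauss_n n)"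
        unfolding small_dist_def by (rule nn_integral_gauss_n_orth[OF V, symmetric]) measurable
      also have "\<dots> = (\<integral>\<^sup>+z. indicator {z. quad_dist n S w (\<lambda>i. ?\<sigma> * z i) \<le> ?d} z \<partial>gauss_n n)"
      proof -
        have "quad_dist n S w (\<lambda>i. ?\<sigma> * z i) = (\<Sum>i<n. lam i * (lin_n n V w i - ?\<sigma> * lin_n n V z i)\<^sup>2)" for z
          unfolding d by (rule sum.cong[OF refl]) (simp only: lessThan_iff lin_n_scale)
        then show ?thesis by (simp add: indicator_def small_dist_def)
      qed
      finally show ?thesis .
    qed
    ultimately show ?thesis using m B by blast
  qed
  ultimately show ?thesis by blast
qed

section \<open>Net of matrices and random codebook\<close>

lemma quad_dist_nonneg:
  assumes "psd_mat n S" shows "0 \<le> quad_dist n S w c"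
  using assms by (auto simp: psd_mat_def quad_dist_def d_Sigma_def)

text \<open>The form at the sum and at the difference of two unit vectors gives
  \<open>2 * \<bar>S $$ (i, j)\<bar> \<le> S $$ (i, i) + S $$ (j, j)\<close>, and diagonal entries
  are nonnegative. The trace condition thus confines all matrices to a bounded cube, where a grid
  has finitely many cells.\<close>

lemma psd_mat_entry_le_trace:
  assumes psd: "psd_mat n S" and ij: "i < n" "j < n"
  shows "\<bar>S $$ (i, j)\<bar> \<le> mat_trace S"
proof -
  have S: "S \<in> carrier_mat n n" and sym: "transpose_mat S = S" using psd by (auto simp: psd_mat_def)
  have tr: "mat_trace S = (\<Sum>k<n. S $$ (k, k))" using S by (simp add: mat_trace_def)
  have quad: "0 \<le> (\<Sum>k<n. \<Sum>l<n. S $$ (k, l) * w k * w l)" for w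
    using quad_dist_nonneg[OF psd, of w "\<lambda>_. 0"] unfolding quad_dist_eq[OF S] by simp
  have diag: "0 \<le> S $$ (k, k)" if k: "k < n" for k
  proof -
    have "(\<Sum>p<n. \<Sum>l<n. S $$ (p, l) * of_bool (p = k) * of_bool (l = k)) = (\<Sum>p\<in>{k}. \<Sum>l\<in>{k}. S $$ (p, l) * of_bool (p = k) * of_bool (l = k))"
      using k by (intro sum.mono_neutral_cong_right) (auto intro!: sum.mono_neutral_right)
    then show ?thesis using quad[of "\<lambda>p. of_bool (p = k)"] by simp
  qed
  show ?thesis
  proof (cases "i = j")
    case True
    have "S $$ (i, i) \<le> mat_trace S" unfolding tr using ij diag by (intro member_le_sum) auto
    then show ?thesis using True diag[OF ij(1)] by simp
  next
    case False
    have "(\<Sum>k\<in>{i, j}. S $$ (k, k)) \<le> mat_trace S"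
      unfolding tr using ij diag by (intro sum_mono2) auto
    then have dd: "S $$ (i, i) + S $$ (j, j) \<le> mat_trace S" using False by simp
    have sij: "S $$ (j, i) = S $$ (i, j)"
      using arg_cong[OF sym, of "\<lambda>M. M $$ (i, j)"] ij S by simp
    have "0 \<le> S $$ (i, i) + 2 * s * S $$ (i, j) + s\<^sup>2 * S $$ (j, j)" for s :: real
    proof -
      define w where "w k = (if k = i then 1 else if k = j then s else 0)" for k
      have "(\<Sum>k<n. \<Sum>l<n. S $$ (k, l) * w k * w l) = (\<Sum>k\<in>{i, j}. \<Sum>l\<in>{i, j}. S $$ (k, l) * w k * w l)"
        using ij by (intro sum.mono_neutral_cong_right) (auto intro!: sum.mono_neutral_right sum.neutral simp: w_def)
      also have "\<dots> = S $$ (i, i) + 2 * s * S $$ (i, j) + s\<^sup>2 * S $$ (j, j)"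
        using False sij by (simp add: w_def power2_eq_square algebra_simps)
      finally show ?thesis using quad[of w] by simp
    qed
    from this[of 1] this[of "-1"] have "2 * \<bar>S $$ (i, j)\<bar> \<le> S $$ (i, i) + S $$ (j, j)" by simp
    then show ?thesis using dd by simp
  qed
qed

text \<open>By \<open>2 * \<bar>x i * x j\<bar> \<le> (x i)\<^sup>2 + (x j)\<^sup>2\<close>, an
  entrywise error \<tau> acts as a form of size \<open>real n * \<tau>\<close>. The net controls
  entries only, and this converts that control into distortion.\<close>

lemma quad_dist_perturb:
  assumes S: "S \<in> carrier_mat n n" "S' \<in> carrier_mat n n"
    and close: "\<And>i j. i < n \<Longrightarrow> j < n \<Longrightarrow> \<bar>S $$ (i, j) - S' $$ (i, j)\<bar> \<le> \<tau>"
  shows "quad_dist n S w c \<le> quad_dist n S' w c + real n * \<tau> * (\<Sum>i<n. (w i - c i)\<^sup>2)"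
proof -
  define x where "x i = w i - c i" for i
  have "quad_dist n S w c - quad_dist n S' w c = (\<Sum>i<n. \<Sum>j<n. (S $$ (i, j) - S' $$ (i, j)) * (x i * x j))"
    unfolding quad_dist_eq[OF S(1)] quad_dist_eq[OF S(2)] x_def sum_subtractf[symmetric]
    by (intro sum.cong refl) (simp add: algebra_simps)
  also have "\<dots> \<le> (\<Sum>i<n. \<Sum>j<n. \<tau> * (((x i)\<^sup>2 + (x j)\<^sup>2) / 2))"
  proof (intro sum_mono)
    fix i j assume ij: "i \<in> {..<n}" "j \<in> {..<n}"
    have t: "\<bar>S $$ (i, j) - S' $$ (i, j)\<bar> \<le> \<tau>" using close ij by auto
    have "\<bar>x i * x j\<bar> \<le> ((x i)\<^sup>2 + (x j)\<^sup>2) / 2"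
      using zero_le_power2[of "x i - x j"] zero_le_power2[of "x i + x j"]
      by (simp add: power2_eq_square algebra_simps abs_le_iff)
    then have "\<bar>S $$ (i, j) - S' $$ (i, j)\<bar> * \<bar>x i * x j\<bar> \<le> \<tau> * (((x i)\<^sup>2 + (x j)\<^sup>2) / 2)"
      using t by (intro mult_mono) auto
    then show "(S $$ (i, j) - S' $$ (i, j)) * (x i * x j) \<le> \<tau> * (((x i)\<^sup>2 + (x j)\<^sup>2) / 2)"
      using abs_ge_self[of "(S $$ (i, j) - S' $$ (i, j)) * (x i * x j)"] by (simp add: abs_mult)
  qed
  also have "\<dots> = real n * \<tau> * (\<Sum>i<n. (x i)\<^sup>2)"
    by (simp add: sum.distrib add_divide_distrib distrib_left sum_distrib_left[symmetric] sum_divide_distrib[symmetric])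
  finally show ?thesis by (simp add: x_def)
qed

lemma approx_minimizer:
  fixes D :: "'a \<Rightarrow> real"
  assumes "A \<noteq> {}" "\<And>x. x \<in> A \<Longrightarrow> 0 \<le> D x" "0 < \<gamma>"
  shows "\<exists>x\<in>A. \<forall>y\<in>A. D x \<le> D y + \<gamma>"
proof -
  have bdd: "bdd_below (D ` A)" using assms(2) by (auto intro!: bdd_belowI[of _ 0])
  obtain x where x: "x \<in> A" "D x < Inf (D ` A) + \<gamma>"
    using cInf_lessD[of "D ` A" "Inf (D ` A) + \<gamma>"] assms by auto
  have "D x \<le> D y + \<gamma>" if "y \<in> A" for y
    using cInf_lower[OF imageI[OF that] bdd] x(2) by simp
  then show ?thesis using x(1) by blast
qed

text \<open>Each cell of the net is represented by an almost minimiser of \<open>D\<close> on that cell, so that no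
  continuity of the spectrum is needed.\<close>

lemma psd_net:
  fixes D :: "real mat \<Rightarrow> real" and n :: nat and \<tau> \<gamma> :: real
  defines "P \<equiv> {S. psd_mat n S \<and> mat_trace S = real n}"
  assumes D: "\<And>S. S \<in> P \<Longrightarrow> 0 \<le> D S" and \<tau>: "0 < \<tau>" and \<gamma>: "0 < \<gamma>"
  shows "\<exists>N \<subseteq> P. finite N \<and> real (card N) \<le> (2 * (real n / \<tau>) + 4) ^ (n * n) \<and>
    (\<forall>S\<in>P. \<exists>S'\<in>N. (\<forall>i<n. \<forall>j<n. \<bar>S $$ (i, j) - S' $$ (i, j)\<bar> \<le> \<tau>) \<and> D S' \<le> D S + \<gamma>)"
proof -
  let ?I = "{..<n} \<times> {..<n}"
  \<comment> \<open>A cell collects the matrices whose entries share their integer parts in units of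
    \<tau>, so two members differ by at most \<tau> in each entry.\<close>
  define \<phi> where "\<phi> S = (\<lambda>(i, j)\<in>?I. \<lfloor>S $$ (i, j) / \<tau>\<rfloor>)" for S :: "real mat"
  define K where "K = \<lceil>real n / \<tau>\<rceil>"
  have K0: "0 \<le> K" unfolding K_def using \<tau> by (simp add: zero_le_ceiling) (smt (verit) divide_nonneg_pos of_nat_0_le_iff)
  have box: "\<phi> S \<in> ?I \<rightarrow>\<^sub>E {-K..K}" if S: "S \<in> P" for S
  proof -
    have "\<lfloor>S $$ (i, j) / \<tau>\<rfloor> \<in> {-K..K}" if ij: "i < n" "j < n" for i j
    proof -
      have "\<bar>S $$ (i, j)\<bar> \<le> real n" using psd_mat_entry_le_trace[of n S i j] S ij by (auto simp: P_def)
      then have "\<bar>S $$ (i, j) / \<tau>\<bar> \<le> real n / \<tau>" using \<tau> by (simp add: divide_right_mono)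
      then have "S $$ (i, j) / \<tau> \<le> real n / \<tau>" "- (real n / \<tau>) \<le> S $$ (i, j) / \<tau>" by linarith+
      then show ?thesis unfolding K_def atLeastAtMost_iff by linarith
    qed
    then show ?thesis by (auto simp: \<phi>_def)
  qed
  then have sub: "\<phi> ` P \<subseteq> ?I \<rightarrow>\<^sub>E {-K..K}" by auto
  have fin: "finite (?I \<rightarrow>\<^sub>E {-K..K})" by (intro finite_PiE) auto
  define rep where "rep l = (SOME S'. S' \<in> P \<and> \<phi> S' = l \<and> (\<forall>S\<in>P. \<phi> S = l \<longrightarrow> D S' \<le> D S + \<gamma>))" for l
  have rep: "rep l \<in> P \<and> \<phi> (rep l) = l \<and> (\<forall>S\<in>P. \<phi> S = l \<longrightarrow> D (rep l) \<le> D S + \<gamma>)" if "l \<in> \<phi> ` P" for l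
  proof -
    have "{S \<in> P. \<phi> S = l} \<noteq> {}" using that by auto
    from approx_minimizer[OF this, of D \<gamma>] D \<gamma>
    have "\<exists>S'. S' \<in> P \<and> \<phi> S' = l \<and> (\<forall>S\<in>P. \<phi> S = l \<longrightarrow> D S' \<le> D S + \<gamma>)" by auto
    then show ?thesis unfolding rep_def by (rule someI_ex)
  qed
  let ?N = "rep ` \<phi> ` P"
  have "?N \<subseteq> P" using rep by auto
  moreover have finN: "finite ?N" using finite_subset[OF sub fin] by blast
  moreover have "real (card ?N) \<le> (2 * (real n / \<tau>) + 4) ^ (n * n)"
  proof -
    have "card ?N \<le> card (?I \<rightarrow>\<^sub>E {-K..K})"
      using card_image_le[OF finite_subset[OF sub fin], of rep] card_mono[OF fin sub] by linarith
    also have "\<dots> = nat (2 * K + 1) ^ (n * n)" by (simp add: card_PiE)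
    finally have "real (card ?N) \<le> real (nat (2 * K + 1)) ^ (n * n)" by (metis of_nat_le_iff of_nat_power)
    also have "\<dots> \<le> (2 * (real n / \<tau>) + 4) ^ (n * n)"
    proof (rule power_mono)
      have "real (nat (2 * K + 1)) = 2 * of_int K + 1" using K0 by simp
      also have "\<dots> \<le> 2 * (real n / \<tau>) + 4" unfolding K_def by linarith
      finally show "real (nat (2 * K + 1)) \<le> 2 * (real n / \<tau>) + 4" .
    qed simp
    finally show ?thesis .
  qed
  moreover have "\<exists>S'\<in>?N. (\<forall>i<n. \<forall>j<n. \<bar>S $$ (i, j) - S' $$ (i, j)\<bar> \<le> \<tau>) \<and> D S' \<le> D S + \<gamma>" if S: "S \<in> P" for S
  proof (intro bexI[of _ "rep (\<phi> S)"] conjI allI impI)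
    have r: "rep (\<phi> S) \<in> P" "\<phi> (rep (\<phi> S)) = \<phi> S" "D (rep (\<phi> S)) \<le> D S + \<gamma>" using rep[of "\<phi> S"] S by auto
    show "D (rep (\<phi> S)) \<le> D S + \<gamma>" by (rule r)
    fix i j assume ij: "i < n" "j < n"
    have "\<lfloor>S $$ (i, j) / \<tau>\<rfloor> = \<lfloor>rep (\<phi> S) $$ (i, j) / \<tau>\<rfloor>"
      using fun_cong[OF r(2), of "(i, j)"] ij by (simp add: \<phi>_def)
    then have "\<bar>S $$ (i, j) / \<tau> - rep (\<phi> S) $$ (i, j) / \<tau>\<bar> \<le> 1" by linarith
    then show "\<bar>S $$ (i, j) - rep (\<phi> S) $$ (i, j)\<bar> \<le> \<tau>"
      using \<tau> by (simp add: diff_divide_distrib[symmetric] abs_divide)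
  qed (use S in auto)
  ultimately show ?thesis by blast
qed

text \<open>Conditioned on a source word outside \<open>Bad s\<close>, all \<open>M\<close> codewords miss with probability at
  most \<open>(1 - \<theta>) ^ M \<le> exp (- M * \<theta>)\<close>, which is small enough for a union bound over \<open>N\<close>.\<close>

lemma random_codebook:
  fixes G :: "'a measure" and W :: "'b measure" and N :: "'s set" and h :: "'a \<Rightarrow> ennreal"
    and \<theta> b c :: real and M :: nat
  assumes G: "prob_space G" and W: "prob_space W" and N: "finite N"
    and P: "\<And>s. s \<in> N \<Longrightarrow> Measurable.pred (W \<Otimes>\<^sub>M G) (\<lambda>(w, z). P s w z)"
    and Bad: "\<And>s. s \<in> N \<Longrightarrow> Bad s \<in> sets W"
    and \<theta>: "0 \<le> \<theta>" "\<theta> \<le> 1"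
    and hit: "\<And>s w. s \<in> N \<Longrightarrow> w \<in> space W - Bad s \<Longrightarrow> ennreal \<theta> \<le> (\<integral>\<^sup>+z. indicator {z. P s w z} z \<partial>G)"
    and h: "h \<in> borel_measurable G" "(\<integral>\<^sup>+z. h z \<partial>G) \<le> ennreal c" and c: "0 < c" and b: "0 < b" and M: "0 < M"
    and small: "real (card N) * b * exp (- (real M * \<theta>)) < 1 / 2"
  shows "\<exists>C \<in> {..<M} \<rightarrow> space G.
    (\<forall>s\<in>N. {w \<in> space W - Bad s. \<forall>k<M. \<not> P s w (C k)} \<in> sets W \<and>
       emeasure W {w \<in> space W - Bad s. \<forall>k<M. \<not> P s w (C k)} \<le> ennreal (1 / b)) \<and>
    (\<Sum>k<M. h (C k)) \<le> ennreal (2 * real M * c)"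
proof -
  interpret G: prob_space G by (rule G)
  interpret W: prob_space W by (rule W)
  interpret PP: product_prob_space "\<lambda>_::nat. G" by (intro product_prob_spaceI G)
  let ?\<Omega> = "PiM {..<M} (\<lambda>_::nat. G)"
  interpret O: prob_space ?\<Omega> by (intro prob_space_PiM G)
  interpret WO: pair_sigma_finite W ?\<Omega> ..
  \<comment> \<open>The indicator that \<open>w\<close> lies outside \<open>Bad s\<close> and is
    missed by every codeword, written as a product so that the integral over independent codewords
    factorises.\<close>
  define F where "F s C w = indicator (space W - Bad s) w * (\<Prod>k<M. indicator {z. \<not> P s w z} (C k) :: ennreal)" for s C w
  have comp: "(\<lambda>p. (fst p, snd p k)) \<in> measurable (W \<Otimes>\<^sub>M ?\<Omega>) (W \<Otimes>\<^sub>M G)" if "k < M" for k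
    using that by (intro measurable_Pair measurable_compose[OF measurable_snd measurable_component_singleton]) auto
  have F[measurable]: "(\<lambda>(w, C). F s C w) \<in> borel_measurable (W \<Otimes>\<^sub>M ?\<Omega>)" if s: "s \<in> N" for s
  proof -
    have 1: "(\<lambda>p. indicator {z. \<not> P s (fst p) z} (snd p k) :: ennreal) \<in> borel_measurable (W \<Otimes>\<^sub>M ?\<Omega>)" if k: "k < M" for k
    proof -
      have "(\<lambda>q. indicator {z. \<not> P s (fst q) z} (snd q) :: ennreal) \<in> borel_measurable (W \<Otimes>\<^sub>M G)"
      proof -
        have "Measurable.pred (W \<Otimes>\<^sub>M G) (\<lambda>q. P s (fst q) (snd q))" using P[OF s] by (simp add: case_prod_beta')
        then have "(\<lambda>q. if P s (fst q) (snd q) then 0 else 1 :: ennreal) \<in> borel_measurable (W \<Otimes>\<^sub>M G)" by measurable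
        moreover have "(\<lambda>q. indicator {z. \<not> P s (fst q) z} (snd q) :: ennreal) = (\<lambda>q. if P s (fst q) (snd q) then 0 else 1)"
          by (auto simp: indicator_def)
        ultimately show ?thesis by simp
      qed
      from measurable_compose[OF comp[OF k] this] show ?thesis by simp
    qed
    have 2: "(\<lambda>p. indicator (space W - Bad s) (fst p) :: ennreal) \<in> borel_measurable (W \<Otimes>\<^sub>M ?\<Omega>)"
      using Bad[OF s] by measurable
    show ?thesis unfolding F_def case_prod_beta'
      by (intro borel_measurable_times_ennreal 2 borel_measurable_prod_ennreal 1) simp
  qed
  have miss: "(\<integral>\<^sup>+C. (\<integral>\<^sup>+w. F s C w \<partial>W) \<partial>?\<Omega>) \<le> ennreal (exp (- (real M * \<theta>)))" if s: "s \<in> N" for s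
  proof -
    have "(\<integral>\<^sup>+C. (\<integral>\<^sup>+w. F s C w \<partial>W) \<partial>?\<Omega>) = (\<integral>\<^sup>+w. (\<integral>\<^sup>+C. F s C w \<partial>?\<Omega>) \<partial>W)"
      using WO.Fubini'[OF F[OF s]] by simp
    also have "\<dots> \<le> (\<integral>\<^sup>+w. ennreal (exp (- (real M * \<theta>))) \<partial>W)"
    proof (rule nn_integral_mono)
      fix w assume w: "w \<in> space W"
      show "(\<integral>\<^sup>+C. F s C w \<partial>?\<Omega>) \<le> ennreal (exp (- (real M * \<theta>)))"
      proof (cases "w \<in> Bad s")
        case True
        then show ?thesis by (simp add: F_def)
      next
        case False
        have Pw: "Measurable.pred G (P s w)"
          using measurable_compose[OF measurable_Pair1'[OF w] P[OF s]] by simp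
        then have m[measurable]: "{z \<in> space G. P s w z} \<in> sets G" by simp
        have i1: "(\<integral>\<^sup>+z. indicator {z. P s w z} z \<partial>G) = emeasure G {z \<in> space G. P s w z}"
        proof -
          have "(\<integral>\<^sup>+z. indicator {z. P s w z} z \<partial>G) = (\<integral>\<^sup>+z. indicator {z \<in> space G. P s w z} z \<partial>G)"
            by (intro nn_integral_cong) (auto simp: indicator_def)
          then show ?thesis by simp
        qed
        have i2: "(\<integral>\<^sup>+z. indicator {z. \<not> P s w z} z \<partial>G) = emeasure G (space G - {z \<in> space G. P s w z})"
        proof -
          have "(\<integral>\<^sup>+z. indicator {z. \<not> P s w z} z \<partial>G) = (\<integral>\<^sup>+z. indicator (space G - {z \<in> space G. P s w z}) z \<partial>G)"
            by (intro nn_integral_cong) (auto simp: indicator_def)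
          then show ?thesis by simp
        qed
        have "ennreal \<theta> \<le> ennreal (G.prob {z \<in> space G. P s w z})"
          using hit[OF s, of w] w False by (simp add: i1 G.emeasure_eq_measure)
        then have "\<theta> \<le> G.prob {z \<in> space G. P s w z}" by (subst (asm) ennreal_le_iff) auto
        then have "G.prob (space G - {z \<in> space G. P s w z}) \<le> 1 - \<theta>" by (subst G.prob_compl) auto
        also have "\<dots> \<le> exp (- \<theta>)" using exp_ge_add_one_self[of "- \<theta>"] by simp
        finally have le: "(\<integral>\<^sup>+z. indicator {z. \<not> P s w z} z \<partial>G) \<le> ennreal (exp (- \<theta>))"
          unfolding i2 G.emeasure_eq_measure by (rule ennreal_leI)
        have "(\<integral>\<^sup>+C. F s C w \<partial>?\<Omega>) \<le> (\<integral>\<^sup>+C. (\<Prod>k<M. indicator {z. \<not> P s w z} (C k)) \<partial>?\<Omega>)"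
          by (intro nn_integral_mono) (auto simp: F_def indicator_def)
        also have "\<dots> = (\<Prod>k<M. \<integral>\<^sup>+z. indicator {z. \<not> P s w z} z \<partial>G)"
        proof (rule PP.product_nn_integral_prod)
          show "indicator {z. \<not> P s w z} \<in> borel_measurable G"
            using Pw by (intro borel_measurable_indicator') auto
        qed simp
        also have "\<dots> \<le> (\<Prod>k<M. ennreal (exp (- \<theta>)))" by (intro prod_mono_ennreal le)
        also have "\<dots> = ennreal (exp (- (real M * \<theta>)))"
          by (simp add: ennreal_power exp_of_nat_mult[symmetric])
        finally show ?thesis .
      qed
    qed
    also have "\<dots> = ennreal (exp (- (real M * \<theta>)))" by (simp add: W.emeasure_space_1)
    finally show ?thesis .
  qed
  have hk: "(\<lambda>C. h (C k)) \<in> borel_measurable ?\<Omega>" "(\<integral>\<^sup>+C. h (C k) \<partial>?\<Omega>) = (\<integral>\<^sup>+z. h z \<partial>G)" if k: "k < M" for k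
  proof -
    have m: "(\<lambda>C. C k) \<in> measurable ?\<Omega> G" using k by simp
    show "(\<lambda>C. h (C k)) \<in> borel_measurable ?\<Omega>" using measurable_compose[OF m h(1)] .
    have "distr ?\<Omega> G (\<lambda>C. C k) = G" using k G by (intro distr_PiM_component) auto
    then show "(\<integral>\<^sup>+C. h (C k) \<partial>?\<Omega>) = (\<integral>\<^sup>+z. h z \<partial>G)" using nn_integral_distr[OF m, of h] h(1) by simp
  qed
  let ?e = "ennreal (1 / (2 * real M * c))"
  \<comment> \<open>One functional for all requirements. Its mean is below 1/2 + 1/2, so some
    codebook has \<open>\<Phi> C < 1\<close>; all terms being nonnegative, each requirement then
    holds on its own, and the weights turn into \<open>1 / b\<close> for the misses and
    \<open>2 * real M * c\<close> for the energy.\<close>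
  define \<Phi> where "\<Phi> C = (\<Sum>s\<in>N. ennreal b * (\<integral>\<^sup>+w. F s C w \<partial>W)) + ?e * (\<Sum>k<M. h (C k))" for C
  have Fm: "(\<lambda>C. \<integral>\<^sup>+w. F s C w \<partial>W) \<in> borel_measurable ?\<Omega>" if s: "s \<in> N" for s
    using measurable_compose[OF measurable_pair_swap' F[OF s]]
    by (intro W.borel_measurable_nn_integral) (simp add: case_prod_beta')
  have "(\<integral>\<^sup>+C. \<Phi> C \<partial>?\<Omega>) = (\<Sum>s\<in>N. ennreal b * (\<integral>\<^sup>+C. (\<integral>\<^sup>+w. F s C w \<partial>W) \<partial>?\<Omega>)) + ?e * (\<Sum>k<M. \<integral>\<^sup>+C. h (C k) \<partial>?\<Omega>)"
  proof -
    have mh: "(\<lambda>C. \<Sum>k<M. h (C k)) \<in> borel_measurable ?\<Omega>" using hk(1) by (intro borel_measurable_sum) auto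
    have mF: "(\<lambda>C. \<Sum>s\<in>N. ennreal b * (\<integral>\<^sup>+w. F s C w \<partial>W)) \<in> borel_measurable ?\<Omega>"
      using Fm by (intro borel_measurable_sum borel_measurable_times_ennreal) auto
    have sh: "(\<integral>\<^sup>+C. (\<Sum>k<M. h (C k)) \<partial>?\<Omega>) = (\<Sum>k<M. \<integral>\<^sup>+C. h (C k) \<partial>?\<Omega>)"
      using hk(1) by (intro nn_integral_sum) auto
    have "(\<integral>\<^sup>+C. (\<Sum>s\<in>N. ennreal b * (\<integral>\<^sup>+w. F s C w \<partial>W)) \<partial>?\<Omega>) = (\<Sum>s\<in>N. \<integral>\<^sup>+C. ennreal b * (\<integral>\<^sup>+w. F s C w \<partial>W) \<partial>?\<Omega>)"
      using Fm by (intro nn_integral_sum borel_measurable_times_ennreal) auto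
    also have "\<dots> = (\<Sum>s\<in>N. ennreal b * (\<integral>\<^sup>+C. (\<integral>\<^sup>+w. F s C w \<partial>W) \<partial>?\<Omega>))"
      using Fm by (intro sum.cong nn_integral_cmult) auto
    finally have sF: "(\<integral>\<^sup>+C. (\<Sum>s\<in>N. ennreal b * (\<integral>\<^sup>+w. F s C w \<partial>W)) \<partial>?\<Omega>) = \<dots>" .
    have "(\<integral>\<^sup>+C. \<Phi> C \<partial>?\<Omega>) = (\<integral>\<^sup>+C. (\<Sum>s\<in>N. ennreal b * (\<integral>\<^sup>+w. F s C w \<partial>W)) \<partial>?\<Omega>) + (\<integral>\<^sup>+C. ?e * (\<Sum>k<M. h (C k)) \<partial>?\<Omega>)"
      unfolding \<Phi>_def using mF mh by (intro nn_integral_add borel_measurable_times_ennreal) auto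
    also have "(\<integral>\<^sup>+C. ?e * (\<Sum>k<M. h (C k)) \<partial>?\<Omega>) = ?e * (\<Sum>k<M. \<integral>\<^sup>+C. h (C k) \<partial>?\<Omega>)"
      unfolding sh[symmetric] using mh by (rule nn_integral_cmult)
    finally show ?thesis unfolding sF .
  qed
  also have "\<dots> \<le> (\<Sum>s\<in>N. ennreal b * ennreal (exp (- (real M * \<theta>)))) + ?e * (\<Sum>k<M. ennreal c)"
    using miss hk h by (intro add_mono sum_mono mult_left_mono) auto
  also have "\<dots> = ennreal (real (card N) * b * exp (- (real M * \<theta>)) + 1 / 2)"
  proof -
    have "(\<Sum>s\<in>N. ennreal b * ennreal (exp (- (real M * \<theta>)))) = ennreal (real (card N) * b * exp (- (real M * \<theta>)))"
      using b by (simp add: ennreal_mult ennreal_of_nat_eq_real_of_nat mult.assoc)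
    moreover have "?e * (\<Sum>k<M. ennreal c) = ennreal (1 / 2)"
      using c M by (simp add: ennreal_of_nat_eq_real_of_nat ennreal_mult[symmetric])
    ultimately show ?thesis using b by (simp add: ennreal_plus)
  qed
  also have "\<dots> < 1" using small by (simp add: ennreal_less_one_iff)
  finally have lt: "(\<integral>\<^sup>+C. \<Phi> C \<partial>?\<Omega>) < 1" .
  have "\<exists>C\<in>space ?\<Omega>. \<Phi> C < 1"
  proof (rule ccontr)
    assume "\<not> ?thesis"
    then have "1 \<le> \<Phi> C" if "C \<in> space ?\<Omega>" for C using that by (auto simp: not_less)
    then have "(\<integral>\<^sup>+C. 1 \<partial>?\<Omega>) \<le> (\<integral>\<^sup>+C. \<Phi> C \<partial>?\<Omega>)" by (intro nn_integral_mono) auto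
    then show False using lt by (simp add: O.emeasure_space_1)
  qed
  then obtain C where C: "C \<in> space ?\<Omega>" and \<Phi>: "\<Phi> C < 1" by blast
  have CG: "C \<in> {..<M} \<rightarrow> space G" using C by (auto simp: space_PiM)
  have "{w \<in> space W - Bad s. \<forall>k<M. \<not> P s w (C k)} \<in> sets W \<and>
    emeasure W {w \<in> space W - Bad s. \<forall>k<M. \<not> P s w (C k)} \<le> ennreal (1 / b)" (is "?A \<in> _ \<and> _") if s: "s \<in> N" for s
  proof
    have [measurable]: "Measurable.pred W (\<lambda>w. P s w (C k))" if "k < M" for k
      using measurable_compose[OF measurable_Pair2'[of "C k" G W] P[OF s]] CG that by auto
    have "?A = (space W - Bad s) \<inter> (\<Inter>k<M. {w \<in> space W. \<not> P s w (C k)})" using M by auto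
    also have "\<dots> \<in> sets W" using Bad[OF s] M by (intro sets.Int sets.Diff sets.finite_INT) auto
    finally show A: "?A \<in> sets W" .
    have "F s C w = indicator ?A w" for w
    proof (cases "w \<in> ?A")
      case True then show ?thesis by (simp add: F_def indicator_def)
    next
      case False
      then show ?thesis unfolding F_def by (auto simp: indicator_def)
    qed
    then have "(\<integral>\<^sup>+w. F s C w \<partial>W) = emeasure W ?A" using A by simp
    moreover have "ennreal b * (\<integral>\<^sup>+w. F s C w \<partial>W) \<le> \<Phi> C"
    proof -
      have "ennreal b * (\<integral>\<^sup>+w. F s C w \<partial>W) \<le> (\<Sum>s\<in>N. ennreal b * (\<integral>\<^sup>+w. F s C w \<partial>W))"
        using N s by (intro member_le_sum) auto
      then show ?thesis unfolding \<Phi>_def by (simp add: add_increasing2)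
    qed
    ultimately have le: "ennreal b * emeasure W ?A \<le> 1" using \<Phi> by simp
    then have "ennreal (b * W.prob ?A) \<le> ennreal 1" using b by (simp add: W.emeasure_eq_measure ennreal_mult)
    then have "b * W.prob ?A \<le> 1" by (subst (asm) ennreal_le_iff) auto
    then have "W.prob ?A \<le> 1 / b" using b by (simp add: field_simps)
    then show "emeasure W ?A \<le> ennreal (1 / b)" unfolding W.emeasure_eq_measure by (rule ennreal_leI)
  qed
  moreover have "(\<Sum>k<M. h (C k)) \<le> ennreal (2 * real M * c)"
  proof -
    have p: "0 < 2 * real M * c" using M c by simp
    have "?e * (\<Sum>k<M. h (C k)) \<le> 1" using \<Phi> unfolding \<Phi>_def by (meson add_increasing le_less_trans less_imp_le order_refl zero_le)
    then have "ennreal (2 * real M * c) * (?e * (\<Sum>k<M. h (C k))) \<le> ennreal (2 * real M * c) * 1"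
      by (intro mult_left_mono) auto
    moreover have "ennreal (2 * real M * c) * ?e = 1"
      using p M c by (simp add: ennreal_mult[symmetric])
    ultimately show ?thesis by (simp add: mult.assoc[symmetric])
  qed
  ultimately show ?thesis using CG by blast
qed

section \<open>Universal codebook\<close>

text \<open>In order: the codebook is nonempty; K scaled copies and the zero codeword fit into rate
  \<open>R + \<epsilon>\<close>; untypical source words cost less than the slack; the union bound
  over the net closes. For the last, \<open>\<alpha> \<le> \<epsilon> * ln 2 / 8\<close> lets the
  expected number of hits grow at least like a multiple of
  \<open>2 powr (real n * (\<epsilon> / 4))\<close>, against a logarithm of the net size of order
  n^3.\<close>

lemma parameter_growth:
  fixes R \<epsilon> \<alpha> K C :: real
  assumes "0 < R" "0 < \<epsilon>" "0 < \<alpha>" "\<alpha> \<le> \<epsilon> * ln 2 / 8" "0 < K" "0 < C"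
  shows "eventually (\<lambda>n. 
    1 \<le> 2 powr (real n * (R + \<epsilon> / 2)) \<and>
    K * 2 powr (real n * (R + \<epsilon> / 2)) + 2 \<le> 2 powr (real n * (R + \<epsilon>)) \<and>
    (C + 1) / (4 * \<alpha>\<^sup>2) \<le> real n \<and>
    (20 * (real n)\<^sup>2 * 2 powr (real n * (R + \<epsilon> / 2)) / \<alpha> + 4) ^ (n * n) * real n *
       exp (- ((2 powr (real n * (R + \<epsilon> / 2)) - 1) * (exp (- (real n * (R * ln 2 + \<alpha>))) / 2))) < 1 / 2) sequentially"
proof -
  have 1: "eventually (\<lambda>n. 1 \<le> 2 powr (real n * (R + \<epsilon> / 2))) sequentially"
    using assms by real_asymp
  have 2: "eventually (\<lambda>n. K * 2 powr (real n * (R + \<epsilon> / 2)) + 2 \<le> 2 powr (real n * (R + \<epsilon>))) sequentially"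
    using assms by real_asymp
  have 3: "eventually (\<lambda>n. (C + 1) / (4 * \<alpha>\<^sup>2) \<le> real n) sequentially" 
    using assms by real_asymp
  have 4: "eventually (\<lambda>n. (real n)\<^sup>2 * ln (20 * (real n)\<^sup>2 * 2 powr (real n * (R + \<epsilon> / 2)) / \<alpha> + 4) + ln (real n)
      - 2 powr (real n * (\<epsilon> / 4)) / 4 < ln (1 / 2)) sequentially"
  proof -
    have "eventually (\<lambda>n. (real n)\<^sup>2 * ln (20 * (real n)\<^sup>2 * 2 powr (real n * r) / \<alpha> + 4) + ln (real n)
      - 2 powr (real n * d) / 4 < ln (1 / 2)) sequentially" if "0 < r" "0 < d" for r d :: real
      using that assms(3) by real_asymp
    from this[of "R + \<epsilon> / 2" "\<epsilon> / 4"] show ?thesis using assms by simp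
  qed
  have 5: "eventually (\<lambda>n. 2 \<le> 2 powr (real n * (R + \<epsilon> / 2))) sequentially" 
    using assms by real_asymp
  have 6: "eventually (\<lambda>n. 0 < real n) sequentially" by real_asymp
  show ?thesis using 1 2 3 4 5 6
  proof eventually_elim
    case (elim n)
    define X where "X = 2 powr (real n * (R + \<epsilon> / 2))"
    define Y where "Y = 20 * (real n)\<^sup>2 * X / \<alpha> + 4"
    have X2: "2 \<le> X" using elim by (simp add: X_def)
    have Y: "0 < Y" using X2 assms by (auto simp: Y_def intro!: add_nonneg_pos)
    have "2 powr (real n * (\<epsilon> / 4)) = exp (real n * (\<epsilon> / 4) * ln 2)" by (simp add: powr_def)
    also have "\<dots> \<le> exp (real n * (R + \<epsilon> / 2) * ln 2 - real n * (R * ln 2 + \<alpha>))"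
    proof -
      define l where "l = ln (2 :: real)"
      have "0 \<le> \<epsilon> * l" using assms by (simp add: l_def)
      then have "\<alpha> \<le> \<epsilon> * l / 4" using assms(4) unfolding l_def[symmetric] by linarith
      then have "real n * \<alpha> \<le> real n * (\<epsilon> * l / 4)" by (rule mult_left_mono) simp
      moreover have "real n * (R + \<epsilon> / 2) * l - real n * (R * l + \<alpha>) = 2 * (real n * (\<epsilon> * l / 4)) - real n * \<alpha>"
        by (simp add: algebra_simps)
      moreover have "real n * (\<epsilon> / 4) * l = real n * (\<epsilon> * l / 4)" by simp
      ultimately show ?thesis unfolding l_def[symmetric] exp_le_cancel_iff by linarith
    qed
    also have "\<dots> = X * exp (- (real n * (R * ln 2 + \<alpha>)))"
      by (simp add: X_def powr_def flip: exp_add)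
    finally have "2 powr (real n * (\<epsilon> / 4)) / 4 \<le> X / 2 * (exp (- (real n * (R * ln 2 + \<alpha>))) / 2)" by simp
    also have "\<dots> \<le> (X - 1) * (exp (- (real n * (R * ln 2 + \<alpha>))) / 2)"
      using X2 by (intro mult_right_mono) auto
    finally have E: "2 powr (real n * (\<epsilon> / 4)) / 4 \<le> (X - 1) * (exp (- (real n * (R * ln 2 + \<alpha>))) / 2)" (is "_ \<le> ?E") .
    have "Y ^ (n * n) * real n * exp (- ?E) = exp ((real n)\<^sup>2 * ln Y + ln (real n) - ?E)"
    proof -
      have "Y ^ (n * n) = exp (real (n * n) * ln Y)" using Y by (subst exp_of_nat_mult) simp
      moreover have "exp (t + ln m - e) = exp t * m * exp (- e)" if "0 < m" for t m e :: real
        using that by (simp add: exp_diff exp_minus exp_add divide_inverse)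
      ultimately show ?thesis using elim(6) by (simp only: power2_eq_square of_nat_mult)
    qed
    also have "\<dots> < exp (ln (1 / 2))" using elim(4) E unfolding X_def[symmetric] Y_def[symmetric]
      by (subst exp_less_cancel_iff) linarith
    finally have "Y ^ (n * n) * real n * exp (- ?E) < 1 / 2" by simp
    then show ?case using elim unfolding X_def[symmetric] Y_def[symmetric] by simp
  qed
qed

text \<open>Completing the square. Used on an event, it splits the distortion of the zero codeword
  into its second moment and the probability of the event, with \<beta> free to balance the
  two.\<close>

lemma linear_le_quadratic:
  fixes x \<beta> :: real assumes "0 < \<beta>"
  shows "x \<le> \<beta> * x\<^sup>2 + 1 / (4 * \<beta>)"
proof -
  have "0 \<le> (2 * \<beta> * x - 1)\<^sup>2 / (4 * \<beta>)" using assms by simp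
  also have "\<dots> = \<beta> * x\<^sup>2 + 1 / (4 * \<beta>) - x" using assms by (simp add: power2_eq_square field_simps)
  finally show ?thesis by simp
qed

lemma ennreal_affine_combination:
  fixes d a b c x y t :: real
  assumes "0 \<le> d" "0 \<le> a" "0 \<le> b" "0 \<le> c" "0 \<le> x" "0 \<le> y" "0 \<le> t"
  shows "ennreal (d + a * x + b * y + c * t) =
    ennreal d + ennreal a * ennreal x + ennreal b * ennreal y + ennreal c * ennreal t"
  using assms by (simp add: ennreal_plus ennreal_mult)

lemma gauss_n_norm2: "(\<integral>\<^sup>+w. ennreal (\<Sum>i<n. (w i)\<^sup>2) \<partial>gauss_n n) = ennreal (real n)"
proof -
  have 1: "integrable (gauss_n n) (\<lambda>w. (w i)\<^sup>2)" "(\<integral>w. (w i)\<^sup>2 \<partial>gauss_n n) = 1" if "i < n" for i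
    using gauss_n_component[OF that std_normal_moments(3)] std_normal_moments(4) by simp_all
  have i: "integrable (gauss_n n) (\<lambda>w. \<Sum>i<n. (w i)\<^sup>2)" using 1 by (intro Bochner_Integration.integrable_sum) auto
  have "(\<integral>w. (\<Sum>i<n. (w i)\<^sup>2) \<partial>gauss_n n) = real n" using 1 by (simp add: Bochner_Integration.integral_sum)
  then show ?thesis using i by (subst nn_integral_eq_integral) (auto intro!: AE_I2 sum_nonneg)
qed

text \<open>The bound is stated for any function \<open>u\<close> below all codeword distortions
  instead of for an encoder, so that no measurable selection enters here; the minimum over the
  codebook is one such \<open>u\<close>.\<close>

lemma universal_codebook:
  fixes R \<epsilon> \<eta> :: real
  assumes R: "0 < R" and \<epsilon>: "0 < \<epsilon>" and \<eta>: "0 < \<eta>"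
  shows "\<exists>n0::nat. \<forall>n\<ge>n0. 0 < n \<and> (\<exists>(Q::nat) (cw :: nat \<Rightarrow> nat \<Rightarrow> real).
    0 < Q \<and> Q \<le> nat \<lfloor>2 powr (real n * (R + \<epsilon>))\<rfloor> \<and>
    (\<forall>S. psd_mat n S \<and> mat_trace S = real n \<longrightarrow>
      (\<forall>u. (\<forall>w\<in>space (leb_n n). \<forall>j\<in>{1..Q}. u w \<le> quad_dist n S w (cw j)) \<longrightarrow>
        (\<integral>\<^sup>+w. ennreal (u w) \<partial>gauss_n n) \<le> ennreal (real n * (D_rc (spec S) R + \<eta>)))))"
proof -
  \<comment> \<open>The losses collected at the end amount to \<open>9 * \<alpha>\<close>, which
    \<open>\<eta> / 16\<close> covers; the other two bounds serve the variance grid and the union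
    bound.\<close>
  define \<alpha> where "\<alpha> = min 1 (min (\<eta> / 16) (\<epsilon> * ln 2 / 8))"
  have \<alpha>: "0 < \<alpha>" "\<alpha> \<le> 1" "\<alpha> \<le> \<eta> / 16" "\<alpha> \<le> \<epsilon> * ln 2 / 8" using \<epsilon> \<eta> by (auto simp: \<alpha>_def)
  define K where "K = nat \<lceil>1 / \<alpha>\<rceil>"
  have K: "0 < K" using \<alpha> by (simp add: K_def)
  obtain C where C: "0 < C" and cp: "\<forall>n>0. \<forall>S. psd_mat n S \<and> mat_trace S = real n \<longrightarrow>
    (\<exists>m\<in>{1..K}. \<exists>Bad \<in> sets (leb_n n). emeasure (gauss_n n) Bad \<le> ennreal (C / real n) \<and>
      (\<forall>w \<in> space (leb_n n) - Bad. ennreal (exp (- (real n * (R * ln 2 + \<alpha>))) / 2) \<le>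
        (\<integral>\<^sup>+z. indicator {z. quad_dist n S w (\<lambda>i. sqrt (real m * \<alpha>) * z i) \<le> real n * (D_rc (spec S) R + \<alpha> + \<alpha> + \<alpha>)} z \<partial>gauss_n n)))"
    using codeword_probability[OF R \<alpha>(1,2) \<alpha>(1) \<alpha>(1)] unfolding K_def by blast
  obtain n0 where n0: "\<And>n. n0 \<le> n \<Longrightarrow>
    1 \<le> 2 powr (real n * (R + \<epsilon> / 2)) \<and>
    real K * 2 powr (real n * (R + \<epsilon> / 2)) + 2 \<le> 2 powr (real n * (R + \<epsilon>)) \<and>
    (C + 1) / (4 * \<alpha>\<^sup>2) \<le> real n \<and>
    (20 * (real n)\<^sup>2 * 2 powr (real n * (R + \<epsilon> / 2)) / \<alpha> + 4) ^ (n * n) * real n *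
       exp (- ((2 powr (real n * (R + \<epsilon> / 2)) - 1) * (exp (- (real n * (R * ln 2 + \<alpha>))) / 2))) < 1 / 2"
    using parameter_growth[OF R \<epsilon> \<alpha>(1) \<alpha>(4), of "real K" C] K C unfolding eventually_sequentially by auto
  show ?thesis
  proof (rule exI[of _ "max 1 n0"], intro allI impI conjI)
    fix n assume "max 1 n0 \<le> n"
    then have n: "0 < n" and n': "n0 \<le> n" by auto
    show "0 < n" by (rule n)
    \<comment> \<open>Half of \<epsilon> makes the codebook large enough to hit; the other half
      absorbs the K variance levels and the zero codeword.\<close>
    define X where "X = 2 powr (real n * (R + \<epsilon> / 2))"
    have X1: "1 \<le> X" and XQ: "real K * X + 2 \<le> 2 powr (real n * (R + \<epsilon>))" and nC: "(C + 1) / (4 * \<alpha>\<^sup>2) \<le> real n"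
      and Xsmall: "(20 * (real n)\<^sup>2 * X / \<alpha> + 4) ^ (n * n) * real n *
       exp (- ((X - 1) * (exp (- (real n * (R * ln 2 + \<alpha>))) / 2))) < 1 / 2"
      using n0[OF n'] unfolding X_def[symmetric] by auto
    define M where "M = nat \<lfloor>X\<rfloor>"
    have M: "0 < M" "real M \<le> X" "X - 1 \<le> real M" using X1 by (auto simp: M_def)
    define \<theta> where "\<theta> = exp (- (real n * (R * ln 2 + \<alpha>))) / 2"
    have \<theta>: "0 \<le> \<theta>" "\<theta> \<le> 1"
    proof -
      have "exp (- (real n * (R * ln 2 + \<alpha>))) \<le> 1" using R \<alpha> by (auto intro!: mult_nonneg_nonneg add_nonneg_nonneg)
      then show "0 \<le> \<theta>" "\<theta> \<le> 1" unfolding \<theta>_def using exp_ge_zero[of "- (real n * (R * ln 2 + \<alpha>))"] by linarith+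
    qed
    define P where "P = {S. psd_mat n S \<and> mat_trace S = real n}"
    define D where "D S = D_rc (spec S) R" for S
    have D0: "0 \<le> D S" if "S \<in> P" for S
    proof -
      have psd: "psd_mat n S" and tr: "mat_trace S = real n" using that by (auto simp: P_def)
      obtain V lam where "orth_n n V" and lam: "\<forall>i<n. 0 \<le> lam i"
        and sp: "spec S = image_mset lam (mset_set {..<n})" and tr': "mat_trace S = (\<Sum>i<n. lam i)"
        and "\<forall>w c. quad_dist n S w c = (\<Sum>i<n. lam i * (lin_n n V w i - lin_n n V c i)\<^sup>2)"
        using psd_mat_quad_dist_spectral[OF psd] by blast
      show ?thesis unfolding D_def sp using bounded_T_rc(1)[OF n lam[rule_format] _ R \<eta>] tr tr' by simp
    qed
    \<comment> \<open>The perturbation loss is \<open>real n * \<tau>\<close> times twice the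
      squared norm of \<open>w\<close> plus \<open>8 * real M * real n\<close>. Its mean is at most
      \<open>10 * \<tau> * real M * (real n)\<^sup>2\<close>, which this choice makes equal to
      \<open>real n * \<alpha>\<close>.\<close>
    define \<tau> where "\<tau> = \<alpha> / (10 * real n * real M)"
    have \<tau>: "0 < \<tau>" using \<alpha> n M by (simp add: \<tau>_def)
    obtain N where N: "N \<subseteq> P" "finite N" and cN: "real (card N) \<le> (2 * (real n / \<tau>) + 4) ^ (n * n)"
      and net: "\<And>S. S \<in> P \<Longrightarrow> \<exists>S'\<in>N. (\<forall>i<n. \<forall>j<n. \<bar>S $$ (i, j) - S' $$ (i, j)\<bar> \<le> \<tau>) \<and> D S' \<le> D S + \<alpha>"
      using psd_net[of n D \<tau> \<alpha>, folded P_def] D0 \<tau> \<alpha>(1) by blast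
    have "\<forall>S\<in>N. \<exists>m Bad. m \<in> {1..K} \<and> Bad \<in> sets (leb_n n) \<and> emeasure (gauss_n n) Bad \<le> ennreal (C / real n) \<and>
      (\<forall>w \<in> space (leb_n n) - Bad. ennreal \<theta> \<le>
        (\<integral>\<^sup>+z. indicator {z. quad_dist n S w (\<lambda>i. sqrt (real m * \<alpha>) * z i) \<le> real n * (D S + 3 * \<alpha>)} z \<partial>gauss_n n))"
    proof
      fix S assume "S \<in> N"
      then have "psd_mat n S \<and> mat_trace S = real n" using N by (auto simp: P_def)
      moreover have e: "D_rc (spec S) R + \<alpha> + \<alpha> + \<alpha> = D S + 3 * \<alpha>" by (simp add: D_def)
      ultimately show "\<exists>m Bad. m \<in> {1..K} \<and> Bad \<in> sets (leb_n n) \<and> emeasure (gauss_n n) Bad \<le> ennreal (C / real n) \<and>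
      (\<forall>w \<in> space (leb_n n) - Bad. ennreal \<theta> \<le>
        (\<integral>\<^sup>+z. indicator {z. quad_dist n S w (\<lambda>i. sqrt (real m * \<alpha>) * z i) \<le> real n * (D S + 3 * \<alpha>)} z \<partial>gauss_n n))"
        using cp[rule_format, OF n, of S] unfolding \<theta>_def[symmetric] e by blast
    qed
    then obtain lev Bad where lev: "\<And>S. S \<in> N \<Longrightarrow> lev S \<in> {1..K}"
      and Bad: "\<And>S. S \<in> N \<Longrightarrow> Bad S \<in> sets (leb_n n)"
      and eBad: "\<And>S. S \<in> N \<Longrightarrow> emeasure (gauss_n n) (Bad S) \<le> ennreal (C / real n)"
      and hit: "\<And>S w. S \<in> N \<Longrightarrow> w \<in> space (leb_n n) - Bad S \<Longrightarrow> ennreal \<theta> \<le>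
        (\<integral>\<^sup>+z. indicator {z. quad_dist n S w (\<lambda>i. sqrt (real (lev S) * \<alpha>) * z i) \<le> real n * (D S + 3 * \<alpha>)} z \<partial>gauss_n n)"
      unfolding bchoice_iff by blast
    have sp: "space (gauss_n n) = space (leb_n n)" by (rule sets_eq_imp_space_eq[OF sets_gauss_n])
    define Hit where "Hit S w z \<longleftrightarrow> quad_dist n S w (\<lambda>i. sqrt (real (lev S) * \<alpha>) * z i) \<le> real n * (D S + 3 * \<alpha>)" for S w z
    define bd where "bd S C' = {w \<in> space (gauss_n n) - Bad S. \<forall>k<M. \<not> Hit S w (C' k)}" for S and C' :: "nat \<Rightarrow> nat \<Rightarrow> real"
    have "\<exists>C' \<in> {..<M} \<rightarrow> space (gauss_n n).
      (\<forall>s\<in>N. bd s C' \<in> sets (gauss_n n) \<and> emeasure (gauss_n n) (bd s C') \<le> ennreal (1 / real n)) \<and>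
      (\<Sum>k<M. ennreal (\<Sum>i<n. (C' k i)\<^sup>2)) \<le> ennreal (2 * real M * real n)"
      unfolding bd_def
    proof (rule random_codebook[where \<theta> = \<theta>])
      show "prob_space (gauss_n n)" "prob_space (gauss_n n)" by (rule prob_space_gauss_n)+
      show "finite N" by (rule N)
      show "Measurable.pred (gauss_n n \<Otimes>\<^sub>M gauss_n n) (\<lambda>(w, z). Hit S w z)" if "S \<in> N" for S
      proof -
        have S: "S \<in> carrier_mat n n" using that N by (auto simp: P_def psd_mat_def)
        show ?thesis unfolding Hit_def quad_dist_eq[OF S] by measurable
      qed
      show "Bad S \<in> sets (gauss_n n)" if "S \<in> N" for S using Bad[OF that] by (simp add: sets_gauss_n)
      show "0 \<le> \<theta>" "\<theta> \<le> 1" by (rule \<theta>)+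
      show "ennreal \<theta> \<le> (\<integral>\<^sup>+z. indicator {z. Hit S w z} z \<partial>gauss_n n)" if "S \<in> N" "w \<in> space (gauss_n n) - Bad S" for S w
        using hit[OF that(1)] that(2) unfolding sp Hit_def by blast
      show "(\<lambda>z. ennreal (\<Sum>i<n. (z i)\<^sup>2)) \<in> borel_measurable (gauss_n n)" by measurable
      show "(\<integral>\<^sup>+z. ennreal (\<Sum>i<n. (z i)\<^sup>2) \<partial>gauss_n n) \<le> ennreal (real n)" by (simp add: gauss_n_norm2)
      show "0 < real n" "0 < real n" "0 < M" using n M by auto
      have "2 * (real n / \<tau>) + 4 \<le> 20 * (real n)\<^sup>2 * X / \<alpha> + 4"
      proof -
        have "2 * (real n / \<tau>) = 20 * (real n)\<^sup>2 * real M / \<alpha>"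
          using \<alpha>(1) by (simp add: \<tau>_def power2_eq_square)
        also have "\<dots> \<le> 20 * (real n)\<^sup>2 * X / \<alpha>" using M \<alpha>(1) by (intro divide_right_mono mult_left_mono) auto
        finally show ?thesis by simp
      qed
      then have "(2 * (real n / \<tau>) + 4) ^ (n * n) \<le> (20 * (real n)\<^sup>2 * X / \<alpha> + 4) ^ (n * n)"
        using \<tau> by (intro power_mono) auto
      then have "real (card N) \<le> (20 * (real n)\<^sup>2 * X / \<alpha> + 4) ^ (n * n)" using cN by linarith
      moreover have "exp (- (real M * \<theta>)) \<le> exp (- ((X - 1) * \<theta>))" using M \<theta> by (simp add: mult_right_mono)
      ultimately have "real (card N) * real n * exp (- (real M * \<theta>)) \<le> (20 * (real n)\<^sup>2 * X / \<alpha> + 4) ^ (n * n) * real n * exp (- ((X - 1) * \<theta>))"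
        by (intro mult_mono) auto
      then show "real (card N) * real n * exp (- (real M * \<theta>)) < 1 / 2" using Xsmall by (simp add: \<theta>_def)
    qed
    then obtain z where bdm: "\<And>S. S \<in> N \<Longrightarrow> bd S z \<in> sets (leb_n n)"
      and bde: "\<And>S. S \<in> N \<Longrightarrow> emeasure (gauss_n n) (bd S z) \<le> ennreal (1 / real n)"
      and zsum: "(\<Sum>k<M. ennreal (\<Sum>i<n. (z k i)\<^sup>2)) \<le> ennreal (2 * real M * real n)"
      by (auto simp: sets_gauss_n)
    \<comment> \<open>Only the sum of the energies is known, so each codeword inherits the bound for
      the total. The factor M, exponential in n, is compensated by the same factor in
      \<tau>.\<close>
    have znorm: "(\<Sum>i<n. (z k i)\<^sup>2) \<le> 2 * real M * real n" if "k < M" for k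
    proof -
      have "ennreal (\<Sum>k<M. \<Sum>i<n. (z k i)\<^sup>2) \<le> ennreal (2 * real M * real n)"
        using zsum by (subst (asm) sum_ennreal) (auto intro: sum_nonneg)
      then have "(\<Sum>k<M. \<Sum>i<n. (z k i)\<^sup>2) \<le> 2 * real M * real n" by (subst (asm) ennreal_le_iff) auto
      moreover have "(\<Sum>i<n. (z k i)\<^sup>2) \<le> (\<Sum>k<M. \<Sum>i<n. (z k i)\<^sup>2)"
        using that by (intro member_le_sum) (auto intro: sum_nonneg)
      ultimately show ?thesis by linarith
    qed
    define Q where "Q = K * M + 1"
    \<comment> \<open>Message 1 is the zero codeword and message \<open>(m - 1) * M + k + 2\<close>
      is codeword \<open>k\<close> at variance level \<open>m\<close>, hence the shift by 2.\<close>
    define cw where "cw i = (if i \<le> 1 then (\<lambda>_. 0) else (\<lambda>l. sqrt (real ((i - 2) div M + 1) * \<alpha>) * z ((i - 2) mod M) l))" for i :: nat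
    have Q0: "0 < Q" by (simp add: Q_def)
    have QX: "Q \<le> nat \<lfloor>2 powr (real n * (R + \<epsilon>))\<rfloor>"
    proof -
      have "real Q \<le> real K * X + 2" using mult_left_mono[OF M(2), of "real K"] by (simp add: Q_def)
      then have "real Q \<le> 2 powr (real n * (R + \<epsilon>))" using XQ by linarith
      then have "int Q \<le> \<lfloor>2 powr (real n * (R + \<epsilon>))\<rfloor>" by (simp add: le_floor_iff)
      then show ?thesis by linarith
    qed
    have cw0: "cw 1 = (\<lambda>_. 0)" "1 \<in> {1..Q}" by (auto simp: cw_def Q_def)
    have cwk: "\<exists>j\<in>{1..Q}. cw j = (\<lambda>l. sqrt (real m * \<alpha>) * z k l)" if mk: "m \<in> {1..K}" "k < M" for m k
    proof
      let ?j = "(m - 1) * M + k + 2"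
      have "(m - 1) * M + k < (m - 1) * M + M" using mk by simp
      also have "\<dots> = m * M" using mk by (metis Suc_pred' add.commute atLeastAtMost_iff mult_Suc less_eq_Suc_le One_nat_def)
      also have "\<dots> \<le> K * M" using mk by simp
      finally show "?j \<in> {1..Q}" by (simp add: Q_def)
      have "(?j - 2) div M + 1 = m" "(?j - 2) mod M = k" using mk M by auto
      then show "cw ?j = (\<lambda>l. sqrt (real m * \<alpha>) * z k l)" by (simp add: cw_def)
    qed
    have "(\<integral>\<^sup>+w. ennreal (u w) \<partial>gauss_n n) \<le> ennreal (real n * (D_rc (spec S) R + \<eta>))"
      if psd: "psd_mat n S" and tr: "mat_trace S = real n" 
        and u: "\<And>w j. w \<in> space (leb_n n) \<Longrightarrow> j \<in> {1..Q} \<Longrightarrow> u w \<le> quad_dist n S w (cw j)" for S u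
    proof -
      have SP: "S \<in> P" using psd tr by (simp add: P_def)
      obtain S' where S': "S' \<in> N" and close: "\<And>i j. i < n \<Longrightarrow> j < n \<Longrightarrow> \<bar>S $$ (i, j) - S' $$ (i, j)\<bar> \<le> \<tau>"
        and DS': "D S' \<le> D S + \<alpha>" using net[OF SP] by blast
      have car: "S \<in> carrier_mat n n" "S' \<in> carrier_mat n n"
        using psd S' N by (auto simp: P_def psd_mat_def)
      let ?x = "\<lambda>w. quad_dist n S w (\<lambda>_. 0)"
      let ?B = "Bad S' \<union> bd S' z"
      let ?d = "real n * (D S' + 3 * \<alpha>) + real n * \<tau> * (8 * real M * real n)"
      have B[measurable]: "?B \<in> sets (leb_n n)" using Bad[OF S'] bdm[OF S'] by auto
      have d0: "0 \<le> ?d" using D0[of S'] S' N \<alpha> \<tau> by (auto intro!: add_nonneg_nonneg mult_nonneg_nonneg)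
      \<comment> \<open>Off \<open>?B\<close> the first two terms suffice: the target distortion and
        the perturbation from \<open>S'\<close> to \<open>S\<close>. On \<open>?B\<close> the zero
        codeword is available, and \<open>linear_le_quadratic\<close> with \<beta> equal to
        \<open>\<alpha> / real n\<close> supplies the last two. All terms are nonnegative, so their
        sum covers both cases.\<close>
      have ubound: "u w \<le> ?d + 2 * real n * \<tau> * (\<Sum>i<n. (w i)\<^sup>2) + \<alpha> / real n * (?x w)\<^sup>2 + real n / (4 * \<alpha>) * indicator ?B w"
        if w: "w \<in> space (leb_n n)" for w
      proof (cases "w \<in> ?B")
        case True
        have "u w \<le> ?x w" using u[OF w cw0(2)] unfolding cw0(1) .
        also have "\<dots> \<le> \<alpha> / real n * (?x w)\<^sup>2 + 1 / (4 * (\<alpha> / real n))"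
          using \<alpha> n by (intro linear_le_quadratic) auto
        also have "1 / (4 * (\<alpha> / real n)) = real n / (4 * \<alpha>)" using n by simp
        finally have "u w \<le> \<alpha> / real n * (?x w)\<^sup>2 + real n / (4 * \<alpha>) * indicator ?B w" using True by simp
        moreover have "0 \<le> 2 * real n * \<tau> * (\<Sum>i<n. (w i)\<^sup>2)" using \<tau> by (intro mult_nonneg_nonneg sum_nonneg) auto
        ultimately show ?thesis using d0 by linarith
      next
        case False
        then obtain k where k: "k < M" "Hit S' w (z k)" using w by (auto simp: bd_def sp)
        let ?s = "sqrt (real (lev S') * \<alpha>)"
        have s2: "?s\<^sup>2 \<le> 2"
        proof -
          have "real (lev S') \<le> real K" using lev[OF S'] by simp
          also have "real K = of_int \<lceil>1 / \<alpha>\<rceil>" using \<alpha>(1) by (simp add: K_def)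
          also have "\<dots> \<le> 1 / \<alpha> + 1" by linarith
          finally have "real (lev S') * \<alpha> \<le> (1 / \<alpha> + 1) * \<alpha>" using \<alpha>(1) by (intro mult_right_mono) auto
          also have "\<dots> = 1 + \<alpha>" using \<alpha>(1) by (simp add: distrib_right)
          finally show ?thesis using \<alpha> by simp
        qed
        obtain j where j: "j \<in> {1..Q}" "cw j = (\<lambda>l. ?s * z k l)" using cwk[OF lev[OF S'] k(1)] by blast
        have "u w \<le> quad_dist n S w (\<lambda>l. ?s * z k l)" using u[OF w j(1)] j(2) by simp
        also have "\<dots> \<le> quad_dist n S' w (\<lambda>l. ?s * z k l) + real n * \<tau> * (\<Sum>i<n. (w i - ?s * z k i)\<^sup>2)"
          by (rule quad_dist_perturb[OF car close])
        also have "\<dots> \<le> real n * (D S' + 3 * \<alpha>) + real n * \<tau> * (2 * (\<Sum>i<n. (w i)\<^sup>2) + 8 * real M * real n)"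
        proof (intro add_mono mult_left_mono)
          show "quad_dist n S' w (\<lambda>l. ?s * z k l) \<le> real n * (D S' + 3 * \<alpha>)" using k(2) by (simp add: Hit_def)
          have "(\<Sum>i<n. (w i - ?s * z k i)\<^sup>2) \<le> (\<Sum>i<n. 2 * (w i)\<^sup>2 + 4 * (z k i)\<^sup>2)"
          proof (rule sum_mono)
            fix i
            have "(w i - ?s * z k i)\<^sup>2 \<le> 2 * (w i)\<^sup>2 + 2 * (?s * z k i)\<^sup>2"
              using zero_le_power2[of "w i + ?s * z k i"] by (simp add: power2_eq_square algebra_simps)
            also have "(?s * z k i)\<^sup>2 \<le> 2 * (z k i)\<^sup>2" unfolding power_mult_distrib using s2 by (intro mult_right_mono) auto
            finally show "(w i - ?s * z k i)\<^sup>2 \<le> 2 * (w i)\<^sup>2 + 4 * (z k i)\<^sup>2" by simp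
          qed
          also have "\<dots> = 2 * (\<Sum>i<n. (w i)\<^sup>2) + 4 * (\<Sum>i<n. (z k i)\<^sup>2)" by (simp add: sum.distrib sum_distrib_left)
          finally show "(\<Sum>i<n. (w i - ?s * z k i)\<^sup>2) \<le> 2 * (\<Sum>i<n. (w i)\<^sup>2) + 8 * real M * real n"
            using znorm[OF k(1)] by simp
        qed (use \<tau> in auto)
        also have "\<dots> = ?d + 2 * real n * \<tau> * (\<Sum>i<n. (w i)\<^sup>2)" by (simp add: algebra_simps)
        finally have "u w \<le> ?d + 2 * real n * \<tau> * (\<Sum>i<n. (w i)\<^sup>2)" .
        moreover have "0 \<le> \<alpha> / real n * (?x w)\<^sup>2" using \<alpha> by simp
        moreover have "0 \<le> real n / (4 * \<alpha>) * indicator ?B w" using \<alpha> by simp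
        ultimately show ?thesis by linarith
      qed
      have c1: "0 \<le> 2 * real n * \<tau>" and c2: "0 \<le> \<alpha> / real n" and c3: "0 \<le> real n / (4 * \<alpha>)" using \<tau> \<alpha> by auto
      have xm[measurable]: "?x \<in> borel_measurable (leb_n n)" unfolding quad_dist_eq[OF car(1)] by measurable
      interpret G: prob_space "gauss_n n" by (rule prob_space_gauss_n)
      have "(\<integral>\<^sup>+w. ennreal (u w) \<partial>gauss_n n) \<le> (\<integral>\<^sup>+w. ((ennreal ?d + ennreal (2 * real n * \<tau>) * ennreal (\<Sum>i<n. (w i)\<^sup>2)) + ennreal (\<alpha> / real n) * ennreal ((?x w)\<^sup>2)) + ennreal (real n / (4 * \<alpha>)) * indicator ?B w \<partial>gauss_n n)"
      proof (rule nn_integral_mono)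
        fix w assume "w \<in> space (gauss_n n)"
        then have "ennreal (u w) \<le> ennreal (?d + 2 * real n * \<tau> * (\<Sum>i<n. (w i)\<^sup>2) + \<alpha> / real n * (?x w)\<^sup>2 + real n / (4 * \<alpha>) * indicator ?B w)"
          unfolding sp by (intro ennreal_leI ubound)
        also have "\<dots> = ((ennreal ?d + ennreal (2 * real n * \<tau>) * ennreal (\<Sum>i<n. (w i)\<^sup>2)) + ennreal (\<alpha> / real n) * ennreal ((?x w)\<^sup>2)) + ennreal (real n / (4 * \<alpha>)) * indicator ?B w"
        proof -
          have "ennreal (indicator ?B w) = indicator ?B w" by (simp add: indicator_def)
          moreover have "0 \<le> (\<Sum>i<n. (w i)\<^sup>2)" by (intro sum_nonneg) auto
          ultimately show ?thesis using ennreal_affine_combination[OF d0 c1 c2 c3, of "\<Sum>i<n. (w i)\<^sup>2" "(?x w)\<^sup>2" "indicator ?B w"] by simp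
        qed
        finally show "ennreal (u w) \<le> \<dots>" .
      qed
      also have "\<dots> = ennreal ?d + ennreal (2 * real n * \<tau>) * ennreal (real n) + ennreal (\<alpha> / real n) * (\<integral>\<^sup>+w. ennreal ((?x w)\<^sup>2) \<partial>gauss_n n) + ennreal (real n / (4 * \<alpha>)) * emeasure (gauss_n n) ?B"
        using B by (simp add: nn_integral_add nn_integral_cmult gauss_n_norm2 G.emeasure_space_1 sets_gauss_n nn_integral_cmult_indicator)
      also have "\<dots> \<le> ennreal ?d + ennreal (2 * real n * \<tau>) * ennreal (real n) + ennreal (\<alpha> / real n) * ennreal (3 * (real n)\<^sup>2) + ennreal (real n / (4 * \<alpha>)) * ennreal ((C + 1) / real n)"
      proof (intro add_mono mult_left_mono order_refl)
        show "(\<integral>\<^sup>+w. ennreal ((?x w)\<^sup>2) \<partial>gauss_n n) \<le> ennreal (3 * (real n)\<^sup>2)" by (rule quad_dist_second_moment[OF psd tr])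
        have "emeasure (gauss_n n) ?B \<le> emeasure (gauss_n n) (Bad S') + emeasure (gauss_n n) (bd S' z)"
          using Bad[OF S'] bdm[OF S'] by (intro emeasure_subadditive) (auto simp: sets_gauss_n)
        also have "\<dots> \<le> ennreal (C / real n) + ennreal (1 / real n)" by (intro add_mono eBad bde S')
        also have "\<dots> = ennreal ((C + 1) / real n)" using C by (simp add: add_divide_distrib flip: ennreal_plus)
        finally show "emeasure (gauss_n n) ?B \<le> ennreal ((C + 1) / real n)" .
      qed auto
      also have "\<dots> = ennreal (?d + 2 * real n * \<tau> * real n + \<alpha> / real n * (3 * (real n)\<^sup>2) + real n / (4 * \<alpha>) * ((C + 1) / real n))"
        using C by (intro ennreal_affine_combination[symmetric] d0 c1 c2 c3) auto
      also have "\<dots> \<le> ennreal (real n * (D_rc (spec S) R + \<eta>))"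
      proof (rule ennreal_leI)
        have "real n * \<tau> * (8 * real M * real n) + 2 * real n * \<tau> * real n \<le> real n * \<alpha>"
        proof -
          have "real n * \<tau> * (8 * real M * real n) + 2 * real n * \<tau> * real n \<le> real n * \<tau> * (10 * real M * real n)"
          proof -
            have "real n * \<tau> * (2 * real n * 1) \<le> real n * \<tau> * (2 * real n * real M)"
              using \<tau> M by (intro mult_left_mono) auto
            then show ?thesis by (simp add: algebra_simps)
          qed
          also have "\<dots> = real n * \<alpha>" using n M by (simp add: \<tau>_def)
          finally show ?thesis .
        qed
        moreover have "\<alpha> / real n * (3 * (real n)\<^sup>2) = real n * (3 * \<alpha>)" using n by (simp add: power2_eq_square)
        \<comment> \<open>A probability of order 1/n meets a weight of order n; the resulting
          constant is dominated by the lower bound imposed on n.\<close>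
        moreover have "real n / (4 * \<alpha>) * ((C + 1) / real n) \<le> real n * \<alpha>"
        proof -
          have "real n / (4 * \<alpha>) * ((C + 1) / real n) = (C + 1) / (4 * \<alpha>\<^sup>2) * \<alpha>"
            using n \<alpha>(1) by (simp add: power2_eq_square)
          also have "\<dots> \<le> real n * \<alpha>" using nC \<alpha>(1) by (intro mult_right_mono) auto
          finally show ?thesis .
        qed
        moreover have "real n * (D S' + 3 * \<alpha>) \<le> real n * (D S + 4 * \<alpha>)" using DS' by (intro mult_left_mono) auto
        \<comment> \<open>Slack in units of \<alpha>: 3 from the hitting event, 1 from the
          near-minimiser of the cell, 1 for the perturbation, 3 for the second moment, 1 for the
          exceptional probability.\<close>
        ultimately have "?d + 2 * real n * \<tau> * real n + \<alpha> / real n * (3 * (real n)\<^sup>2) + real n / (4 * \<alpha>) * ((C + 1) / real n)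
          \<le> real n * (D S + 4 * \<alpha>) + real n * \<alpha> + real n * (3 * \<alpha>) + real n * \<alpha>" by linarith
        also have "\<dots> = real n * (D S + 9 * \<alpha>)" by (simp add: algebra_simps)
        also have "\<dots> \<le> real n * (D S + \<eta>)" using \<alpha> \<eta> by (intro mult_left_mono) auto
        finally show "?d + 2 * real n * \<tau> * real n + \<alpha> / real n * (3 * (real n)\<^sup>2) + real n / (4 * \<alpha>) * ((C + 1) / real n) \<le> real n * (D_rc (spec S) R + \<eta>)"
          by (simp add: D_def)
      qed
      finally show ?thesis .
    qed
    then show "\<exists>(Q::nat) (cw :: nat \<Rightarrow> nat \<Rightarrow> real).
    0 < Q \<and> Q \<le> nat \<lfloor>2 powr (real n * (R + \<epsilon>))\<rfloor> \<and>
    (\<forall>S. psd_mat n S \<and> mat_trace S = real n \<longrightarrow>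
      (\<forall>u. (\<forall>w\<in>space (leb_n n). \<forall>j\<in>{1..Q}. u w \<le> quad_dist n S w (cw j)) \<longrightarrow>
        (\<integral>\<^sup>+w. ennreal (u w) \<partial>gauss_n n) \<le> ennreal (real n * (D_rc (spec S) R + \<eta>))))"
      using Q0 QX by (intro exI[of _ Q] exI[of _ cw]) blast
  qed
qed

section \<open>Encoder and decoder from the universal codebook\<close>

theorem theorem2p2:
  fixes Rstar \<epsilon> \<eta> B :: real
  assumes "Rstar > 0" "\<epsilon> > 0" "\<eta> > 0" "B > 0"
  shows "\<exists>n0::nat. \<forall>n\<ge>n0. \<exists>(R::real) (f :: (nat \<Rightarrow> real) \<Rightarrow> real mat \<Rightarrow> real \<Rightarrow> nat)
            (g :: nat \<Rightarrow> real \<Rightarrow> real vec).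
     R \<le> Rstar + \<epsilon> \<and>
     (\<forall>w \<in> space (gauss_n n). \<forall>\<Sigma>. \<forall>s\<in>{0..1}. psd_mat n \<Sigma> \<longrightarrow>
         f w \<Sigma> s \<in> {1..nat \<lfloor>2 powr (real n * R)\<rfloor>}) \<and>
     (\<forall>k \<in> {1..nat \<lfloor>2 powr (real n * R)\<rfloor>}. \<forall>s\<in>{0..1}. g k s \<in> carrier_vec n) \<and>
     (\<forall>\<Sigma>. \<forall>s\<in>{0..1}. psd_mat n \<Sigma> \<longrightarrow>
         (\<lambda>w. f w \<Sigma> s) \<in> measurable (gauss_n n) (count_space UNIV)) \<and>
     (\<exists>A \<in> sets lborel.
        A \<subseteq> {s \<in> {0..1}. \<forall>\<Sigma>. psd_mat n \<Sigma> \<and> mat_trace \<Sigma> = real n \<longrightarrow>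
              (1 / real n) * (\<integral>w. d_Sigma \<Sigma> (vec n w) (g (f w \<Sigma> s) s) \<partial>gauss_n n)
                \<le> D_rc (spec \<Sigma>) Rstar + \<eta>} \<and>
        measure lborel A \<ge> 1 - exp (- (real n powr B)))"
proof -
  obtain n0 :: nat where n0: "\<And>n. n0 \<le> n \<Longrightarrow> 0 < n \<and> (\<exists>(Q::nat) (cw :: nat \<Rightarrow> nat \<Rightarrow> real).
    0 < Q \<and> Q \<le> nat \<lfloor>2 powr (real n * (Rstar + \<epsilon>))\<rfloor> \<and>
    (\<forall>S. psd_mat n S \<and> mat_trace S = real n \<longrightarrow>
      (\<forall>u. (\<forall>w\<in>space (leb_n n). \<forall>j\<in>{1..Q}. u w \<le> quad_dist n S w (cw j)) \<longrightarrow>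
        (\<integral>\<^sup>+w. ennreal (u w) \<partial>gauss_n n) \<le> ennreal (real n * (D_rc (spec S) Rstar + \<eta>)))))"
    using universal_codebook[OF assms(1-3)] by blast
  show ?thesis
  proof (intro exI[of _ n0] allI impI)
    fix n assume "n0 \<le> n"
    obtain Q cw where n: "0 < n" and Q: "0 < Q" "Q \<le> nat \<lfloor>2 powr (real n * (Rstar + \<epsilon>))\<rfloor>"
      and code: "\<forall>S. psd_mat n S \<and> mat_trace S = real n \<longrightarrow>
        (\<forall>u. (\<forall>w\<in>space (leb_n n). \<forall>j\<in>{1..Q}. u w \<le> quad_dist n S w (cw j)) \<longrightarrow>
          (\<integral>\<^sup>+w. ennreal (u w) \<partial>gauss_n n) \<le> ennreal (real n * (D_rc (spec S) Rstar + \<eta>)))"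
      using n0[OF \<open>n0 \<le> n\<close>] by blast
    define opt where "opt S w k \<longleftrightarrow> k \<in> {1..Q} \<and> (\<forall>j\<in>{1..Q}. quad_dist n S w (cw k) \<le> quad_dist n S w (cw j))" for S w k
    \<comment> \<open>The encoder minimises the distortion and breaks ties by the smallest index.
      Optimality of an index is decided by finitely many comparisons of measurable functions, so
      \<open>LEAST\<close> keeps the encoder measurable.\<close>
    define f where "f w S s = (LEAST k. opt S w k)" for w S and s :: real
    define g where "g k s = vec n (cw k)" for k and s :: real
    have opt: "opt S w (f w S s)" for S w s
    proof -
      have ne: "finite ((\<lambda>j. quad_dist n S w (cw j)) ` {1..Q})" "(\<lambda>j. quad_dist n S w (cw j)) ` {1..Q} \<noteq> {}" using Q by auto
      obtain k where "k \<in> {1..Q}" "quad_dist n S w (cw k) = Min ((\<lambda>j. quad_dist n S w (cw j)) ` {1..Q})"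
        using Min_in[OF ne] by auto
      then have "opt S w k" using Min_le[OF ne(1)] by (auto simp: opt_def)
      then show ?thesis unfolding f_def by (rule LeastI)
    qed
    have meas: "(\<lambda>w. f w S s) \<in> measurable (gauss_n n) (count_space UNIV)" if "psd_mat n S" for S s
    proof -
      have S: "S \<in> carrier_mat n n" using that by (simp add: psd_mat_def)
      have dm: "(\<lambda>w. quad_dist n S w c) \<in> borel_measurable (gauss_n n)" for c
        unfolding quad_dist_eq[OF S] by measurable
      have le: "Measurable.pred (gauss_n n) (\<lambda>w. quad_dist n S w c \<le> quad_dist n S w c')" for c c'
        unfolding pred_def by (rule borel_measurable_le[OF dm dm])
      have "(\<lambda>w. opt S w k) \<in> measurable (gauss_n n) (count_space UNIV)" for k
        unfolding opt_def by (intro pred_intros_logic pred_intros_finite le) auto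
      then show ?thesis unfolding f_def by (rule measurable_Least)
    qed
    have good: "(1 / real n) * (\<integral>w. d_Sigma S (vec n w) (g (f w S s) s) \<partial>gauss_n n) \<le> D_rc (spec S) Rstar + \<eta>"
      if psd: "psd_mat n S" and tr: "mat_trace S = real n" for S s
    proof -
      \<comment> \<open>The distortion achieved by the encoder is itself a function below all
        codeword distortions.\<close>
      have le: "(\<integral>\<^sup>+w. ennreal (quad_dist n S w (cw (f w S s))) \<partial>gauss_n n) \<le> ennreal (real n * (D_rc (spec S) Rstar + \<eta>))"
        using opt by (intro code[rule_format]) (auto simp: opt_def psd tr)
      obtain V lam where "orth_n n V" and lam: "\<forall>i<n. 0 \<le> lam i"
        and sp: "spec S = image_mset lam (mset_set {..<n})" and tr': "mat_trace S = (\<Sum>i<n. lam i)"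
        and "\<forall>w c. quad_dist n S w c = (\<Sum>i<n. lam i * (lin_n n V w i - lin_n n V c i)\<^sup>2)"
        using psd_mat_quad_dist_spectral[OF psd] by blast
      \<comment> \<open>Passing from the nonnegative integral to the Bochner integral requires a
        nonnegative bound on the right.\<close>
      have "0 \<le> D_rc (spec S) Rstar" unfolding sp using bounded_T_rc(1)[OF n lam[rule_format] _ assms(1,3)] tr tr' by simp
      then have "(\<integral>w. quad_dist n S w (cw (f w S s)) \<partial>gauss_n n) \<le> real n * (D_rc (spec S) Rstar + \<eta>)"
        using assms(3) by (intro integral_real_bounded le) auto
      then show ?thesis using n by (simp add: quad_dist_def g_def field_simps)
    qed
    show "\<exists>(R::real) (f :: (nat \<Rightarrow> real) \<Rightarrow> real mat \<Rightarrow> real \<Rightarrow> nat)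
            (g :: nat \<Rightarrow> real \<Rightarrow> real vec).
     R \<le> Rstar + \<epsilon> \<and>
     (\<forall>w \<in> space (gauss_n n). \<forall>\<Sigma>. \<forall>s\<in>{0..1}. psd_mat n \<Sigma> \<longrightarrow>
         f w \<Sigma> s \<in> {1..nat \<lfloor>2 powr (real n * R)\<rfloor>}) \<and>
     (\<forall>k \<in> {1..nat \<lfloor>2 powr (real n * R)\<rfloor>}. \<forall>s\<in>{0..1}. g k s \<in> carrier_vec n) \<and>
     (\<forall>\<Sigma>. \<forall>s\<in>{0..1}. psd_mat n \<Sigma> \<longrightarrow>
         (\<lambda>w. f w \<Sigma> s) \<in> measurable (gauss_n n) (count_space UNIV)) \<and>
     (\<exists>A \<in> sets lborel.
        A \<subseteq> {s \<in> {0..1}. \<forall>\<Sigma>. psd_mat n \<Sigma> \<and> mat_trace \<Sigma> = real n \<longrightarrow>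
              (1 / real n) * (\<integral>w. d_Sigma \<Sigma> (vec n w) (g (f w \<Sigma> s) s) \<partial>gauss_n n)
                \<le> D_rc (spec \<Sigma>) Rstar + \<eta>} \<and>
        measure lborel A \<ge> 1 - exp (- (real n powr B)))"
    \<comment> \<open>The good seeds fill the whole unit interval, whose measure 1 meets the
      required bound.\<close>
    proof (intro exI[of _ "Rstar + \<epsilon>"] exI[of _ f] exI[of _ g] conjI bexI[of _ "{0..1}"] ballI allI impI)
      show "f w S s \<in> {1..nat \<lfloor>2 powr (real n * (Rstar + \<epsilon>))\<rfloor>}" for w S s
        using opt[of S w s] Q by (auto simp: opt_def)
      show "g k s \<in> carrier_vec n" for k s by (simp add: g_def)
      show "(\<lambda>w. f w S s) \<in> measurable (gauss_n n) (count_space UNIV)" if "psd_mat n S" for S s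
        by (rule meas[OF that])
      show "{0..1} \<subseteq> {s \<in> {0..1}. \<forall>\<Sigma>. psd_mat n \<Sigma> \<and> mat_trace \<Sigma> = real n \<longrightarrow>
              (1 / real n) * (\<integral>w. d_Sigma \<Sigma> (vec n w) (g (f w \<Sigma> s) s) \<partial>gauss_n n)
                \<le> D_rc (spec \<Sigma>) Rstar + \<eta>}" using good by blast
    qed auto
  qed
qed

end
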